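(* Let $S\subset\Omega$ be a finite set and let $V:\Omega\to[0,+\infty]$ be measurable with $V\in L^\infty\big(\Omega\setminus\bigcup_{x\in S}B_\rho(x)\big)$ for all $\rho>0$. Let $\mu\in\mathcal M(\Omega)$ and let $\mu_r$ be its reduced measure. Then $$\mu_r=\mu-\sum_{x\in Z}\mu(\{x\})\,\delta_x,$$ where $Z=\{x\in\Omega:\text{ there is no solution of }u=\mathcal G(\delta_x-Vu)\text{ such that }u,Vu\in L^1(\Omega)\}$.
   Context: Setting: $n\ge 3$, $0<s\le 1$, $0<\gamma\le 1$, $\Omega\subset\mathbb R^n$ is a bounded domain, $\delta(x)=\mathrm{dist}(x,\partial\Omega)$ as a function, while $\delta_x$ is the Dirac measure at $x$. The Green operator is $\mathcal G(f)(x)=\int_\Omega \mathbb G(x,y)f(y)\,dy$, where the kernel $\mathbb G\ge 0$ on $\Omega\times\Omega$ satisfies: (G1) $\mathbb G(x,y)=\mathbb G(y,x)$; (G2) there are constants $0<c\le C$ with $c\,K(x,y)\le \mathbb G(x,y)\le C\,K(x,y)$, where $K(x,y)=\frac{1}{|x-y|^{n-2s}}\left(\min\left\{\frac{\delta(x)\delta(y)}{|x-y|^2},1\right\}\right)^\gamma$; (G3) $\int_\Omega f\,\mathcal G(f)\,dx\ge 0$ for all $f\in L^2(\Omega)$; (G4) $\mathcal G$ maps $L^\infty(\Omega)$ into $\mathcal C(\overline\Omega)$. $\mathcal M(\Omega)$ is the space of finite signed Radon measures on $\Omega$. For $\mu\in\mathcal M(\Omega)$, $\mathcal G(\mu)(x)=\int_\Omega\mathbb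 G(x,y)\,d\mu(y)$, a function in $L^1(\Omega)$. For $0\le W\in L^\infty(\Omega)$ and $\mu\in\mathcal M(\Omega)$, $\mathcal G_W(\mu)$ denotes the unique $u\in L^1(\Omega)$ with $u=\mathcal G(\mu-Wu)$. Reduced measure: for $\mu\ge0$ in $\mathcal M(\Omega)$ and $\varepsilon>0$ put $V_\varepsilon=\min\{V,1/\varepsilon\}$ and $u_\varepsilon=\mathcal G_{V_\varepsilon}(\mu)$. As $\varepsilon\to0$, $u_\varepsilon$ decreases to a limit $\underline u$ in $L^1(\Omega)$, and there are constants $\alpha_\mu^x\in\mathbb R$ ($x\in S$) such that $V_\varepsilon u_\varepsilon\rightharpoonup V\underline u+\sum_{x\in S}\alpha^x_\mu\delta_x$ in the sense that $\int_\Omega \varphi\delta^\gamma V_\varepsilon u_\varepsilon\,dx\to\int_\Omega\varphi\delta^\gamma V\underline u\,dx+\sum_{x\in S}\alpha_\mu^x\varphi(x)\delta(x)^\gamma$ for all $\varphi\in\mathcal C_0(\Omega)$. The reduced measure is $\mu_r=\mu-\sum_{x\in S}\alpha_\mu^x\delta_x$. For signed $\mu$, it is defined by linearity, $\alpha_\mu^x=\alpha_{\mu^+}^x-\alpha_{\mu^-}^x$. *)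

theory Defs
  imports "HOL-Analysis.Analysis" "HOL-Probability.Giry_Monad"
begin

abbreviation bdist :: "(real^'n) set \<Rightarrow> real^'n \<Rightarrow> real" where
  "bdist \<Omega> x \<equiv> infdist x (frontier \<Omega>)"

definition model_kernel :: "(real^'n) set \<Rightarrow> real \<Rightarrow> real \<Rightarrow> real^'n \<Rightarrow> real^'n \<Rightarrow> real" where
  "model_kernel \<Omega> s \<gamma> x y =
     1 / norm (x - y) powr (real CARD('n) - 2 * s)
       * min (bdist \<Omega> x * bdist \<Omega> y / (norm (x - y))\<^sup>2) 1 powr \<gamma>"

definition green_fun ::
  "(real^'n) set \<Rightarrow> (real^'n \<Rightarrow> real^'n \<Rightarrow> real) \<Rightarrow> (real^'n \<Rightarrow> real) \<Rightarrow> real^'n \<Rightarrow> real" where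
  "green_fun \<Omega> G f x = (\<integral>y. G x y * f y \<partial>lebesgue_on \<Omega>)"

definition green_meas :: "(real^'n \<Rightarrow> real^'n \<Rightarrow> real) \<Rightarrow> (real^'n) measure \<Rightarrow> real^'n \<Rightarrow> real" where
  "green_meas G \<mu> x = (\<integral>y. G x y \<partial>\<mu>)"

text \<open>The two-sided bound is imposed off the diagonal only, where the model kernel is finite.
  Diagonal values are irrelevant: they affect neither \<open>green_fun\<close> nor, for a finite measure,
  the almost-everywhere class of \<open>green_meas\<close>. Joint Borel measurability is what makes the
  potential of an arbitrary finite Borel measure meaningful. The last clause speaks about the
  pointwise-defined function \<open>green_fun \<Omega> G f\<close> on \<open>\<Omega>\<close>, not just about its almost-everywhere class.\<close>

definition green_kernel ::
  "(real^'n) set \<Rightarrow> real \<Rightarrow> real \<Rightarrow> (real^'n \<Rightarrow> real^'n \<Rightarrow> real) \<Rightarrow> bool" where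
  "green_kernel \<Omega> s \<gamma> G \<longleftrightarrow>
     (\<lambda>(x, y). G x y) \<in> borel_measurable (restrict_space borel (\<Omega> \<times> \<Omega>)) \<and>
     (\<forall>x\<in>\<Omega>. \<forall>y\<in>\<Omega>. 0 \<le> G x y) \<and>
     (\<forall>x\<in>\<Omega>. \<forall>y\<in>\<Omega>. G x y = G y x) \<and>
     (\<exists>c C. 0 < c \<and> c \<le> C \<and>
        (\<forall>x\<in>\<Omega>. \<forall>y\<in>\<Omega>. x \<noteq> y \<longrightarrow>
           c * model_kernel \<Omega> s \<gamma> x y \<le> G x y \<and> G x y \<le> C * model_kernel \<Omega> s \<gamma> x y)) \<and>
     (\<forall>f. f \<in> borel_measurable (lebesgue_on \<Omega>) \<and> integrable (lebesgue_on \<Omega>) (\<lambda>x. (f x)\<^sup>2) \<longrightarrow>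
        0 \<le> (\<integral>x. f x * green_fun \<Omega> G f x \<partial>lebesgue_on \<Omega>)) \<and>
     (\<forall>f. f \<in> borel_measurable (lebesgue_on \<Omega>) \<and> (\<exists>B. AE x in lebesgue_on \<Omega>. \<bar>f x\<bar> \<le> B) \<longrightarrow>
        (\<exists>g. continuous_on (closure \<Omega>) g \<and> (\<forall>x\<in>\<Omega>. g x = green_fun \<Omega> G f x)))"

text \<open>Finite signed Radon measures on \<open>\<Omega>\<close>, as countably additive real set functions on the Borel
  subsets of \<open>\<Omega>\<close>, set to \<open>0\<close> elsewhere so that equality of measures is equality of functions.
  On an open set in Euclidean space every finite Borel measure is Radon, and a nonnegative one is
  represented by a library measure.\<close>

definition signed_measures :: "(real^'n) set \<Rightarrow> ((real^'n) set \<Rightarrow> real) set" where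
  "signed_measures \<Omega> =
     {\<mu>. (\<forall>A. A \<notin> sets (restrict_space borel \<Omega>) \<longrightarrow> \<mu> A = 0) \<and>
         (\<forall>A :: nat \<Rightarrow> (real^'n) set.
            range A \<subseteq> sets (restrict_space borel \<Omega>) \<and> disjoint_family A \<longrightarrow>
              (\<lambda>i. \<mu> (A i)) sums \<mu> (\<Union>i. A i))}"

definition nonneg_measures :: "(real^'n) set \<Rightarrow> (real^'n) measure set" where
  "nonneg_measures \<Omega> = {\<mu>. sets \<mu> = sets (restrict_space borel \<Omega>) \<and> finite_measure \<mu>}"

text \<open>Jordan decomposition. The supremum is taken in \<^typ>\<open>ennreal\<close>, where \<open>ennreal\<close> of a
  negative number is \<open>0\<close>.\<close>

definition pos_part :: "(real^'n) set \<Rightarrow> ((real^'n) set \<Rightarrow> real) \<Rightarrow> (real^'n) measure" where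
  "pos_part \<Omega> \<mu> =
     measure_of \<Omega> (sets (restrict_space borel \<Omega>))
       (\<lambda>A. SUP B \<in> {B \<in> sets (restrict_space borel \<Omega>). B \<subseteq> A}. ennreal (\<mu> B))"

definition neg_part :: "(real^'n) set \<Rightarrow> ((real^'n) set \<Rightarrow> real) \<Rightarrow> (real^'n) measure" where
  "neg_part \<Omega> \<mu> = pos_part \<Omega> (\<lambda>A. - \<mu> A)"

definition dirac :: "(real^'n) set \<Rightarrow> real^'n \<Rightarrow> (real^'n) measure" where
  "dirac \<Omega> x = return (restrict_space borel \<Omega>) x"

text \<open>\<open>u, W u \<in> L\<^sup>1(\<Omega>)\<close> and \<open>u = G(\<mu> - W u)\<close> almost everywhere. For bounded measurable \<open>W\<close> the
  integrability of \<open>W u\<close> follows from that of \<open>u\<close>, and the solution is \<open>G\<^sub>W(\<mu>)\<close>.\<close>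

definition green_solution ::
  "(real^'n) set \<Rightarrow> (real^'n \<Rightarrow> real^'n \<Rightarrow> real) \<Rightarrow> (real^'n \<Rightarrow> real) \<Rightarrow> (real^'n) measure
     \<Rightarrow> (real^'n \<Rightarrow> real) \<Rightarrow> bool" where
  "green_solution \<Omega> G W \<mu> u \<longleftrightarrow>
     integrable (lebesgue_on \<Omega>) u \<and>
     integrable (lebesgue_on \<Omega>) (\<lambda>x. W x * u x) \<and>
     (AE x in lebesgue_on \<Omega>. u x = green_meas G \<mu> x - green_fun \<Omega> G (\<lambda>y. W y * u y) x)"

definition admissible_potential ::
  "(real^'n) set \<Rightarrow> (real^'n) set \<Rightarrow> (real^'n \<Rightarrow> ennreal) \<Rightarrow> bool" where
  "admissible_potential \<Omega> S V \<longleftrightarrow>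
     V \<in> borel_measurable (lebesgue_on \<Omega>) \<and>
     (\<forall>\<rho>>0. \<exists>B::real. AE x in lebesgue_on (\<Omega> - (\<Union>z\<in>S. ball z \<rho>)). V x \<le> ennreal B)"

definition truncate_pot :: "(real^'n \<Rightarrow> ennreal) \<Rightarrow> real \<Rightarrow> real^'n \<Rightarrow> real" where
  "truncate_pot V \<epsilon> x = enn2real (min (V x) (ennreal (1 / \<epsilon>)))"

text \<open>For \<open>\<mu> \<ge> 0\<close>: \<open>w \<epsilon>\<close> is \<open>G\<^sub>W(\<mu>)\<close> for the truncation \<open>W = min V (1/\<epsilon>)\<close>, \<open>u\<close> is its limit, and
  \<open>\<alpha>\<close> (on \<open>S\<close>) are the concentration coefficients. An admissible potential is finite almost
  everywhere, so the convention \<open>enn2real \<infinity> = 0\<close> does not affect \<open>V u\<close>.\<close>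

definition reduction_limit ::
  "(real^'n) set \<Rightarrow> real \<Rightarrow> (real^'n \<Rightarrow> real^'n \<Rightarrow> real) \<Rightarrow> (real^'n \<Rightarrow> ennreal) \<Rightarrow> (real^'n) set
     \<Rightarrow> (real^'n) measure \<Rightarrow> (real^'n \<Rightarrow> real) \<Rightarrow> (real^'n \<Rightarrow> real) \<Rightarrow> bool" where
  "reduction_limit \<Omega> \<gamma> G V S \<mu> u \<alpha> \<longleftrightarrow>
     (\<exists>w :: real \<Rightarrow> real^'n \<Rightarrow> real.
        (\<forall>\<epsilon>>0. green_solution \<Omega> G (truncate_pot V \<epsilon>) \<mu> (w \<epsilon>)) \<and>
        (\<forall>\<epsilon> \<epsilon>'. 0 < \<epsilon>' \<and> \<epsilon>' \<le> \<epsilon> \<longrightarrow> (AE x in lebesgue_on \<Omega>. w \<epsilon>' x \<le> w \<epsilon> x)) \<and>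
        integrable (lebesgue_on \<Omega>) u \<and>
        ((\<lambda>\<epsilon>. \<integral>x. \<bar>w \<epsilon> x - u x\<bar> \<partial>lebesgue_on \<Omega>) \<longlongrightarrow> 0) (at_right 0) \<and>
        (\<forall>\<phi> :: real^'n \<Rightarrow> real.
           continuous_on (closure \<Omega>) \<phi> \<and> (\<forall>x\<in>frontier \<Omega>. \<phi> x = 0) \<longrightarrow>
             integrable (lebesgue_on \<Omega>) (\<lambda>x. \<phi> x * bdist \<Omega> x powr \<gamma> * (enn2real (V x) * u x)) \<and>
             ((\<lambda>\<epsilon>. \<integral>x. \<phi> x * bdist \<Omega> x powr \<gamma> * (truncate_pot V \<epsilon> x * w \<epsilon> x) \<partial>lebesgue_on \<Omega>)
               \<longlongrightarrow> (\<integral>x. \<phi> x * bdist \<Omega> x powr \<gamma> * (enn2real (V x) * u x) \<partial>lebesgue_on \<Omega>)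
                   + (\<Sum>x\<in>S. \<alpha> x * \<phi> x * bdist \<Omega> x powr \<gamma>)) (at_right 0)))"

definition reduction_coeff ::
  "(real^'n) set \<Rightarrow> real \<Rightarrow> (real^'n \<Rightarrow> real^'n \<Rightarrow> real) \<Rightarrow> (real^'n \<Rightarrow> ennreal) \<Rightarrow> (real^'n) set
     \<Rightarrow> (real^'n) measure \<Rightarrow> real^'n \<Rightarrow> real" where
  "reduction_coeff \<Omega> \<gamma> G V S \<mu> = (SOME \<alpha>. \<exists>u. reduction_limit \<Omega> \<gamma> G V S \<mu> u \<alpha>)"

definition reduced_measure ::
  "(real^'n) set \<Rightarrow> real \<Rightarrow> (real^'n \<Rightarrow> real^'n \<Rightarrow> real) \<Rightarrow> (real^'n \<Rightarrow> ennreal) \<Rightarrow> (real^'n) set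
     \<Rightarrow> ((real^'n) set \<Rightarrow> real) \<Rightarrow> (real^'n) set \<Rightarrow> real" where
  "reduced_measure \<Omega> \<gamma> G V S \<mu> A =
     \<mu> A - (\<Sum>x\<in>S. (reduction_coeff \<Omega> \<gamma> G V S (pos_part \<Omega> \<mu>) x
                      - reduction_coeff \<Omega> \<gamma> G V S (neg_part \<Omega> \<mu>) x) * measure (dirac \<Omega> x) A)"

definition unsolvable_points ::
  "(real^'n) set \<Rightarrow> (real^'n \<Rightarrow> real^'n \<Rightarrow> real) \<Rightarrow> (real^'n \<Rightarrow> ennreal) \<Rightarrow> (real^'n) set" where
  "unsolvable_points \<Omega> G V =
     {x \<in> \<Omega>. \<not> (\<exists>u. green_solution \<Omega> G (\<lambda>y. enn2real (V y)) (dirac \<Omega> x) u)}"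

end

theory Submission
  imports Defs
begin


text \<open>
  Write \<open>w \<epsilon>\<close> for the solution with datum \<open>\<nu> \<ge> 0\<close> and potential \<open>min V (1 / \<epsilon>)\<close>, \<open>u\<close> for the limit of
  \<open>w \<epsilon>\<close>, and \<open>\<alpha>\<close> for the concentration coefficients. Everything rests on one formula: \<open>\<alpha> x\<close> is \<open>\<nu> {x}\<close> if the
  equation with datum \<open>\<delta>\<^sub>x\<close> is unsolvable, and \<open>0\<close> otherwise. The theorem follows by applying it to the two
  parts of the Jordan decomposition, whose masses at \<open>x\<close> differ by \<open>\<mu> {x}\<close>.

  Testing the equation of \<open>w \<epsilon>\<close> with bounded functions and passing to the limit gives
  \<open>u = G(\<nu> - V u - (\<Sum>z\<in>S. \<alpha> z \<delta>\<^sub>z))\<close> (\<open>red_identity\<close>). Suppose it is known that a measure produces no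
  concentration at a point that it does not charge (\<open>coefficient_zero_no_atom\<close>). By linearity it is
  then enough to treat \<open>\<nu> = \<delta>\<^sub>x\<close>, where the identity reads \<open>u = G((1 - \<alpha> x) \<delta>\<^sub>x - V u)\<close>. If \<open>\<alpha> x \<noteq> 1\<close>, then
  \<open>u / (1 - \<alpha> x)\<close> solves the equation with datum \<open>\<delta>\<^sub>x\<close>. Conversely, if that equation has a solution \<open>v\<close>,
  then \<open>u = v\<close> (\<open>stability\<close>), and comparing the two equations gives \<open>\<alpha> x = 0\<close>.

  A positive semidefinite kernel need not have a maximum principle, so \<open>w \<epsilon>\<close> and \<open>u\<close> may change sign. Positivity is
  replaced by the monotonicity of \<open>w \<epsilon>\<close> in \<open>\<epsilon>\<close>, which supplies the three bounds that are used. First,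
  \<open>u \<le> w \<epsilon>\<close>, so the negative part of \<open>min V (1 / \<epsilon>) * w \<epsilon>\<close> is dominated by the integrable function
  \<open>V * \<bar>u\<bar>\<close>; hence these functions are bounded in \<open>L\<^sup>1\<close> and \<open>\<alpha> \<ge> 0\<close>. Secondly, \<open>w \<epsilon> \<le> G \<nu>\<close>. Thirdly, an upper
  bound for a sum bounds its summands: if \<open>\<nu> \<ge> 2\<^sup>j \<nu>'\<close>, then the coefficients and the solutions of \<open>\<nu>'\<close> are of
  size \<open>2\<^sup>-\<^sup>j\<close> relative to fixed quantities that belong to \<open>\<nu>\<close>. Applied to one well-chosen measure
  \<open>\<Sum>j. 2\<^sup>j \<nu>\<^sub>j\<close> (\<open>rapid_sum\<close>), this plays the part of a uniform boundedness theorem.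

  No concentration at \<open>y\<close> is proved first for \<open>\<nu>\<close> vanishing near \<open>y\<close>. Solutions are locally bounded off \<open>S\<close>
  and the support of \<open>\<nu>\<close>, by iterating the Riesz-type bound of the kernel. Therefore the energies of
  \<open>f = min V (1 / \<epsilon>) * w \<epsilon>\<close> restricted to a ball about \<open>y\<close> stay bounded as \<open>\<epsilon> \<rightarrow> 0\<close>, whereas a point mass has
  infinite energy: pairing \<open>f\<close> with the indicator of a ball of radius \<open>r\<close>, positive semidefiniteness
  bounds the pairing by \<open>O(r\<^sup>n\<^sup>/\<^sup>2 \<^sup>+ \<^sup>s)\<close>, while a mass \<open>\<alpha> y\<close> at \<open>y\<close> would contribute a multiple of \<open>r\<^sup>2\<^sup>s\<close>, and
  \<open>n > 2 s\<close>. Weighted sums then pass from measures that vanish near \<open>y\<close> to measures with \<open>\<nu> {y} = 0\<close>.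
\<close>

section \<open>Riesz kernels\<close>

text \<open>Since \<open>0 powr a = 0\<close>, the kernel vanishes on the diagonal. This is a null set, and with this value the
  product estimate below also holds when \<open>z\<close> is one of the two poles.\<close>

definition riesz :: "real \<Rightarrow> 'a::euclidean_space \<Rightarrow> 'a \<Rightarrow> ennreal" where
  "riesz a x z = ennreal (norm (x - z) powr - a)"

lemma riesz_measurable [measurable (raw)]:
  assumes "f \<in> borel_measurable M" "g \<in> borel_measurable M"
  shows "(\<lambda>p. riesz a (f p) (g p)) \<in> borel_measurable M"
  unfolding riesz_def using assms by measurable

lemma riesz_commute: "riesz a x z = riesz a z x"
  by (simp add: riesz_def norm_minus_commute)

lemma riesz_le:
  assumes "d \<le> norm (x - z)" "0 < d" "0 \<le> a"
  shows "riesz a x z \<le> ennreal (d powr - a)"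
  unfolding riesz_def using assms by (intro ennreal_leI powr_mono2') auto

lemma ennreal_le_suminf: "(f :: nat \<Rightarrow> ennreal) k \<le> suminf f"
  using sum_le_suminf[OF summableI, of "{k}" f] by simp

lemma dyadic_shell:
  fixes d r :: real
  assumes "0 < d" "d < r"
  obtains k :: nat where "r / 2 ^ Suc k \<le> d" "d < r / 2 ^ k"
proof -
  obtain m :: nat where "r / d < 2 ^ m"
    using real_arch_pow[of 2 "r / d"] by auto
  hence ex: "r / 2 ^ m \<le> d" using assms by (simp add: field_simps)
  define m0 where "m0 = (LEAST m. r / 2 ^ m \<le> d)"
  have m0: "r / 2 ^ m0 \<le> d" unfolding m0_def using ex by (rule LeastI)
  have "m0 \<noteq> 0" using m0 assms by (intro notI) simp
  then obtain k where k: "m0 = Suc k" by (cases m0) auto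
  have "\<not> r / 2 ^ k \<le> d" using not_less_Least[of k "\<lambda>m. r / 2 ^ m \<le> d"] k unfolding m0_def by auto
  thus thesis using that m0 k by auto
qed

lemma nn_integral_suminf_balls:
  "(\<integral>\<^sup>+z. (\<Sum>k::nat. c k * indicator (ball (x::'a::euclidean_space) (r k)) z) \<partial>lborel)
    = (\<Sum>k. \<integral>\<^sup>+z. c k * indicator (ball x (r k)) z \<partial>lborel)"
  by (intro nn_integral_suminf borel_measurable_times_ennreal borel_measurable_const
      borel_measurable_indicator) simp

text \<open>On the shell \<open>r / 2\<^sup>k\<^sup>+\<^sup>1 \<le> \<bar>x - z\<bar> < r / 2\<^sup>k\<close> the kernel is at most \<open>(r / 2\<^sup>k\<^sup>+\<^sup>1)\<^sup>-\<^sup>a\<close>. Bounding the shell by the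
  ball that contains it leaves a geometric series of ratio \<open>2\<^sup>a\<^sup>-\<^sup>n\<close>.\<close>

lemma riesz_integral_centred_ball:
  fixes a :: real
  assumes "0 \<le> a" "a < real DIM('a::euclidean_space)"
  obtains C where "0 \<le> C" "\<And>(x::'a) r. 0 < r \<Longrightarrow>
    (\<integral>\<^sup>+z. riesz a x z * indicator (ball x r) z \<partial>lborel) \<le> ennreal (C * r powr (real DIM('a) - a))"
proof -
  let ?N = "real DIM('a)"
  define v where "v = unit_ball_vol ?N"
  have v: "0 \<le> v" unfolding v_def by simp
  define b where "b = 2 powr (- (?N - a))"
  have b: "0 < b" "b < 1" using assms unfolding b_def by (auto simp: powr_less_one)
  define C where "C = 2 powr a * v * (1 / (1 - b))"
  show thesis
  proof (rule that[of C])
    show "0 \<le> C" using b v unfolding C_def by simp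
    fix x :: 'a and r :: real assume r: "0 < r"
    have le: "riesz a x z * indicator (ball x r) z
        \<le> (\<Sum>k. ennreal ((r / 2 ^ Suc k) powr - a) * indicator (ball x (r / 2 ^ k)) z)" for z
    proof (cases "z \<in> ball x r \<and> z \<noteq> x")
      case True
      obtain k where k: "r / 2 ^ Suc k \<le> dist x z" "dist x z < r / 2 ^ k"
        using dyadic_shell[of "dist x z" r] True by auto
      have "riesz a x z * indicator (ball x r) z
          \<le> ennreal ((r / 2 ^ Suc k) powr - a) * indicator (ball x (r / 2 ^ k)) z"
        using k r assms True by (auto simp: dist_norm intro!: riesz_le)
      also have "\<dots> \<le> (\<Sum>k. ennreal ((r / 2 ^ Suc k) powr - a) * indicator (ball x (r / 2 ^ k)) z)"
        by (rule ennreal_le_suminf)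
      finally show ?thesis .
    next
      case False
      thus ?thesis by (auto simp: riesz_def)
    qed
    have shell: "(\<integral>\<^sup>+z. ennreal ((r / 2 ^ Suc k) powr - a) * indicator (ball x (r / 2 ^ k)) z \<partial>lborel)
        = ennreal (2 powr a * v * r powr (?N - a) * b ^ k)" for k
    proof -
      have pw: "(2 powr c) ^ k = 2 powr (c * real k)" for c :: real
        using powr_powr[of 2 c "real k"] powr_realpow[of "2 powr c" k] by simp
      have tk: "(2::real) ^ j = 2 powr real j" for j
        by (simp add: powr_realpow)
      have "(r / 2 ^ Suc k) powr - a = r powr - a / 2 powr (- (real (Suc k) * a))"
        using r by (simp only: tk powr_divide powr_powr) (simp add: powr_powr)
      also have "\<dots> = r powr - a * 2 powr (real (Suc k) * a)"
        by (simp only: powr_minus divide_inverse inverse_inverse_eq)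
      also have "2 powr (real (Suc k) * a) = 2 powr a * (2 powr a) ^ k"
        unfolding pw powr_add[symmetric] by (simp add: algebra_simps)
      finally have 1: "(r / 2 ^ Suc k) powr - a = 2 powr a * r powr (-a) * (2 powr a) ^ k"
        by (simp only: ac_simps)
      have "(r / 2 ^ k) ^ DIM('a) = r ^ DIM('a) / 2 powr (?N * real k)"
        by (simp add: power_divide tk[of "k * DIM('a)", symmetric, simplified] power_mult[symmetric] mult.commute)
      also have "\<dots> = r powr ?N * (2 powr - ?N) ^ k"
        unfolding pw using r by (simp add: powr_realpow powr_minus divide_inverse)
      finally have 2: "(r / 2 ^ k) ^ DIM('a) = r powr ?N * (2 powr - ?N) ^ k" .
      have 3: "(2 powr a) ^ k * (2 powr - ?N) ^ k = b ^ k"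
        unfolding b_def power_mult_distrib[symmetric] powr_add[symmetric] by (simp add: algebra_simps)
      have 4: "r powr - a * r powr ?N = r powr (?N - a)"
        unfolding powr_add[symmetric] by simp
      have "(\<integral>\<^sup>+z. ennreal ((r / 2 ^ Suc k) powr - a) * indicator (ball x (r / 2 ^ k)) z \<partial>lborel)
          = ennreal ((r / 2 ^ Suc k) powr - a) * ennreal (v * (r / 2 ^ k) ^ DIM('a))"
        using r by (subst nn_integral_cmult_indicator) (auto simp: emeasure_ball v_def)
      also have "\<dots> = ennreal ((r / 2 ^ Suc k) powr - a * (v * (r / 2 ^ k) ^ DIM('a)))"
        using v r by (subst ennreal_mult) auto
      also have "(r / 2 ^ Suc k) powr - a * (v * (r / 2 ^ k) ^ DIM('a))
          = 2 powr a * v * (r powr (-a) * r powr ?N) * ((2 powr a) ^ k * (2 powr - ?N) ^ k)"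
        unfolding 1 2 by (simp only: ac_simps)
      finally show ?thesis unfolding 3 4 .
    qed
    have "(\<integral>\<^sup>+z. riesz a x z * indicator (ball x r) z \<partial>lborel)
       \<le> (\<integral>\<^sup>+z. (\<Sum>k. ennreal ((r / 2 ^ Suc k) powr - a) * indicator (ball x (r / 2 ^ k)) z) \<partial>lborel)"
      by (rule nn_integral_mono) (rule le)
    also have "\<dots> = (\<Sum>k. \<integral>\<^sup>+z. ennreal ((r / 2 ^ Suc k) powr - a) * indicator (ball x (r / 2 ^ k)) z \<partial>lborel)"
      by (rule nn_integral_suminf_balls)
    also have "\<dots> = (\<Sum>k. ennreal (2 powr a * v * r powr (?N - a) * b ^ k))"
      by (simp only: shell)
    also have "\<dots> = ennreal (\<Sum>k. 2 powr a * v * r powr (?N - a) * b ^ k)"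
      using b v by (intro suminf_ennreal2 summable_mult summable_geometric) auto
    also have "(\<Sum>k. 2 powr a * v * r powr (?N - a) * b ^ k) = C * r powr (?N - a)"
      using b by (subst suminf_mult) (auto simp: suminf_geometric C_def summable_geometric)
    finally show "(\<integral>\<^sup>+z. riesz a x z * indicator (ball x r) z \<partial>lborel) \<le> ennreal (C * r powr (?N - a))" .
  qed
qed

lemma nn_integral_add_cmult_indicator:
  assumes "f \<in> borel_measurable M" "A \<in> sets M"
  shows "(\<integral>\<^sup>+z. f z + c * indicator A z \<partial>M) = (\<integral>\<^sup>+z. f z \<partial>M) + c * emeasure M A"
  using assms by (simp add: nn_integral_add nn_integral_cmult_indicator)

text \<open>A ball about another centre costs only a constant: the kernel is at most \<open>r\<^sup>-\<^sup>a\<close> outside \<open>ball x r\<close>.\<close>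

lemma riesz_integral_ball:
  fixes a :: real
  assumes "0 \<le> a" "a < real DIM('a::euclidean_space)"
  obtains C where "0 \<le> C" "\<And>(x::'a) y r. 0 < r \<Longrightarrow>
    (\<integral>\<^sup>+z. riesz a x z * indicator (ball y r) z \<partial>lborel) \<le> ennreal (C * r powr (real DIM('a) - a))"
proof -
  let ?N = "real DIM('a)"
  obtain C where C: "0 \<le> C" "\<And>(x::'a) r. 0 < r \<Longrightarrow>
    (\<integral>\<^sup>+z. riesz a x z * indicator (ball x r) z \<partial>lborel) \<le> ennreal (C * r powr (?N - a))"
    by (rule riesz_integral_centred_ball[OF assms]) (rule that)
  define v where "v = unit_ball_vol ?N"
  have v: "0 \<le> v" unfolding v_def by simp
  show thesis
  proof (rule that[of "C + v"])
    show "0 \<le> C + v" using C v by simp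
    fix x y :: 'a and r :: real assume r: "0 < r"
    have "riesz a x z * indicator (ball y r) z
        \<le> riesz a x z * indicator (ball x r) z + ennreal (r powr - a) * indicator (ball y r) z" for z
      using riesz_le[of r x z a] r assms by (auto simp: indicator_def dist_norm)
    hence "(\<integral>\<^sup>+z. riesz a x z * indicator (ball y r) z \<partial>lborel)
        \<le> (\<integral>\<^sup>+z. riesz a x z * indicator (ball x r) z + ennreal (r powr - a) * indicator (ball y r) z \<partial>lborel)"
      by (intro nn_integral_mono)
    also have "\<dots> = (\<integral>\<^sup>+z. riesz a x z * indicator (ball x r) z \<partial>lborel)
        + ennreal (r powr - a) * ennreal (v * r ^ DIM('a))"
      using r by (subst nn_integral_add_cmult_indicator)
        (auto simp: emeasure_ball v_def intro!: borel_measurable_times_ennreal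
          borel_measurable_indicator riesz_measurable)
    also have "\<dots> \<le> ennreal (C * r powr (?N - a)) + ennreal (r powr - a) * ennreal (v * r ^ DIM('a))"
      by (intro add_right_mono C r)
    also have "\<dots> = ennreal (C * r powr (?N - a) + r powr - a * (v * r ^ DIM('a)))"
      using C v r by (simp add: ennreal_mult ennreal_plus)
    also have "r powr - a * (v * r ^ DIM('a)) = v * r powr (?N - a)"
      using r by (simp add: powr_realpow[symmetric] powr_add[symmetric] algebra_simps)
    finally show "(\<integral>\<^sup>+z. riesz a x z * indicator (ball y r) z \<partial>lborel)
        \<le> ennreal ((C + v) * r powr (?N - a))"
      by (simp add: algebra_simps)
  qed
qed

text \<open>One of \<open>\<bar>x - z\<bar>\<close> and \<open>\<bar>z - y\<bar>\<close> is at least \<open>\<bar>x - y\<bar> / 2\<close>. An exponent \<open>e\<close> taken from that factor becomes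
  \<open>\<bar>x - y\<bar>\<^sup>-\<^sup>e\<close>; the two remaining factors are bounded by the sum of the pure powers with the total exponent.\<close>

lemma riesz_mult_split:
  fixes x y z :: "'a::euclidean_space"
  assumes "0 \<le> e" "e \<le> a" "e \<le> b" "x \<noteq> y"
  shows "riesz a x z * riesz b z y
    \<le> ennreal (2 powr e) * riesz e x y * (riesz (a + b - e) x z + riesz (a + b - e) z y)"
proof (cases "z = x \<or> z = y")
  case True
  thus ?thesis by (auto simp: riesz_def)
next
  case False
  define t u d where "t = norm (x - z)" and "u = norm (z - y)" and "d = norm (x - y)"
  have pos: "0 < t" "0 < u" "0 < d" using False assms unfolding t_def u_def d_def by auto
  have tri: "d \<le> t + u" unfolding t_def u_def d_def using norm_triangle_ineq[of "x - z" "z - y"] by simp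
  have split: "p powr - A * q powr - B \<le> p powr - (A + B) + q powr - (A + B)"
    if "0 \<le> A" "0 \<le> B" "0 < p" "0 < q" for A B p q :: real
  proof (cases "p \<le> q")
    case True
    have "p powr - A * q powr - B \<le> p powr - A * p powr - B"
      using that True by (intro mult_left_mono powr_mono2') auto
    also have "\<dots> = p powr - (A + B)" by (simp add: powr_add[symmetric])
    finally show ?thesis by (simp add: add_increasing2)
  next
    case False
    have "p powr - A * q powr - B \<le> q powr - A * q powr - B"
      using that False by (intro mult_right_mono powr_mono2') auto
    also have "\<dots> = q powr - (A + B)" by (simp add: powr_add[symmetric])
    finally show ?thesis by (simp add: add_increasing)
  qed
  have half: "p powr - e \<le> 2 powr e * d powr - e" if "d / 2 \<le> p" for p
  proof -
    have "p powr - e \<le> (d / 2) powr - e" using that pos assms by (intro powr_mono2') auto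
    also have "\<dots> = 2 powr e * d powr - e" 
      using pos powr_divide[of d 2 "- e"] powr_minus[of 2 e] by (simp only: divide_inverse inverse_inverse_eq mult.commute)
    finally show ?thesis .
  qed
  have "t powr - a * u powr - b \<le> 2 powr e * d powr - e * (t powr - (a + b - e) + u powr - (a + b - e))"
  proof (cases "d / 2 \<le> t")
    case True
    have "t powr - a * u powr - b = t powr - e * (t powr - (a - e) * u powr - b)"
      by (simp add: powr_add[symmetric] mult.assoc[symmetric])
    also have "\<dots> \<le> (2 powr e * d powr - e) * (t powr - (a - e + b) + u powr - (a - e + b))"
      using half[OF True] split[of "a - e" b t u] assms pos by (intro mult_mono) auto
    finally show ?thesis by (simp add: algebra_simps)
  next
    case False
    hence "d / 2 \<le> u" using tri by simp
    have "t powr - a * u powr - b = u powr - e * (t powr - a * u powr - (b - e))"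
      by (simp add: powr_add[symmetric] mult.left_commute)
    also have "\<dots> \<le> (2 powr e * d powr - e) * (t powr - (a + (b - e)) + u powr - (a + (b - e)))"
      using half[OF \<open>d / 2 \<le> u\<close>] split[of a "b - e" t u] assms pos by (intro mult_mono) auto
    finally show ?thesis by (simp add: algebra_simps)
  qed
  hence "ennreal (t powr - a * u powr - b)
    \<le> ennreal (2 powr e * d powr - e * (t powr - (a + b - e) + u powr - (a + b - e)))"
    by (rule ennreal_leI)
  thus ?thesis unfolding riesz_def t_def u_def d_def
    by (simp add: ennreal_mult ennreal_plus)
qed

lemma riesz_integral_bounded:
  fixes \<Omega> :: "'a::euclidean_space set"
  assumes "0 \<le> a" "a < real DIM('a)" "bounded \<Omega>" "\<Omega> \<in> sets lebesgue"
  obtains C where "0 \<le> C" "\<And>x. (\<integral>\<^sup>+z. riesz a x z \<partial>lebesgue_on \<Omega>) \<le> ennreal C"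
proof -
  obtain R where R: "0 < R" "\<Omega> \<subseteq> ball 0 R"
    using bounded_subset_ballD[OF assms(3), of 0] by auto
  obtain C where C: "0 \<le> C" "\<And>(x::'a) y r. 0 < r \<Longrightarrow>
    (\<integral>\<^sup>+z. riesz a x z * indicator (ball y r) z \<partial>lborel) \<le> ennreal (C * r powr (real DIM('a) - a))"
    by (rule riesz_integral_ball[OF assms(1,2)]) (rule that)
  show thesis
  proof (rule that[of "C * R powr (real DIM('a) - a)"])
    show "0 \<le> C * R powr (real DIM('a) - a)" using C by simp
    fix x :: 'a
    have "(\<integral>\<^sup>+z. riesz a x z \<partial>lebesgue_on \<Omega>) = (\<integral>\<^sup>+z. riesz a x z * indicator \<Omega> z \<partial>lebesgue)"
      using assms by (simp add: nn_integral_restrict_space)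
    also have "\<dots> \<le> (\<integral>\<^sup>+z. riesz a x z * indicator (ball 0 R) z \<partial>lebesgue)"
      using R by (intro nn_integral_mono mult_left_mono) (auto simp: indicator_def)
    also have "\<dots> = (\<integral>\<^sup>+z. riesz a x z * indicator (ball 0 R) z \<partial>lborel)"
      by (simp add: nn_integral_completion)
    also have "\<dots> \<le> ennreal (C * R powr (real DIM('a) - a))" by (rule C(2)[OF R(1)])
    finally show "(\<integral>\<^sup>+z. riesz a x z \<partial>lebesgue_on \<Omega>) \<le> ennreal (C * R powr (real DIM('a) - a))" .
  qed
qed

lemma borel_measurable_lebesgue_onI:
  assumes "f \<in> borel_measurable borel"
  shows "f \<in> borel_measurable (lebesgue_on \<Omega>)"
proof -
  have "f \<in> borel_measurable lborel" using assms by (simp only: measurable_lborel2)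
  hence "f \<in> borel_measurable lebesgue" by (rule measurable_completion)
  thus ?thesis by (rule measurable_restrict_space1)
qed

lemma riesz_measurable_lebesgue_on [measurable]:
  "riesz a x \<in> borel_measurable (lebesgue_on \<Omega>)" "(\<lambda>z. riesz a z x) \<in> borel_measurable (lebesgue_on \<Omega>)"
proof -
  have 1: "(\<lambda>z. riesz a x z) \<in> borel_measurable borel"
    by (rule riesz_measurable) simp_all
  have 2: "(\<lambda>z. riesz a z x) \<in> borel_measurable borel"
    by (rule riesz_measurable) simp_all
  show "riesz a x \<in> borel_measurable (lebesgue_on \<Omega>)" "(\<lambda>z. riesz a z x) \<in> borel_measurable (lebesgue_on \<Omega>)"
    using 1 2 by (auto intro: borel_measurable_lebesgue_onI)
qed

text \<open>The sharp exponent would be \<open>a + b - n\<close>. Any larger \<open>e\<close> is enough for the iteration that uses this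
  lemma, and avoids the logarithm of the limiting case.\<close>

lemma riesz_composition:
  fixes \<Omega> :: "'a::euclidean_space set"
  assumes "0 \<le> e" "e \<le> a" "e \<le> b" "a + b - e < real DIM('a)" "bounded \<Omega>" "\<Omega> \<in> sets lebesgue"
  obtains C where "0 \<le> C"
    "\<And>x y. x \<noteq> y \<Longrightarrow> (\<integral>\<^sup>+z. riesz a x z * riesz b z y \<partial>lebesgue_on \<Omega>) \<le> ennreal C * riesz e x y"
proof -
  obtain C where C: "0 \<le> C" "\<And>x. (\<integral>\<^sup>+z. riesz (a + b - e) x z \<partial>lebesgue_on \<Omega>) \<le> ennreal C"
    using riesz_integral_bounded[of "a + b - e" \<Omega>] assms by auto
  show thesis
  proof (rule that[of "2 powr e * (2 * C)"])
    show "0 \<le> 2 powr e * (2 * C)" using C by simp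
    fix x y :: 'a assume xy: "x \<noteq> y"
    have "(\<integral>\<^sup>+z. riesz a x z * riesz b z y \<partial>lebesgue_on \<Omega>)
      \<le> (\<integral>\<^sup>+z. ennreal (2 powr e) * riesz e x y * (riesz (a + b - e) x z + riesz (a + b - e) z y) \<partial>lebesgue_on \<Omega>)"
      by (intro nn_integral_mono riesz_mult_split assms xy)
    also have "\<dots> = ennreal (2 powr e) * riesz e x y *
        ((\<integral>\<^sup>+z. riesz (a + b - e) x z \<partial>lebesgue_on \<Omega>) + (\<integral>\<^sup>+z. riesz (a + b - e) y z \<partial>lebesgue_on \<Omega>))"
      by (simp add: nn_integral_cmult nn_integral_add riesz_commute[of _ _ y])
    also have "\<dots> \<le> ennreal (2 powr e) * riesz e x y * (ennreal C + ennreal C)"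
      by (intro mult_left_mono add_mono C) auto
    also have "ennreal C + ennreal C = ennreal (2 * C)" using C by (simp flip: ennreal_plus)
    also have "ennreal (2 powr e) * riesz e x y * ennreal (2 * C) = ennreal (2 powr e * (2 * C)) * riesz e x y"
      using C by (simp add: ennreal_mult ac_simps)
    finally show "(\<integral>\<^sup>+z. riesz a x z * riesz b z y \<partial>lebesgue_on \<Omega>)
      \<le> ennreal (2 powr e * (2 * C)) * riesz e x y" .
  qed
qed

section \<open>The Green operator on functions and measures\<close>

lemma AE_neq_point:
  assumes "\<Omega> \<in> sets lebesgue"
  shows "AE x in lebesgue_on \<Omega>. x \<noteq> (y::'a::euclidean_space)"
proof (rule AE_I'[of "{y} \<inter> \<Omega>"])
  have "{y} \<inter> \<Omega> \<in> null_sets lebesgue"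
    using negligible_finite[of "{y} \<inter> \<Omega>"] by (simp add: negligible_iff_null_sets)
  thus "{y} \<inter> \<Omega> \<in> null_sets (lebesgue_on \<Omega>)"
    using assms by (simp add: null_sets_restrict_space)
qed auto

lemma ennreal_abs_integral_le: "ennreal \<bar>\<integral>x. f x \<partial>M\<bar> \<le> (\<integral>\<^sup>+x. ennreal \<bar>f x\<bar> \<partial>M)"
  for f :: "'a \<Rightarrow> real"
proof (cases "integrable M f")
  case True
  thus ?thesis using integral_norm_bound_ennreal[OF True] by simp
next
  case False
  thus ?thesis by (simp add: not_integrable_integral_eq)
qed

locale green_setting =
  fixes \<Omega> :: "(real^'n) set" and s \<gamma> :: real and G :: "real^'n \<Rightarrow> real^'n \<Rightarrow> real" and c C q :: real
  assumes dim: "3 \<le> CARD('n)" and q_def: "q = real CARD('n) - 2 * s" and s: "0 < s" "s \<le> 1" and \<gamma>: "0 < \<gamma>"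
    and open_\<Omega>: "open \<Omega>" and bounded_\<Omega>: "bounded \<Omega>" and nonempty_\<Omega>: "\<Omega> \<noteq> {}"
    and G_borel: "(\<lambda>(x, y). G x y) \<in> borel_measurable (restrict_space borel (\<Omega> \<times> \<Omega>))"
    and G_nonneg: "\<And>x y. x \<in> \<Omega> \<Longrightarrow> y \<in> \<Omega> \<Longrightarrow> 0 \<le> G x y"
    and G_sym: "\<And>x y. x \<in> \<Omega> \<Longrightarrow> y \<in> \<Omega> \<Longrightarrow> G x y = G y x"
    and c: "0 < c"
    and G_lower: "\<And>x y. x \<in> \<Omega> \<Longrightarrow> y \<in> \<Omega> \<Longrightarrow> x \<noteq> y \<Longrightarrow> c * model_kernel \<Omega> s \<gamma> x y \<le> G x y"
    and G_upper: "\<And>x y. x \<in> \<Omega> \<Longrightarrow> y \<in> \<Omega> \<Longrightarrow> x \<noteq> y \<Longrightarrow> G x y \<le> C * model_kernel \<Omega> s \<gamma> x y"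
    and C: "0 \<le> C"
    and G_psd: "\<And>f. f \<in> borel_measurable (lebesgue_on \<Omega>) \<Longrightarrow> integrable (lebesgue_on \<Omega>) (\<lambda>x. (f x)\<^sup>2) \<Longrightarrow>
        0 \<le> (\<integral>x. f x * green_fun \<Omega> G f x \<partial>lebesgue_on \<Omega>)"
    and G_cont: "\<And>f B. f \<in> borel_measurable (lebesgue_on \<Omega>) \<Longrightarrow> AE x in lebesgue_on \<Omega>. \<bar>f x\<bar> \<le> B \<Longrightarrow>
        \<exists>g. continuous_on (closure \<Omega>) g \<and> (\<forall>x\<in>\<Omega>. g x = green_fun \<Omega> G f x)"
begin

abbreviation M :: "(real^'n) measure" where "M \<equiv> lebesgue_on \<Omega>"
abbreviation \<G> :: "(real^'n \<Rightarrow> real) \<Rightarrow> real^'n \<Rightarrow> real" where "\<G> \<equiv> green_fun \<Omega> G"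
abbreviation B\<Omega> :: "(real^'n) measure" where "B\<Omega> \<equiv> restrict_space borel \<Omega>"

lemma q: "0 < q" "q < real CARD('n)" "q < real DIM(real^'n)" "0 \<le> q"
  using dim s by (auto simp: q_def)

lemma \<Omega>_sets: "\<Omega> \<in> sets borel" "\<Omega> \<in> sets lebesgue" "\<Omega> \<in> lmeasurable"
  using open_\<Omega> bounded_\<Omega> by (auto simp: lmeasurable_open)

lemma finite_measure_M: "finite_measure M"
  by (rule finite_measure_lebesgue_on) (rule \<Omega>_sets)

sublocale M: finite_measure M by (rule finite_measure_M)
sublocale MM: pair_sigma_finite M M ..

lemma space_B\<Omega> [simp]: "space B\<Omega> = \<Omega>" by (simp add: space_restrict_space)

lemma id_M: "(\<lambda>x. x) \<in> measurable M B\<Omega>"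
proof (rule measurable_restrict_space2)
  show "(\<lambda>x. x) \<in> space M \<rightarrow> \<Omega>" by simp
  have "(\<lambda>x. x) \<in> measurable lborel (borel :: (real^'n) measure)"
    unfolding measurable_lborel2 by simp
  thus "(\<lambda>x. x) \<in> measurable M borel"
    by (intro measurable_restrict_space1 measurable_completion)
qed

lemma id_B\<Omega>: "(\<lambda>x. x) \<in> measurable B\<Omega> B\<Omega>"
  by simp

lemma nonneg_measuresD:
  assumes "\<nu> \<in> nonneg_measures \<Omega>"
  shows "sets \<nu> = sets B\<Omega>" "space \<nu> = \<Omega>" "finite_measure \<nu>" "(\<lambda>x. x) \<in> measurable \<nu> B\<Omega>"
proof -
  show 1: "sets \<nu> = sets B\<Omega>" "finite_measure \<nu>" using assms by (auto simp: nonneg_measures_def)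
  show "space \<nu> = \<Omega>" using sets_eq_imp_space_eq[OF 1(1)] by simp
  show "(\<lambda>x. x) \<in> measurable \<nu> B\<Omega>" by (rule measurable_ident_sets[OF 1(1)])
qed

lemma G_measurable:
  assumes "f \<in> measurable P B\<Omega>" "g \<in> measurable P B\<Omega>"
  shows "(\<lambda>p. G (f p) (g p)) \<in> borel_measurable P"
proof -
  have fg: "f \<in> measurable P borel" "f \<in> space P \<rightarrow> \<Omega>" "g \<in> measurable P borel" "g \<in> space P \<rightarrow> \<Omega>"
    using assms by (auto simp: measurable_restrict_space2_iff)
  have "(\<lambda>p. (f p, g p)) \<in> measurable P (borel \<Otimes>\<^sub>M borel)"
    using fg by (intro measurable_Pair)
  hence "(\<lambda>p. (f p, g p)) \<in> measurable P (restrict_space borel (\<Omega> \<times> \<Omega>))"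
    using fg by (intro measurable_restrict_space2) (auto simp: borel_prod)
  from measurable_compose[OF this G_borel] show ?thesis by simp
qed

lemma G_measurable_snd:
  assumes "x \<in> \<Omega>" "(\<lambda>x. x) \<in> measurable P B\<Omega>"
  shows "G x \<in> borel_measurable P" "(\<lambda>y. G y x) \<in> borel_measurable P"
  using assms by (intro G_measurable[of "\<lambda>_. x" P "\<lambda>x. x", simplified] G_measurable[of "\<lambda>x. x" P "\<lambda>_. x", simplified]
      measurable_const; simp)+

lemma bdist_pos: "x \<in> \<Omega> \<Longrightarrow> 0 < bdist \<Omega> x"
proof -
  assume x: "x \<in> \<Omega>"
  have "frontier \<Omega> \<noteq> {}"
    using bounded_\<Omega> nonempty_\<Omega> not_bounded_UNIV by (auto simp: frontier_eq_empty)
  moreover have "x \<notin> frontier \<Omega>" using x open_\<Omega> by (simp add: frontier_def interior_open)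
  ultimately show ?thesis
    by (metis frontier_closed in_closed_iff_infdist_zero infdist_nonneg order_less_le)
qed

lemma model_kernel_eq:
  "model_kernel \<Omega> s \<gamma> x y = norm (x - y) powr - q * min (bdist \<Omega> x * bdist \<Omega> y / (norm (x - y))\<^sup>2) 1 powr \<gamma>"
  unfolding model_kernel_def q_def by (simp only: powr_minus_divide)

lemma model_kernel_le: "model_kernel \<Omega> s \<gamma> x y \<le> norm (x - y) powr - q"
proof -
  have "min (bdist \<Omega> x * bdist \<Omega> y / (norm (x - y))\<^sup>2) 1 powr \<gamma> \<le> 1 powr \<gamma>"
    using \<gamma> by (intro powr_mono2) (auto simp: infdist_nonneg)
  thus ?thesis unfolding model_kernel_eq by (simp add: mult_left_le)
qed

lemma G_pos: "x \<in> \<Omega> \<Longrightarrow> y \<in> \<Omega> \<Longrightarrow> x \<noteq> y \<Longrightarrow> 0 < G x y"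
proof -
  assume *: "x \<in> \<Omega>" "y \<in> \<Omega>" "x \<noteq> y"
  have "0 < model_kernel \<Omega> s \<gamma> x y"
    unfolding model_kernel_eq using bdist_pos[of x] bdist_pos[of y] * by (intro mult_pos_pos powr_gt_zero[THEN iffD2]) (auto simp: min_def)
  thus ?thesis using G_lower[OF *] c by (meson less_le_trans mult_pos_pos)
qed

lemma G_le_riesz:
  assumes "x \<in> \<Omega>" "y \<in> \<Omega>" "x \<noteq> y"
  shows "ennreal (G x y) \<le> ennreal C * riesz q x y"
proof -
  have "G x y \<le> C * norm (x - y) powr - q"
    using G_upper[OF assms] model_kernel_le[of x y] C by (meson mult_left_mono order_trans)
  hence "ennreal (G x y) \<le> ennreal (C * norm (x - y) powr - q)" by (rule ennreal_leI)
  thus ?thesis unfolding riesz_def using C by (simp add: ennreal_mult)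
qed

text \<open>The boundary factor of the kernel is at most \<open>1\<close> and is dropped; only the distance of the two points matters.\<close>

lemma G_far:
  assumes "x \<in> \<Omega>" "y \<in> \<Omega>" "0 < d" "d \<le> dist x y"
  shows "G x y \<le> C * d powr - q"
proof -
  have "x \<noteq> y" using assms by auto
  have "norm (x - y) powr - q \<le> d powr - q"
    using assms q by (intro powr_mono2') (auto simp: dist_norm)
  thus ?thesis
    using G_upper[OF assms(1,2) \<open>x \<noteq> y\<close>] model_kernel_le[of x y] C
    by (meson mult_left_mono order_trans)
qed

lemma ex_G_bound: "\<exists>C1>0. \<forall>y\<in>\<Omega>. (\<integral>\<^sup>+x. G x y \<partial>M) \<le> ennreal C1"
proof -
  obtain C2 where C2: "0 \<le> C2" "\<And>x. (\<integral>\<^sup>+z. riesz q x z \<partial>M) \<le> ennreal C2"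
    by (rule riesz_integral_bounded[OF q(4) q(3) bounded_\<Omega> \<Omega>_sets(2)]) (rule that)
  have "(\<integral>\<^sup>+x. G x y \<partial>M) \<le> ennreal (C * C2 + 1)" if y: "y \<in> \<Omega>" for y
  proof -
    have "(\<integral>\<^sup>+x. G x y \<partial>M) \<le> (\<integral>\<^sup>+x. ennreal C * riesz q y x \<partial>M)"
    proof (rule nn_integral_mono_AE)
      show "AE x in M. ennreal (G x y) \<le> ennreal C * riesz q y x"
        using AE_neq_point[OF \<Omega>_sets(2), of y] AE_space[of M]
        by eventually_elim (use y G_le_riesz[of _ y] in \<open>auto simp: riesz_commute[of q y]\<close>)
    qed
    also have "\<dots> \<le> ennreal C * ennreal C2"
      by (subst nn_integral_cmult) (auto intro!: mult_left_mono C2(2))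
    also have "\<dots> \<le> ennreal (C * C2 + 1)"
      using C C2 by (simp flip: ennreal_mult)
    finally show ?thesis .
  qed
  moreover have "0 < C * C2 + 1" using C C2 by (simp add: add_nonneg_pos)
  ultimately show ?thesis by blast
qed

definition C1 :: real where "C1 = (SOME C1. 0 < C1 \<and> (\<forall>y\<in>\<Omega>. (\<integral>\<^sup>+x. G x y \<partial>M) \<le> ennreal C1))"

lemma C1: "0 < C1" "y \<in> \<Omega> \<Longrightarrow> (\<integral>\<^sup>+x. G x y \<partial>M) \<le> ennreal C1"
  using someI_ex[OF ex_G_bound[unfolded Bex_def Ball_def]] unfolding C1_def by (auto simp: Ball_def)

lemma C1': "x \<in> \<Omega> \<Longrightarrow> (\<integral>\<^sup>+y. G x y \<partial>M) \<le> ennreal C1"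
  using C1(2)[of x] nn_integral_cong[of M "\<lambda>y. ennreal (G x y)" "\<lambda>y. ennreal (G y x)"] G_sym[of x] by auto

lemma G_measurable_MM:
  "(\<lambda>(x, y). G x y) \<in> borel_measurable (M \<Otimes>\<^sub>M M)"
  unfolding case_prod_beta'
  by (intro G_measurable measurable_compose[OF measurable_fst id_M] measurable_compose[OF measurable_snd id_M])

text \<open>Absolute convergence of the double integral, from the uniform bound \<open>C1\<close> on the \<open>L\<^sup>1\<close> norms of the
  sections of the kernel. Fubini's theorem then gives both the potential of an integrable function and
  the symmetry of the Green operator.\<close>

lemma integrable_G_times_pair:
  assumes f: "integrable M f" and \<psi>: "\<psi> \<in> borel_measurable M" "\<And>x. x \<in> \<Omega> \<Longrightarrow> \<bar>\<psi> x\<bar> \<le> Q"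
  shows "integrable (M \<Otimes>\<^sub>M M) (\<lambda>(x, y). \<psi> x * (G x y * f y))"
proof (rule integrableI_bounded)
  have [measurable]: "f \<in> borel_measurable M" using f by auto
  note G_measurable_MM[measurable] \<psi>(1)[measurable]
  show meas: "(\<lambda>(x, y). \<psi> x * (G x y * f y)) \<in> borel_measurable (M \<Otimes>\<^sub>M M)"
    by measurable
  have Q: "0 \<le> Q" using \<psi>(2) nonempty_\<Omega> abs_ge_zero order_trans by blast
  have "(\<integral>\<^sup>+p. ennreal (norm (case p of (x, y) \<Rightarrow> \<psi> x * (G x y * f y))) \<partial>(M \<Otimes>\<^sub>M M))
      = (\<integral>\<^sup>+y. (\<integral>\<^sup>+x. ennreal (norm (\<psi> x * (G x y * f y))) \<partial>M) \<partial>M)"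
    by (subst MM.nn_integral_snd[symmetric]) (use meas in \<open>auto simp: split_beta'\<close>)
  also have "\<dots> \<le> (\<integral>\<^sup>+y. ennreal (Q * C1) * ennreal \<bar>f y\<bar> \<partial>M)"
  proof (rule nn_integral_mono)
    fix y assume y: "y \<in> space M"
    have "(\<integral>\<^sup>+x. ennreal (norm (\<psi> x * (G x y * f y))) \<partial>M) \<le> (\<integral>\<^sup>+x. (ennreal Q * ennreal \<bar>f y\<bar>) * ennreal (G x y) \<partial>M)"
    proof (rule nn_integral_mono)
      fix x assume x: "x \<in> space M"
      have "\<bar>\<psi> x\<bar> * (G x y * \<bar>f y\<bar>) \<le> Q * (G x y * \<bar>f y\<bar>)"
        using x y \<psi>(2) G_nonneg by (intro mult_right_mono) auto
      hence "norm (\<psi> x * (G x y * f y)) \<le> (Q * \<bar>f y\<bar>) * G x y"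
        using x y G_nonneg[of x y] by (simp add: abs_mult ac_simps)
      thus "ennreal (norm (\<psi> x * (G x y * f y))) \<le> (ennreal Q * ennreal \<bar>f y\<bar>) * ennreal (G x y)"
        using x y G_nonneg[of x y] Q by (simp flip: ennreal_mult)
    qed
    also have "\<dots> = (ennreal Q * ennreal \<bar>f y\<bar>) * (\<integral>\<^sup>+x. ennreal (G x y) \<partial>M)"
      using y G_measurable_snd(2)[OF _ id_M, of y] by (intro nn_integral_cmult) auto
    also have "\<dots> \<le> (ennreal Q * ennreal \<bar>f y\<bar>) * ennreal C1"
      using y by (intro mult_left_mono C1) auto
    finally show "(\<integral>\<^sup>+x. ennreal (norm (\<psi> x * (G x y * f y))) \<partial>M) \<le> ennreal (Q * C1) * ennreal \<bar>f y\<bar>"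
      using Q C1(1) by (simp add: ennreal_mult ac_simps)
  qed
  also have "\<dots> = ennreal (Q * C1) * (\<integral>\<^sup>+y. ennreal \<bar>f y\<bar> \<partial>M)"
    by (rule nn_integral_cmult) auto
  also have "\<dots> < \<infinity>"
    using f by (auto simp: ennreal_mult_less_top integrable_iff_bounded)
  finally show "(\<integral>\<^sup>+p. ennreal (norm (case p of (x, y) \<Rightarrow> \<psi> x * (G x y * f y))) \<partial>(M \<Otimes>\<^sub>M M)) < \<infinity>" .
qed

lemma
  assumes "integrable M f"
  shows AE_integrable_G: "AE x in M. integrable M (\<lambda>y. G x y * f y)"
    and integrable_green_fun: "integrable M (\<G> f)"
proof -
  have "integrable (M \<Otimes>\<^sub>M M) (\<lambda>(x, y). G x y * f y)"
    using integrable_G_times_pair[OF assms, of "\<lambda>_. 1" 1] by simp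
  from MM.AE_integrable_fst'[OF this] MM.integrable_fst'[OF this]
  show "AE x in M. integrable M (\<lambda>y. G x y * f y)" "integrable M (\<G> f)"
    by (auto simp: green_fun_def[abs_def])
qed

lemma green_fun_pairing:
  assumes f: "integrable M f" and \<psi>: "\<psi> \<in> borel_measurable M" "\<And>x. x \<in> \<Omega> \<Longrightarrow> \<bar>\<psi> x\<bar> \<le> Q"
  shows "(\<integral>x. \<psi> x * \<G> f x \<partial>M) = (\<integral>x. \<G> \<psi> x * f x \<partial>M)"
proof -
  have "(\<integral>x. \<psi> x * \<G> f x \<partial>M) = (\<integral>x. \<integral>y. \<psi> x * (G x y * f y) \<partial>M \<partial>M)"
    by (simp add: green_fun_def)
  also have "\<dots> = (\<integral>y. \<integral>x. \<psi> x * (G x y * f y) \<partial>M \<partial>M)"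
    using MM.Fubini_integral[OF integrable_G_times_pair[OF f \<psi>]] by simp
  also have "\<dots> = (\<integral>y. \<G> \<psi> y * f y \<partial>M)"
  proof (rule Bochner_Integration.integral_cong[OF refl])
    fix y assume y: "y \<in> space M"
    have "(\<integral>x. \<psi> x * (G x y * f y) \<partial>M) = (\<integral>x. (G y x * \<psi> x) * f y \<partial>M)"
      using y G_sym by (intro Bochner_Integration.integral_cong) (auto simp: ac_simps)
    thus "(\<integral>x. \<psi> x * (G x y * f y) \<partial>M) = \<G> \<psi> y * f y"
      by (simp add: green_fun_def)
  qed
  finally show ?thesis .
qed

lemma green_fun_cong_AE:
  assumes "f \<in> borel_measurable M" "g \<in> borel_measurable M" "AE y in M. f y = g y" "x \<in> \<Omega>"
  shows "\<G> f x = \<G> g x"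
  unfolding green_fun_def using assms G_measurable_snd(1)[OF _ id_M, of x]
  by (intro integral_cong_AE) auto

lemma integrable_bounded_times:
  assumes h: "h \<in> borel_measurable M" "\<And>x. x \<in> \<Omega> \<Longrightarrow> \<bar>h x\<bar> \<le> (Q::real)" and f: "integrable M f"
  shows "integrable M (\<lambda>x. h x * f x)"
proof (rule Bochner_Integration.integrable_bound[of M "\<lambda>x. Q * f x"])
  show "integrable M (\<lambda>x. Q * f x)" using f by simp
  show "(\<lambda>x. h x * f x) \<in> borel_measurable M" using h(1) borel_measurable_integrable[OF f] by simp
  show "AE x in M. norm (h x * f x) \<le> norm (Q * f x)"
  proof (rule AE_I2)
    fix x assume "x \<in> space M"
    hence "\<bar>h x\<bar> \<le> \<bar>Q\<bar>" using h(2)[of x] by simp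
    from mult_right_mono[OF this, of "\<bar>f x\<bar>"]
    show "norm (h x * f x) \<le> norm (Q * f x)" by (simp add: abs_mult)
  qed
qed

lemma integrable_G:
  assumes "x \<in> \<Omega>" shows "integrable M (G x)" "(\<integral>y. G x y \<partial>M) \<le> C1"
proof -
  have m: "G x \<in> borel_measurable M" using G_measurable_snd(1)[OF assms id_M] .
  show i: "integrable M (G x)"
  proof (rule integrableI_nonneg[OF m])
    show "AE y in M. 0 \<le> G x y" using AE_space[of M] by eventually_elim (use assms G_nonneg in auto)
    show "(\<integral>\<^sup>+y. G x y \<partial>M) < \<infinity>" using C1'[OF assms] by (simp add: le_less_trans)
  qed
  have "ennreal (\<integral>y. G x y \<partial>M) = (\<integral>\<^sup>+y. G x y \<partial>M)"
    using i by (intro nn_integral_eq_integral[symmetric] AE_I2) (use assms G_nonneg in auto)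
  with C1'[OF assms] have "ennreal (\<integral>y. G x y \<partial>M) \<le> ennreal C1" by simp
  thus "(\<integral>y. G x y \<partial>M) \<le> C1" using C1(1) by (subst (asm) ennreal_le_iff) auto
qed

lemma
  assumes x: "x \<in> \<Omega>" and \<psi>: "\<psi> \<in> borel_measurable M" "\<And>x. x \<in> \<Omega> \<Longrightarrow> \<bar>\<psi> x\<bar> \<le> Q"
  shows integrable_G_bounded: "integrable M (\<lambda>y. G x y * \<psi> y)"
    and green_fun_bounded: "\<bar>\<G> \<psi> x\<bar> \<le> C1 * Q"
proof -
  have Q: "0 \<le> Q" using \<psi>(2) nonempty_\<Omega> abs_ge_zero order_trans by blast
  have m: "G x \<in> borel_measurable M" using G_measurable_snd(1)[OF x id_M] .
  have le: "\<bar>G x y * \<psi> y\<bar> \<le> G x y * Q" if "y \<in> \<Omega>" for y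
    using that x G_nonneg \<psi>(2) by (simp add: abs_mult mult_left_mono)
  show i: "integrable M (\<lambda>y. G x y * \<psi> y)"
    by (rule Bochner_Integration.integrable_bound[of M "\<lambda>y. G x y * Q"])
      (use integrable_G(1)[OF x] m \<psi>(1) le Q G_nonneg x in \<open>auto simp: abs_mult intro!: AE_I2\<close>)
  have "\<bar>\<G> \<psi> x\<bar> \<le> (\<integral>y. \<bar>G x y * \<psi> y\<bar> \<partial>M)"
    unfolding green_fun_def by (rule integral_abs_bound)
  also have "\<dots> \<le> (\<integral>y. G x y * Q \<partial>M)"
    using i integrable_G(1)[OF x] le by (intro integral_mono) auto
  also have "\<dots> \<le> C1 * Q" using integrable_G(2)[OF x] Q by (simp add: mult_right_mono)
  finally show "\<bar>\<G> \<psi> x\<bar> \<le> C1 * Q" .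
qed

text \<open>The continuity up to the boundary that is assumed of the Green operator enters only here, to make
  potentials of bounded functions admissible as test functions.\<close>

lemma green_fun_continuous:
  assumes "\<psi> \<in> borel_measurable M" "\<And>x. x \<in> \<Omega> \<Longrightarrow> \<bar>\<psi> x\<bar> \<le> Q"
  shows "continuous_on \<Omega> (\<G> \<psi>)" "\<G> \<psi> \<in> borel_measurable M"
proof -
  have "AE x in M. \<bar>\<psi> x\<bar> \<le> Q" using assms by (intro AE_I2) auto
  from G_cont[OF assms(1) this] obtain g where g: "continuous_on (closure \<Omega>) g"
    "\<And>x. x \<in> \<Omega> \<Longrightarrow> g x = \<G> \<psi> x" by blast
  have "continuous_on \<Omega> g" using g(1) closure_subset continuous_on_subset by blast
  thus 1: "continuous_on \<Omega> (\<G> \<psi>)" using g(2) continuous_on_cong by metis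
  show "\<G> \<psi> \<in> borel_measurable M"
    by (rule continuous_imp_measurable_on_sets_lebesgue[OF 1]) (rule \<Omega>_sets)
qed

lemma green_fun_add_AE:
  assumes "integrable M f" "integrable M g"
  shows "AE x in M. \<G> (\<lambda>y. a * f y + b * g y) x = a * \<G> f x + b * \<G> g x"
  using AE_integrable_G[OF assms(1)] AE_integrable_G[OF assms(2)]
proof eventually_elim
  case (elim x)
  have "\<G> (\<lambda>y. a * f y + b * g y) x = (\<integral>y. a * (G x y * f y) + b * (G x y * g y) \<partial>M)"
    unfolding green_fun_def by (intro Bochner_Integration.integral_cong) (auto simp: algebra_simps)
  thus ?case using elim by (simp add: green_fun_def)
qed

lemma
  assumes \<nu>: "\<nu> \<in> nonneg_measures \<Omega>"
  shows AE_integrable_G_meas: "AE x in M. integrable \<nu> (G x)"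
    and integrable_green_meas: "integrable M (green_meas G \<nu>)"
proof -
  note n = nonneg_measuresD[OF \<nu>]
  interpret \<nu>: finite_measure \<nu> by (rule n)
  interpret P: pair_sigma_finite M \<nu> ..
  have meas: "(\<lambda>(x, y). G x y) \<in> borel_measurable (M \<Otimes>\<^sub>M \<nu>)"
    unfolding case_prod_beta'
    by (intro G_measurable measurable_compose[OF measurable_fst id_M] measurable_compose[OF measurable_snd n(4)])
  have "integrable (M \<Otimes>\<^sub>M \<nu>) (\<lambda>(x, y). G x y)"
  proof (rule integrableI_bounded[OF meas])
    have "(\<integral>\<^sup>+p. ennreal (norm (case p of (x, y) \<Rightarrow> G x y)) \<partial>(M \<Otimes>\<^sub>M \<nu>))
      = (\<integral>\<^sup>+y. (\<integral>\<^sup>+x. ennreal \<bar>G x y\<bar> \<partial>M) \<partial>\<nu>)"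
      by (subst P.nn_integral_snd[symmetric]) (use meas in \<open>auto simp: split_beta'\<close>)
    also have "\<dots> \<le> (\<integral>\<^sup>+y. ennreal C1 \<partial>\<nu>)"
    proof (rule nn_integral_mono)
      fix y assume y: "y \<in> space \<nu>"
      have "(\<integral>\<^sup>+x. ennreal \<bar>G x y\<bar> \<partial>M) = (\<integral>\<^sup>+x. ennreal (G x y) \<partial>M)"
        using y n(2) G_nonneg by (intro nn_integral_cong) auto
      thus "(\<integral>\<^sup>+x. ennreal \<bar>G x y\<bar> \<partial>M) \<le> ennreal C1" using C1(2)[of y] y n(2) by simp
    qed
    also have "\<dots> < \<infinity>" by (simp add: ennreal_mult_less_top \<nu>.emeasure_eq_measure)
    finally show "(\<integral>\<^sup>+p. ennreal (norm (case p of (x, y) \<Rightarrow> G x y)) \<partial>(M \<Otimes>\<^sub>M \<nu>)) < \<infinity>" .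
  qed
  from P.AE_integrable_fst'[OF this] P.integrable_fst'[OF this]
  show "AE x in M. integrable \<nu> (G x)" "integrable M (green_meas G \<nu>)"
    by (auto simp: green_meas_def[abs_def])
qed

lemma green_meas_nonneg: "\<nu> \<in> nonneg_measures \<Omega> \<Longrightarrow> x \<in> \<Omega> \<Longrightarrow> 0 \<le> green_meas G \<nu> x"
  unfolding green_meas_def using G_nonneg nonneg_measuresD(2)
  by (intro Bochner_Integration.integral_nonneg) auto

lemma green_meas_far:
  assumes \<nu>: "\<nu> \<in> nonneg_measures \<Omega>" and x: "x \<in> \<Omega>" and d: "0 < d" "AE z in \<nu>. d \<le> dist x z"
  shows "green_meas G \<nu> x \<le> C * d powr - q * measure \<nu> \<Omega>"
proof -
  note n = nonneg_measuresD[OF \<nu>]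
  interpret \<nu>: finite_measure \<nu> by (rule n)
  have c0: "0 \<le> C * d powr - q" using C by simp
  have "ennreal \<bar>green_meas G \<nu> x\<bar> \<le> (\<integral>\<^sup>+z. ennreal \<bar>G x z\<bar> \<partial>\<nu>)"
    unfolding green_meas_def by (rule ennreal_abs_integral_le)
  also have "\<dots> \<le> (\<integral>\<^sup>+z. ennreal (C * d powr - q) \<partial>\<nu>)"
  proof (rule nn_integral_mono_AE)
    show "AE z in \<nu>. ennreal \<bar>G x z\<bar> \<le> ennreal (C * d powr - q)"
      using d(2) AE_space
    proof eventually_elim
      case (elim z)
      hence "z \<in> \<Omega>" using n by simp
      thus ?case using G_far[OF x _ d(1) elim(1)] G_nonneg[OF x] by (intro ennreal_leI) simp
    qed
  qed
  also have "\<dots> = ennreal (C * d powr - q * measure \<nu> \<Omega>)"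
    using c0 n by (simp add: \<nu>.emeasure_eq_measure ennreal_mult)
  finally have "\<bar>green_meas G \<nu> x\<bar> \<le> C * d powr - q * measure \<nu> \<Omega>"
    using c0 by (subst (asm) ennreal_le_iff) auto
  thus ?thesis by simp
qed

lemma dirac_nonneg: "x \<in> \<Omega> \<Longrightarrow> dirac \<Omega> x \<in> nonneg_measures \<Omega>"
  unfolding dirac_def nonneg_measures_def
  using prob_space.finite_measure[OF prob_space_return[of x B\<Omega>]] by auto

lemma green_meas_dirac:
  assumes "x \<in> \<Omega>" "z \<in> \<Omega>" shows "green_meas G (dirac \<Omega> z) x = G x z"
  unfolding green_meas_def dirac_def
  using assms G_measurable_snd(1)[OF assms(1) id_B\<Omega>] by (intro integral_return) auto

text \<open>The measure \<open>f m\<close> on the Borel sets of \<open>\<Omega>\<close>. Transporting the density along the identity lets \<open>m\<close> be Lebesgue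
  measure with its larger \<open>\<sigma>\<close>-algebra as well as a Borel measure; both cases are needed.\<close>

definition push :: "(real^'n) measure \<Rightarrow> (real^'n \<Rightarrow> ennreal) \<Rightarrow> (real^'n) measure" where
  "push m f = distr (density m f) B\<Omega> (\<lambda>x. x)"

lemma
  assumes m: "(\<lambda>x. x) \<in> measurable m B\<Omega>" and f: "f \<in> borel_measurable m"
  shows push_nonneg: "(\<integral>\<^sup>+x. f x \<partial>m) < \<infinity> \<Longrightarrow> push m f \<in> nonneg_measures \<Omega>"
    and nn_integral_push: "h \<in> borel_measurable B\<Omega> \<Longrightarrow> (\<integral>\<^sup>+y. h y \<partial>push m f) = (\<integral>\<^sup>+y. f y * h y \<partial>m)"
    and green_meas_push: "x \<in> \<Omega> \<Longrightarrow> green_meas G (push m f) x = enn2real (\<integral>\<^sup>+y. f y * G x y \<partial>m)"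
proof -
  have sp: "space m \<subseteq> \<Omega>" using measurable_space[OF m] by auto
  have md: "(\<lambda>x. x) \<in> measurable (density m f) B\<Omega>" using m by simp
  have *: "(\<integral>\<^sup>+y. h y \<partial>push m f) = (\<integral>\<^sup>+y. f y * h y \<partial>m)" if h: "h \<in> borel_measurable B\<Omega>" for h
  proof -
    have hm: "h \<in> borel_measurable m" using measurable_compose[OF m h] by simp
    have "(\<integral>\<^sup>+y. h y \<partial>push m f) = (\<integral>\<^sup>+y. h y \<partial>density m f)"
      unfolding push_def using nn_integral_distr[OF md, of h] h by simp
    also have "\<dots> = (\<integral>\<^sup>+y. f y * h y \<partial>m)" by (rule nn_integral_density[OF f hm])
    finally show ?thesis .
  qed
  show "h \<in> borel_measurable B\<Omega> \<Longrightarrow> (\<integral>\<^sup>+y. h y \<partial>push m f) = (\<integral>\<^sup>+y. f y * h y \<partial>m)" by (rule *)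
  show "push m f \<in> nonneg_measures \<Omega>" if "(\<integral>\<^sup>+x. f x \<partial>m) < \<infinity>"
  proof -
    have "emeasure (push m f) (space (push m f)) = (\<integral>\<^sup>+y. 1 \<partial>push m f)" by simp
    also have "\<dots> = (\<integral>\<^sup>+y. f y * 1 \<partial>m)" by (rule *) simp
    finally have "emeasure (push m f) (space (push m f)) \<noteq> \<infinity>" using that by simp
    hence "finite_measure (push m f)" by (rule finite_measureI)
    thus ?thesis unfolding nonneg_measures_def by (simp add: push_def)
  qed
  show "green_meas G (push m f) x = enn2real (\<integral>\<^sup>+y. f y * G x y \<partial>m)" if x: "x \<in> \<Omega>"
  proof -
    have gb: "G x \<in> borel_measurable B\<Omega>" by (rule G_measurable_snd(1)[OF x id_B\<Omega>])
    have "green_meas G (push m f) x = enn2real (\<integral>\<^sup>+y. G x y \<partial>push m f)"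
      unfolding green_meas_def
    proof (rule integral_eq_nn_integral)
      show "G x \<in> borel_measurable (push m f)" using gb by (simp add: push_def)
      show "AE y in push m f. 0 \<le> G x y" using x G_nonneg by (intro AE_I2) (auto simp: push_def)
    qed
    also have "(\<integral>\<^sup>+y. G x y \<partial>push m f) = (\<integral>\<^sup>+y. f y * G x y \<partial>m)"
      by (rule *) (use gb in simp)
    finally show ?thesis .
  qed
qed

end

section \<open>Local boundedness and uniqueness of solutions\<close>

lemma ennreal_add_same:
  assumes "0 \<le> x" "0 \<le> y"
  shows "ennreal (x * y) + (ennreal (x * y) + t) = ennreal (2 * x * y) + t"
proof -
  have "ennreal (x * y) + ennreal (x * y) = ennreal (2 * x * y)"
    using assms by (subst ennreal_plus[symmetric]) auto
  thus ?thesis by (simp add: add.assoc[symmetric])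
qed

lemma ennreal_affine_compose:
  fixes c d x y z :: real and t :: ennreal
  assumes "0 \<le> c" "0 \<le> d" "0 \<le> x" "0 \<le> y" "0 \<le> z"
  shows "ennreal c + ennreal d * (ennreal z * ennreal y + ennreal z * (ennreal x * t))
    = ennreal (c + d * z * y) + ennreal (d * z * x) * t"
  using assms by (simp add: ennreal_plus ennreal_mult algebra_simps)

context green_setting
begin

text \<open>Quantifying over \<open>F\<close> makes this the whole of \<open>\<Omega>\<close> for \<open>F = {}\<close>, whereas \<open>infdist\<close> puts every point at distance
  \<open>0\<close> from the empty set.\<close>

definition away :: "(real^'n) set \<Rightarrow> real \<Rightarrow> (real^'n) set" where
  "away F r = {x \<in> \<Omega>. \<forall>a\<in>F. r \<le> dist a x}"

lemma away_sets: "away F r \<in> sets B\<Omega>" "away F r \<in> sets M"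
proof -
  have "away F r = \<Omega> \<inter> (\<Inter>a\<in>F. {x. r \<le> dist a x})" by (auto simp: away_def)
  moreover have "closed (\<Inter>a\<in>F. {x. r \<le> dist a x})"
    by (intro closed_INT ballI closed_Collect_le continuous_intros)
  ultimately show 1: "away F r \<in> sets B\<Omega>"
    by (auto simp: sets_restrict_space)
  from measurable_sets[OF id_M 1] show "away F r \<in> sets M" by (simp add: away_def Int_def conj_commute)
qed

text \<open>The equation with an arbitrary function \<open>p\<close> in the place of the potential of a measure. Differences of
  potentials are then allowed, and solutions are closed under linear combinations.\<close>

definition sol :: "(real^'n \<Rightarrow> real) \<Rightarrow> (real^'n \<Rightarrow> real) \<Rightarrow> (real^'n \<Rightarrow> real) \<Rightarrow> bool" where
  "sol W p w \<longleftrightarrow> integrable M w \<and> integrable M (\<lambda>x. W x * w x) \<and>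
     (AE x in M. w x = p x - \<G> (\<lambda>y. W y * w y) x)"

lemma green_solution_iff_sol: "green_solution \<Omega> G W \<nu> w \<longleftrightarrow> sol W (green_meas G \<nu>) w"
  by (simp add: green_solution_def sol_def)

text \<open>The hypotheses of the local bound, as one predicate with fixed constants \<open>b\<close> and \<open>K\<close>: the bound has to be
  uniform over all potentials \<open>W\<close> and solutions \<open>w\<close> satisfying them, in particular over all \<open>\<epsilon>\<close>.\<close>

definition locally_controlled ::
  "(real^'n) set \<Rightarrow> (real \<Rightarrow> real) \<Rightarrow> real \<Rightarrow> (real^'n \<Rightarrow> real) \<Rightarrow> (real^'n \<Rightarrow> real) \<Rightarrow> (real^'n) measure \<Rightarrow> bool"
where
  "locally_controlled F b K W w \<nu> \<longleftrightarrow>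
     \<nu> \<in> nonneg_measures \<Omega> \<and> measure \<nu> \<Omega> \<le> K \<and> (\<forall>r>0. AE x in \<nu>. x \<notin> away F r) \<and>
     (\<forall>r>0. AE x in M. x \<in> away F r \<longrightarrow> \<bar>W x\<bar> \<le> b r) \<and>
     (\<integral>x. \<bar>w x\<bar> \<partial>M) \<le> K \<and> (\<integral>x. \<bar>W x * w x\<bar> \<partial>M) \<le> K \<and> sol W (green_meas G \<nu>) w"

lemma away_dist:
  assumes "x \<in> away F r" "y \<in> \<Omega>" "y \<notin> away F (r / 2)"
  shows "r / 2 \<le> dist x y"
proof -
  obtain a where a: "a \<in> F" "dist a y < r / 2" using assms by (auto simp: away_def not_le)
  have "r \<le> dist a x" using assms a by (auto simp: away_def)
  thus ?thesis using a dist_triangle[of a x y] by (simp add: dist_commute)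
qed

text \<open>Near \<open>x\<close> the potential \<open>W\<close> is bounded and \<open>\<nu>\<close> vanishes, so \<open>W * w\<close> contributes a Riesz potential of
  \<open>\<bar>w\<bar>\<close>. Everything else lies at distance at least \<open>r / 2\<close> from \<open>x\<close>, where the kernel is bounded and only the total
  masses matter.\<close>

lemma locally_controlled_base:
  assumes lc: "locally_controlled F b K W w \<nu>" and r: "0 < r"
  shows "AE x in M. x \<in> away F r \<longrightarrow> ennreal \<bar>w x\<bar> \<le> ennreal (2 * (C * (r / 2) powr - q) * K) +
    ennreal (C * \<bar>b (r / 2)\<bar>) * (\<integral>\<^sup>+z. riesz q x z * (ennreal \<bar>w z\<bar> * indicator (away F (r / 2)) z) \<partial>M)"
proof -
  let ?c = "C * (r / 2) powr - q"
  have c0: "0 \<le> ?c" using C by simp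
  have \<nu>: "\<nu> \<in> nonneg_measures \<Omega>" "measure \<nu> \<Omega> \<le> K" "AE y in \<nu>. y \<notin> away F (r / 2)"
    and Wb: "AE y in M. y \<in> away F (r / 2) \<longrightarrow> \<bar>W y\<bar> \<le> b (r / 2)"
    and K: "(\<integral>x. \<bar>w x\<bar> \<partial>M) \<le> K" "(\<integral>x. \<bar>W x * w x\<bar> \<partial>M) \<le> K"
    and i: "integrable M w" "integrable M (\<lambda>x. W x * w x)"
    and eq: "AE x in M. w x = green_meas G \<nu> x - \<G> (\<lambda>y. W y * w y) x"
    using lc r by (auto simp: locally_controlled_def sol_def)
  note n = nonneg_measuresD[OF \<nu>(1)]
  interpret \<nu>: finite_measure \<nu> by (rule n)
  have K0: "0 \<le> K" using \<nu>(2) measure_nonneg order_trans by blast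
  note [measurable] = borel_measurable_integrable[OF i(1)] borel_measurable_integrable[OF i(2)] away_sets(2)
  show ?thesis using eq
  proof eventually_elim
    case (elim x)
    show ?case
    proof
      assume x: "x \<in> away F r"
      hence x\<Omega>: "x \<in> \<Omega>" by (simp add: away_def)
      have "AE y in \<nu>. r / 2 \<le> dist x y"
        using \<nu>(3) AE_space by eventually_elim (use n away_dist[OF x] in auto)
      from green_meas_far[OF \<nu>(1) x\<Omega> _ this]
      have "green_meas G \<nu> x \<le> ?c * measure \<nu> \<Omega>" using r by simp
      also have "\<dots> \<le> ?c * K" using c0 \<nu>(2) by (intro mult_left_mono)
      finally have 1: "ennreal \<bar>green_meas G \<nu> x\<bar> \<le> ennreal (?c * K)"
        using green_meas_nonneg[OF \<nu>(1) x\<Omega>] by (intro ennreal_leI) simp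
      let ?I = "\<integral>\<^sup>+z. riesz q x z * (ennreal \<bar>w z\<bar> * indicator (away F (r / 2)) z) \<partial>M"
      have "ennreal \<bar>\<G> (\<lambda>y. W y * w y) x\<bar> \<le> (\<integral>\<^sup>+y. ennreal \<bar>G x y * (W y * w y)\<bar> \<partial>M)"
        unfolding green_fun_def by (rule ennreal_abs_integral_le)
      also have "\<dots> \<le> (\<integral>\<^sup>+y. ennreal ?c * ennreal \<bar>W y * w y\<bar>
          + ennreal (C * \<bar>b (r / 2)\<bar>) * (riesz q x y * (ennreal \<bar>w y\<bar> * indicator (away F (r / 2)) y)) \<partial>M)"
      proof (rule nn_integral_mono_AE)
        show "AE y in M. ennreal \<bar>G x y * (W y * w y)\<bar> \<le> ennreal ?c * ennreal \<bar>W y * w y\<bar>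
          + ennreal (C * \<bar>b (r / 2)\<bar>) * (riesz q x y * (ennreal \<bar>w y\<bar> * indicator (away F (r / 2)) y))"
          using Wb AE_space[of M] AE_neq_point[OF \<Omega>_sets(2), of x]
        proof eventually_elim
          case (elim y)
          hence y: "y \<in> \<Omega>" "x \<noteq> y" by auto
          have abs: "ennreal \<bar>G x y * (W y * w y)\<bar> = ennreal (G x y) * ennreal \<bar>W y * w y\<bar>"
            using x\<Omega> y G_nonneg[of x y] by (simp add: abs_mult ennreal_mult)
          show ?case
          proof (cases "y \<in> away F (r / 2)")
            case False
            have "ennreal (G x y) * ennreal \<bar>W y * w y\<bar> \<le> ennreal ?c * ennreal \<bar>W y * w y\<bar>"
              using G_far[OF x\<Omega> y(1) _ away_dist[OF x y(1) False]] r
              by (intro mult_right_mono ennreal_leI) auto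
            thus ?thesis unfolding abs by (simp add: add_increasing2)
          next
            case True
            have "ennreal (G x y) * ennreal \<bar>W y * w y\<bar>
                \<le> (ennreal C * riesz q x y) * (ennreal \<bar>b (r / 2)\<bar> * ennreal \<bar>w y\<bar>)"
            proof (rule mult_mono)
              show "ennreal (G x y) \<le> ennreal C * riesz q x y" by (rule G_le_riesz[OF x\<Omega> y])
              have "\<bar>W y\<bar> \<le> \<bar>b (r / 2)\<bar>" using elim(1) True by auto
              thus "ennreal \<bar>W y * w y\<bar> \<le> ennreal \<bar>b (r / 2)\<bar> * ennreal \<bar>w y\<bar>"
                by (auto simp: abs_mult simp flip: ennreal_mult intro!: ennreal_leI mult_right_mono)
            qed auto
            also have "\<dots> = ennreal (C * \<bar>b (r / 2)\<bar>) * (riesz q x y * (ennreal \<bar>w y\<bar> * indicator (away F (r / 2)) y))"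
              using True C by (simp add: ennreal_mult ac_simps)
            finally show ?thesis unfolding abs by (simp add: add_increasing)
          qed
        qed
      qed
      also have "\<dots> = ennreal ?c * (\<integral>\<^sup>+y. ennreal \<bar>W y * w y\<bar> \<partial>M) + ennreal (C * \<bar>b (r / 2)\<bar>) * ?I"
        by (simp add: nn_integral_add nn_integral_cmult)
      also have "(\<integral>\<^sup>+y. ennreal \<bar>W y * w y\<bar> \<partial>M) = ennreal (\<integral>y. \<bar>W y * w y\<bar> \<partial>M)"
        using i by (intro nn_integral_eq_integral) auto
      also have "ennreal ?c * ennreal (\<integral>y. \<bar>W y * w y\<bar> \<partial>M) \<le> ennreal (?c * K)"
        using c0 K by (simp add: ennreal_mult[symmetric] ennreal_leI mult_left_mono)
      finally have 2: "ennreal \<bar>\<G> (\<lambda>y. W y * w y) x\<bar>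
          \<le> ennreal (?c * K) + ennreal (C * \<bar>b (r / 2)\<bar>) * ?I"
        by (simp add: add_right_mono)
      have "ennreal \<bar>w x\<bar> \<le> ennreal (\<bar>green_meas G \<nu> x\<bar> + \<bar>\<G> (\<lambda>y. W y * w y) x\<bar>)"
        unfolding elim by (intro ennreal_leI) simp
      also have "\<dots> \<le> ennreal (?c * K) + (ennreal (?c * K) + ennreal (C * \<bar>b (r / 2)\<bar>) * ?I)"
        by (simp add: ennreal_plus add_mono 1 2)
      also have "\<dots> = ennreal (2 * ?c * K) + ennreal (C * \<bar>b (r / 2)\<bar>) * ?I"
        by (rule ennreal_add_same) (use c0 K0 in auto)
      finally show "ennreal \<bar>w x\<bar> \<le> ennreal (2 * ?c * K) + ennreal (C * \<bar>b (r / 2)\<bar>) * ?I" .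
    qed
  qed
qed

definition riesz_dominated :: "real \<Rightarrow> (real^'n) set \<Rightarrow> (real \<Rightarrow> real) \<Rightarrow> real \<Rightarrow> bool" where
  "riesz_dominated a F b K \<longleftrightarrow> (\<forall>r>0. \<exists>D\<ge>0. \<forall>W w \<nu>. locally_controlled F b K W w \<nu> \<longrightarrow>
     (AE x in M. x \<in> away F r \<longrightarrow>
        ennreal \<bar>w x\<bar> \<le> ennreal D + ennreal D * (\<integral>\<^sup>+z. riesz a x z * ennreal \<bar>w z\<bar> \<partial>M)))"

lemma riesz_dominated_q: "0 \<le> K \<Longrightarrow> riesz_dominated q F b K"
  unfolding riesz_dominated_def
proof (intro allI impI)
  fix r :: real assume K: "0 \<le> K" and r: "0 < r"
  let ?c = "2 * (C * (r / 2) powr - q) * K" and ?d = "C * \<bar>b (r / 2)\<bar>"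
  have cd: "0 \<le> ?c" "0 \<le> ?d" using C K by auto
  show "\<exists>D\<ge>0. \<forall>W w \<nu>. locally_controlled F b K W w \<nu> \<longrightarrow>
     (AE x in M. x \<in> away F r \<longrightarrow>
        ennreal \<bar>w x\<bar> \<le> ennreal D + ennreal D * (\<integral>\<^sup>+z. riesz q x z * ennreal \<bar>w z\<bar> \<partial>M))"
  proof (intro exI[of _ "?c + ?d"] conjI allI impI)
    show "0 \<le> ?c + ?d" using cd by simp
    fix W w \<nu> assume "locally_controlled F b K W w \<nu>"
    from locally_controlled_base[OF this r]
    show "AE x in M. x \<in> away F r \<longrightarrow>
        ennreal \<bar>w x\<bar> \<le> ennreal (?c + ?d) + ennreal (?c + ?d) * (\<integral>\<^sup>+z. riesz q x z * ennreal \<bar>w z\<bar> \<partial>M)"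
    proof eventually_elim
      case (elim x)
      show ?case
      proof
        assume x: "x \<in> away F r"
        have "ennreal \<bar>w x\<bar> \<le> ennreal ?c + ennreal ?d *
            (\<integral>\<^sup>+z. riesz q x z * (ennreal \<bar>w z\<bar> * indicator (away F (r / 2)) z) \<partial>M)" using elim x by blast
        also have "\<dots> \<le> ennreal (?c + ?d) + ennreal (?c + ?d) * (\<integral>\<^sup>+z. riesz q x z * ennreal \<bar>w z\<bar> \<partial>M)"
          using cd by (intro add_mono mult_mono nn_integral_mono ennreal_leI) (auto simp: indicator_def)
        finally show "ennreal \<bar>w x\<bar> \<le> ennreal (?c + ?d) + ennreal (?c + ?d) * (\<integral>\<^sup>+z. riesz q x z * ennreal \<bar>w z\<bar> \<partial>M)" .
      qed
    qed
  qed
qed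

lemma id_borel_M: "(\<lambda>x. x) \<in> borel_measurable M"
  using id_M by (auto simp: measurable_restrict_space2_iff)

lemma riesz_measurable_MM: "(\<lambda>p. riesz a (fst p) (snd p)) \<in> borel_measurable (M \<Otimes>\<^sub>M M)"
  by (intro riesz_measurable measurable_compose[OF measurable_fst id_borel_M]
      measurable_compose[OF measurable_snd id_borel_M])

lemma riesz_measurable_left:
  assumes "h \<in> borel_measurable M"
  shows "(\<lambda>x. \<integral>\<^sup>+z. riesz a x z * h z \<partial>M) \<in> borel_measurable M"
proof (rule M.borel_measurable_nn_integral)
  have "(\<lambda>p. riesz a (fst p) (snd p) * h (snd p)) \<in> borel_measurable (M \<Otimes>\<^sub>M M)"
    by (intro borel_measurable_times_ennreal riesz_measurable_MM measurable_compose[OF measurable_snd assms])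
  thus "(\<lambda>(x, z). riesz a x z * h z) \<in> borel_measurable (M \<Otimes>\<^sub>M M)"
    by (simp add: case_prod_beta')
qed

lemma riesz_iterate:
  assumes a: "0 \<le> e" "e \<le> a" "a \<le> q" "a - e < 2 * s"
  obtains D where "0 \<le> D" "\<And>x h. h \<in> borel_measurable M \<Longrightarrow>
    (\<integral>\<^sup>+z. riesz q x z * (\<integral>\<^sup>+y. riesz a z y * h y \<partial>M) \<partial>M) \<le> ennreal D * (\<integral>\<^sup>+y. riesz e x y * h y \<partial>M)"
proof -
  obtain D where D: "0 \<le> D" "\<And>x y. x \<noteq> y \<Longrightarrow>
      (\<integral>\<^sup>+z. riesz q x z * riesz a z y \<partial>M) \<le> ennreal D * riesz e x y"
    by (rule riesz_composition[of e q a \<Omega>])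
      (use a bounded_\<Omega> \<Omega>_sets in \<open>auto simp: q_def\<close>)
  show thesis
  proof (rule that[of D])
    show "0 \<le> D" by (rule D)
    fix x and h :: "real^'n \<Rightarrow> ennreal" assume h[measurable]: "h \<in> borel_measurable M"
    have h1: "(\<lambda>y. riesz a z y * h y) \<in> borel_measurable M" for a z
      by (intro borel_measurable_times_ennreal riesz_measurable_lebesgue_on h)
    have m: "(\<lambda>(z, y). riesz q x z * (riesz a z y * h y)) \<in> borel_measurable (M \<Otimes>\<^sub>M M)"
      unfolding case_prod_beta'
      by (intro borel_measurable_times_ennreal riesz_measurable_MM measurable_compose[OF measurable_snd h]
          measurable_compose[OF measurable_fst riesz_measurable_lebesgue_on(1)])
    have "(\<integral>\<^sup>+z. riesz q x z * (\<integral>\<^sup>+y. riesz a z y * h y \<partial>M) \<partial>M)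
        = (\<integral>\<^sup>+z. \<integral>\<^sup>+y. riesz q x z * (riesz a z y * h y) \<partial>M \<partial>M)"
      by (simp only: nn_integral_cmult[OF h1])
    also have "\<dots> = (\<integral>\<^sup>+y. \<integral>\<^sup>+z. riesz q x z * (riesz a z y * h y) \<partial>M \<partial>M)"
      by (rule MM.Fubini'[symmetric]) (rule m)
    also have "\<dots> = (\<integral>\<^sup>+y. (\<integral>\<^sup>+z. riesz q x z * riesz a z y \<partial>M) * h y \<partial>M)"
    proof (rule nn_integral_cong)
      fix y
      have "(\<lambda>z. riesz q x z * riesz a z y) \<in> borel_measurable M"
        by (intro borel_measurable_times_ennreal riesz_measurable_lebesgue_on)
      from nn_integral_multc[OF this, of "h y"]
      show "(\<integral>\<^sup>+z. riesz q x z * (riesz a z y * h y) \<partial>M) = (\<integral>\<^sup>+z. riesz q x z * riesz a z y \<partial>M) * h y"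
        by (simp add: mult.assoc)
    qed
    also have "\<dots> \<le> (\<integral>\<^sup>+y. ennreal D * (riesz e x y * h y) \<partial>M)"
    proof (rule nn_integral_mono_AE)
      show "AE y in M. (\<integral>\<^sup>+z. riesz q x z * riesz a z y \<partial>M) * h y \<le> ennreal D * (riesz e x y * h y)"
        using AE_neq_point[OF \<Omega>_sets(2), of x]
        by eventually_elim (use D(2) in \<open>auto simp: mult.assoc[symmetric] intro!: mult_right_mono\<close>)
    qed
    also have "\<dots> = ennreal D * (\<integral>\<^sup>+y. riesz e x y * h y \<partial>M)"
      by (rule nn_integral_cmult[OF h1])
    finally show "(\<integral>\<^sup>+z. riesz q x z * (\<integral>\<^sup>+y. riesz a z y * h y \<partial>M) \<partial>M)
      \<le> ennreal D * (\<integral>\<^sup>+y. riesz e x y * h y \<partial>M)" .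
  qed
qed

text \<open>Inserting the estimate of exponent \<open>a\<close> into the basic one composes two Riesz kernels. This lowers the
  exponent, by anything less than \<open>2 s\<close>, at the price of halving the distance to \<open>F\<close>.\<close>

lemma riesz_dominated_step:
  assumes K: "0 \<le> K" and dom: "riesz_dominated a F b K" and a: "0 \<le> e" "e \<le> a" "a \<le> q" "a - e < 2 * s"
  shows "riesz_dominated e F b K"
  unfolding riesz_dominated_def
proof (intro allI impI)
  fix r :: real assume r: "0 < r"
  let ?c = "2 * (C * (r / 2) powr - q) * K" and ?d = "C * \<bar>b (r / 2)\<bar>"
  have cd: "0 \<le> ?c" "0 \<le> ?d" using C K by auto
  obtain D1 where D1: "0 \<le> D1" "\<And>x h. h \<in> borel_measurable M \<Longrightarrow>
    (\<integral>\<^sup>+z. riesz q x z * (\<integral>\<^sup>+y. riesz a z y * h y \<partial>M) \<partial>M) \<le> ennreal D1 * (\<integral>\<^sup>+y. riesz e x y * h y \<partial>M)"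
    by (rule riesz_iterate[OF a]) (rule that)
  obtain D2 where D2: "0 \<le> D2" "\<And>x. (\<integral>\<^sup>+z. riesz q x z \<partial>M) \<le> ennreal D2"
    by (rule riesz_integral_bounded[OF q(4) q(3) bounded_\<Omega> \<Omega>_sets(2)]) (rule that)
  obtain D3 where D3: "0 \<le> D3" "\<And>W w \<nu>. locally_controlled F b K W w \<nu> \<Longrightarrow>
     (AE x in M. x \<in> away F (r / 2) \<longrightarrow>
        ennreal \<bar>w x\<bar> \<le> ennreal D3 + ennreal D3 * (\<integral>\<^sup>+z. riesz a x z * ennreal \<bar>w z\<bar> \<partial>M))"
    using dom r unfolding riesz_dominated_def by (meson half_gt_zero)
  let ?D = "?c + ?d * D3 * D2 + ?d * D3 * D1"
  have D0: "0 \<le> ?d * D3 * D2" "0 \<le> ?d * D3 * D1" "0 \<le> ?d * D3" using cd D1 D2 D3 by auto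
  show "\<exists>D\<ge>0. \<forall>W w \<nu>. locally_controlled F b K W w \<nu> \<longrightarrow>
     (AE x in M. x \<in> away F r \<longrightarrow>
        ennreal \<bar>w x\<bar> \<le> ennreal D + ennreal D * (\<integral>\<^sup>+z. riesz e x z * ennreal \<bar>w z\<bar> \<partial>M))"
  proof (intro exI[of _ ?D] conjI allI impI)
    show "0 \<le> ?D" using cd D0 by simp
    fix W w \<nu> assume lc: "locally_controlled F b K W w \<nu>"
    have "integrable M w" using lc by (simp add: locally_controlled_def sol_def)
    hence w: "(\<lambda>z. ennreal \<bar>w z\<bar>) \<in> borel_measurable M" by simp
    show "AE x in M. x \<in> away F r \<longrightarrow>
        ennreal \<bar>w x\<bar> \<le> ennreal ?D + ennreal ?D * (\<integral>\<^sup>+z. riesz e x z * ennreal \<bar>w z\<bar> \<partial>M)"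
      using locally_controlled_base[OF lc r]
    proof eventually_elim
      case (elim x)
      show ?case
      proof
        assume x: "x \<in> away F r"
        let ?I = "\<lambda>a x. \<integral>\<^sup>+z. riesz a x z * ennreal \<bar>w z\<bar> \<partial>M"
        have mI: "?I a \<in> borel_measurable M" by (rule riesz_measurable_left[OF w])
        have "(\<integral>\<^sup>+z. riesz q x z * (ennreal \<bar>w z\<bar> * indicator (away F (r / 2)) z) \<partial>M)
            \<le> (\<integral>\<^sup>+z. ennreal D3 * riesz q x z + ennreal D3 * (riesz q x z * ?I a z) \<partial>M)"
        proof (rule nn_integral_mono_AE)
          show "AE z in M. riesz q x z * (ennreal \<bar>w z\<bar> * indicator (away F (r / 2)) z)
              \<le> ennreal D3 * riesz q x z + ennreal D3 * (riesz q x z * ?I a z)"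
            using D3(2)[OF lc]
          proof eventually_elim
            case (elim z)
            have "ennreal \<bar>w z\<bar> * indicator (away F (r / 2)) z \<le> ennreal D3 + ennreal D3 * ?I a z"
              using elim by (auto simp: indicator_def)
            from mult_left_mono[OF this, of "riesz q x z"] show ?case
              by (simp add: algebra_simps)
          qed
        qed
        also have "\<dots> = ennreal D3 * (\<integral>\<^sup>+z. riesz q x z \<partial>M) + ennreal D3 * (\<integral>\<^sup>+z. riesz q x z * ?I a z \<partial>M)"
          using mI by (simp add: nn_integral_add nn_integral_cmult)
        also have "\<dots> \<le> ennreal D3 * ennreal D2 + ennreal D3 * (ennreal D1 * ?I e x)"
          by (intro add_mono mult_left_mono D2 D1(2) w) auto
        finally have I: "(\<integral>\<^sup>+z. riesz q x z * (ennreal \<bar>w z\<bar> * indicator (away F (r / 2)) z) \<partial>M)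
            \<le> ennreal D3 * ennreal D2 + ennreal D3 * (ennreal D1 * ?I e x)" .
        have "ennreal \<bar>w x\<bar> \<le> ennreal ?c + ennreal ?d *
            (\<integral>\<^sup>+z. riesz q x z * (ennreal \<bar>w z\<bar> * indicator (away F (r / 2)) z) \<partial>M)" using elim x by blast
        also have "\<dots> \<le> ennreal ?c + ennreal ?d * (ennreal D3 * ennreal D2 + ennreal D3 * (ennreal D1 * ?I e x))"
          by (intro add_left_mono mult_left_mono I) auto
        also have "\<dots> = ennreal (?c + ?d * D3 * D2) + ennreal (?d * D3 * D1) * ?I e x"
          by (rule ennreal_affine_compose) (use cd D1(1) D2(1) D3(1) in auto)
        also have "\<dots> \<le> ennreal ?D + ennreal ?D * ?I e x"
          by (rule add_mono[OF ennreal_leI mult_right_mono[OF ennreal_leI]]) (use cd D0 in auto)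
        finally show "ennreal \<bar>w x\<bar> \<le> ennreal ?D + ennreal ?D * ?I e x" .
      qed
    qed
  qed
qed

text \<open>Lowering the exponent by \<open>s\<close> finitely often reaches \<open>0\<close>, where the Riesz potential of \<open>\<bar>w\<bar>\<close> is just its
  \<open>L\<^sup>1\<close> norm.\<close>

lemma locally_controlled_bounded:
  assumes K: "0 \<le> K" and r: "0 < r"
  obtains B where "\<And>W w \<nu>. locally_controlled F b K W w \<nu> \<Longrightarrow> AE x in M. x \<in> away F r \<longrightarrow> \<bar>w x\<bar> \<le> B"
proof -
  have dom: "riesz_dominated (max 0 (q - real j * s)) F b K" for j
  proof (induction j)
    case 0
    thus ?case using riesz_dominated_q[OF K] q by simp
  next
    case (Suc j)
    show ?case
    proof (rule riesz_dominated_step[OF K Suc])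
      show "0 \<le> max 0 (q - real (Suc j) * s)" by simp
      show "max 0 (q - real (Suc j) * s) \<le> max 0 (q - real j * s)"
        using s by (simp add: algebra_simps max_def)
      show "max 0 (q - real j * s) \<le> q" using q s by simp
      show "max 0 (q - real j * s) - max 0 (q - real (Suc j) * s) < 2 * s"
        using s by (simp add: algebra_simps max_def)
    qed
  qed
  obtain j :: nat where "q / s < real j" using reals_Archimedean2 by blast
  hence "q < real j * s" using s by (simp add: field_simps)
  hence "riesz_dominated 0 F b K" using dom[of j] by (simp add: max_def split: if_splits)
  then obtain D where D: "0 \<le> D" "\<And>W w \<nu>. locally_controlled F b K W w \<nu> \<Longrightarrow>
     (AE x in M. x \<in> away F r \<longrightarrow>
        ennreal \<bar>w x\<bar> \<le> ennreal D + ennreal D * (\<integral>\<^sup>+z. riesz 0 x z * ennreal \<bar>w z\<bar> \<partial>M))"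
    using r unfolding riesz_dominated_def by meson
  show thesis
  proof (rule that[of "D + D * K"])
    fix W w \<nu> assume lc: "locally_controlled F b K W w \<nu>"
    have w: "integrable M w" "(\<integral>x. \<bar>w x\<bar> \<partial>M) \<le> K" using lc by (auto simp: locally_controlled_def sol_def)
    show "AE x in M. x \<in> away F r \<longrightarrow> \<bar>w x\<bar> \<le> D + D * K"
      using D(2)[OF lc]
    proof eventually_elim
      case (elim x)
      show ?case
      proof
        assume x: "x \<in> away F r"
        have "(\<integral>\<^sup>+z. riesz 0 x z * ennreal \<bar>w z\<bar> \<partial>M) \<le> (\<integral>\<^sup>+z. ennreal \<bar>w z\<bar> \<partial>M)"
        proof (rule nn_integral_mono)
          fix z
          have "riesz 0 x z \<le> 1" unfolding riesz_def by simp
          from mult_right_mono[OF this, of "ennreal \<bar>w z\<bar>"]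
          show "riesz 0 x z * ennreal \<bar>w z\<bar> \<le> ennreal \<bar>w z\<bar>" by simp
        qed
        also have "\<dots> = ennreal (\<integral>z. \<bar>w z\<bar> \<partial>M)" using w by (intro nn_integral_eq_integral) auto
        also have "\<dots> \<le> ennreal K" using w by (intro ennreal_leI)
        finally have "ennreal D + ennreal D * (\<integral>\<^sup>+z. riesz 0 x z * ennreal \<bar>w z\<bar> \<partial>M) \<le> ennreal D + ennreal D * ennreal K"
          by (intro add_left_mono mult_left_mono) auto
        also have "\<dots> = ennreal (D + D * K)" using D(1) K by (simp add: ennreal_plus ennreal_mult)
        finally have "ennreal \<bar>w x\<bar> \<le> ennreal (D + D * K)" using elim x order_trans by blast
        thus "\<bar>w x\<bar> \<le> D + D * K" using D(1) K by (subst (asm) ennreal_le_iff) auto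
      qed
    qed
  qed
qed

lemma sol_add:
  assumes "sol W p w" "sol W p' w'"
  shows "sol W (\<lambda>x. a * p x + b * p' x) (\<lambda>x. a * w x + b * w' x)"
  unfolding sol_def
proof (intro conjI)
  have i: "integrable M w" "integrable M w'" "integrable M (\<lambda>x. W x * w x)" "integrable M (\<lambda>x. W x * w' x)"
    and eq: "AE x in M. w x = p x - \<G> (\<lambda>y. W y * w y) x"
      "AE x in M. w' x = p' x - \<G> (\<lambda>y. W y * w' y) x"
    using assms by (auto simp: sol_def)
  have W: "(\<lambda>x. W x * (a * w x + b * w' x)) = (\<lambda>x. a * (W x * w x) + b * (W x * w' x))"
    by (auto simp: algebra_simps)
  show "integrable M (\<lambda>x. a * w x + b * w' x)" "integrable M (\<lambda>x. W x * (a * w x + b * w' x))"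
    unfolding W using i by auto
  show "AE x in M. a * w x + b * w' x = a * p x + b * p' x - \<G> (\<lambda>y. W y * (a * w y + b * w' y)) x"
    unfolding W using green_fun_add_AE[OF i(3,4), of a b] eq
  proof eventually_elim
    case (elim x)
    show ?case by (subst elim(2), subst elim(3), subst elim(1)) (simp add: algebra_simps)
  qed
qed

lemma sol_cong_AE:
  assumes "sol W p w" "AE x in M. p x = p' x" shows "sol W p' w"
  using assms unfolding sol_def by (auto elim: AE_mp)

lemma null_measure_nonneg: "null_measure B\<Omega> \<in> nonneg_measures \<Omega>"
  by (auto simp: nonneg_measures_def intro!: finite_measureI)

text \<open>Since \<open>z = - \<G> (W z)\<close>, semidefiniteness tested with \<open>W z\<close> gives \<open>\<integral> W z\<^sup>2 \<le> 0\<close>, hence \<open>W z = 0\<close> and \<open>z = 0\<close>.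
  The test function must be square integrable, while \<open>z\<close> is only integrable at first: the local bound
  with empty exceptional set shows that \<open>z\<close> is bounded.\<close>

lemma sol_zero:
  assumes W: "W \<in> borel_measurable M" "\<And>x. x \<in> \<Omega> \<Longrightarrow> 0 \<le> W x" "\<And>x. x \<in> \<Omega> \<Longrightarrow> W x \<le> b"
    and sol: "sol W (\<lambda>x. 0) z"
  shows "AE x in M. z x = 0"
proof -
  let ?f = "\<lambda>x. W x * z x"
  have i: "integrable M z" "integrable M ?f" and eq: "AE x in M. z x = - \<G> ?f x"
    using sol by (auto simp: sol_def)
  have gm: "green_meas G (null_measure B\<Omega>) = (\<lambda>x. 0)" by (auto simp: green_meas_def)
  define K where "K = max (\<integral>x. \<bar>z x\<bar> \<partial>M) (\<integral>x. \<bar>?f x\<bar> \<partial>M)"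
  have K: "0 \<le> K" unfolding K_def by (simp add: le_max_iff_disj)
  have lc: "locally_controlled {} (\<lambda>_. b) K W z (null_measure B\<Omega>)"
    unfolding locally_controlled_def gm
  proof (intro conjI allI impI)
    show "AE x in null_measure B\<Omega>. x \<notin> away {} r" for r
    proof -
      have "\<Omega> \<in> sets B\<Omega>" by (metis sets.top space_B\<Omega>)
      hence "\<Omega> \<in> null_sets (null_measure B\<Omega>)" by (simp add: null_sets_def)
      thus ?thesis by (rule AE_I') simp
    qed
    show "AE x in M. x \<in> away {} r \<longrightarrow> \<bar>W x\<bar> \<le> b" for r
      using W by (intro AE_I2) (auto simp: away_def)
  qed (use sol K null_measure_nonneg in \<open>auto simp: K_def measure_def\<close>)
  obtain Q where Q': "\<And>W w \<nu>. locally_controlled {} (\<lambda>_. b) K W w \<nu> \<Longrightarrow> AE x in M. x \<in> away {} 1 \<longrightarrow> \<bar>w x\<bar> \<le> Q"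
    by (rule locally_controlled_bounded[OF K zero_less_one]) (rule that)
  note Q = Q'[OF lc]
  have zb: "AE x in M. \<bar>z x\<bar> \<le> Q"
    using Q AE_space[of M] by eventually_elim (auto simp: away_def)
  have "AE x in M. \<bar>?f x\<bar> \<le> b * Q" using zb AE_space[of M]
    by eventually_elim (use W in \<open>auto simp: abs_mult intro!: mult_mono intro: order_trans\<close>)
  hence i2: "integrable M (\<lambda>x. (?f x)\<^sup>2)"
  proof (intro M.integrable_const_bound[of _ "(b * Q)\<^sup>2"])
    show "AE x in M. norm ((?f x)\<^sup>2) \<le> (b * Q)\<^sup>2" if "AE x in M. \<bar>?f x\<bar> \<le> b * Q"
      using that by eventually_elim (simp add: abs_le_square_iff[symmetric])
  qed (use i in auto)
  have "0 \<le> (\<integral>x. ?f x * \<G> ?f x \<partial>M)"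
    using i i2 by (intro G_psd) auto
  also have "\<dots> = (\<integral>x. - (W x * (z x)\<^sup>2) \<partial>M)"
    using eq i W(1) borel_measurable_integrable[OF integrable_green_fun[OF i(2)]]
    by (intro integral_cong_AE) (auto elim!: AE_mp simp: power2_eq_square)
  finally have le: "(\<integral>x. W x * (z x)\<^sup>2 \<partial>M) \<le> 0" by simp
  have nn: "AE x in M. 0 \<le> W x * (z x)\<^sup>2" using W by (intro AE_I2) auto
  have iz: "integrable M (\<lambda>x. W x * (z x)\<^sup>2)"
  proof (rule M.integrable_const_bound[of _ "b * Q\<^sup>2"])
    show "AE x in M. norm (W x * (z x)\<^sup>2) \<le> b * Q\<^sup>2"
      using zb AE_space[of M]
      by eventually_elim (use W in \<open>auto simp: abs_mult abs_le_square_iff[symmetric]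
          intro!: mult_mono intro: order_trans\<close>)
  qed (use i W in auto)
  have "AE x in M. W x * (z x)\<^sup>2 = 0"
    using integral_nonneg_eq_0_iff_AE[OF iz nn] le integral_nonneg_AE[OF nn] by simp
  hence f0: "AE x in M. ?f x = 0" by eventually_elim auto
  have "\<G> ?f x = 0" if "x \<in> \<Omega>" for x
    using green_fun_cong_AE[of ?f "\<lambda>_. 0" x] f0 i that by (simp add: green_fun_def)
  with eq AE_space[of M] show ?thesis by (auto elim!: AE_mp)
qed

lemma sol_unique:
  assumes W: "W \<in> borel_measurable M" "\<And>x. x \<in> \<Omega> \<Longrightarrow> 0 \<le> W x" "\<And>x. x \<in> \<Omega> \<Longrightarrow> W x \<le> b"
    and sol: "sol W p w" "sol W p' w'" and p: "AE x in M. p x = p' x"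
  shows "AE x in M. w x = w' x"
proof -
  have "sol W (\<lambda>x. 1 * p x + (-1) * p' x) (\<lambda>x. 1 * w x + (-1) * w' x)" by (rule sol_add[OF sol])
  hence "sol W (\<lambda>x. 0) (\<lambda>x. 1 * w x + (-1) * w' x)"
    by (rule sol_cong_AE) (use p in \<open>auto elim!: AE_mp\<close>)
  hence "AE x in M. 1 * w x + (-1) * w' x = 0"
    by (rule sol_zero[OF W(1), rotated 2]) (use W in auto)
  thus ?thesis by eventually_elim auto
qed

end

section \<open>Passing to the limit in the truncated equations\<close>

locale reduction_setting = green_setting \<Omega> s \<gamma> G c C q
  for \<Omega> :: "(real^'n) set" and s \<gamma> G c C q +
  fixes V :: "real^'n \<Rightarrow> ennreal" and S :: "(real^'n) set"
  assumes S: "finite S" "S \<subseteq> \<Omega>"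
    and admissible: "admissible_potential \<Omega> S V"
    and reduction: "\<And>\<nu>. \<nu> \<in> nonneg_measures \<Omega> \<Longrightarrow> \<exists>u \<alpha>. reduction_limit \<Omega> \<gamma> G V S \<nu> u \<alpha>"
begin

abbreviation Vr :: "real^'n \<Rightarrow> real" where "Vr x \<equiv> enn2real (V x)"
abbreviation T :: "real \<Rightarrow> real^'n \<Rightarrow> real" where "T \<equiv> truncate_pot V"

lemma V_measurable [measurable]: "V \<in> borel_measurable M"
  using admissible by (simp add: admissible_potential_def)

lemma T_measurable [measurable]: "T \<epsilon> \<in> borel_measurable M"
  unfolding truncate_pot_def by measurable

lemma T_nonneg: "0 \<le> T \<epsilon> x"
  by (simp add: truncate_pot_def)

lemma T_le: "0 < \<epsilon> \<Longrightarrow> T \<epsilon> x \<le> 1 / \<epsilon>"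
  unfolding truncate_pot_def by (rule enn2real_leI) auto

lemma T_eq: "V x \<le> ennreal (1 / \<epsilon>) \<Longrightarrow> T \<epsilon> x = Vr x"
  by (simp add: truncate_pot_def min_def)

lemma T_le_V: "V x < \<infinity> \<Longrightarrow> T \<epsilon> x \<le> Vr x"
  unfolding truncate_pot_def by (rule enn2real_mono) (auto simp: less_top)

lemma V_bounded_away:
  assumes "0 < \<rho>"
  obtains B where "0 \<le> B" "AE x in M. x \<in> away S \<rho> \<longrightarrow> V x \<le> ennreal B"
proof -
  have eq: "\<Omega> - (\<Union>z\<in>S. ball z \<rho>) = away S \<rho>" by (auto simp: away_def not_less)
  have "\<forall>\<rho>>0. \<exists>B::real. AE x in lebesgue_on (\<Omega> - (\<Union>z\<in>S. ball z \<rho>)). V x \<le> ennreal B"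
    using admissible unfolding admissible_potential_def by (rule conjunct2)
  from this[rule_format, OF assms]
  obtain B :: real where B: "AE x in lebesgue_on (away S \<rho>). V x \<le> ennreal B"
    unfolding eq by (rule exE)
  have meas: "away S \<rho> \<in> sets lebesgue"
    using away_sets(2)[of S \<rho>] \<Omega>_sets by (auto simp: sets_restrict_space)
  have "AE x in lebesgue. x \<in> away S \<rho> \<longrightarrow> V x \<le> ennreal B"
    using B meas by (subst (asm) AE_restrict_space_iff) auto
  hence "AE x in M. x \<in> away S \<rho> \<longrightarrow> V x \<le> ennreal B"
    using \<Omega>_sets by (subst AE_restrict_space_iff) (auto elim!: AE_mp)
  hence "AE x in M. x \<in> away S \<rho> \<longrightarrow> V x \<le> ennreal (max 0 B)"
    by eventually_elim (auto intro: order_trans ennreal_leI)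
  thus thesis by (intro that[of "max 0 B"]) auto
qed

lemma V_finite: "AE x in M. V x < \<infinity>"
proof -
  have 1: "AE x in M. x \<in> away S (1 / real (Suc k)) \<longrightarrow> V x < \<infinity>" for k
  proof -
    have k: "0 < 1 / real (Suc k)" by simp
    obtain B where B: "0 \<le> B" "AE x in M. x \<in> away S (1 / real (Suc k)) \<longrightarrow> V x \<le> ennreal B"
      by (rule V_bounded_away[OF k]) (rule that)
    show ?thesis using B(2) by eventually_elim (auto intro: le_less_trans)
  qed
  have 2: "AE x in M. x \<notin> S"
  proof -
    have "AE x in M. \<forall>z\<in>S. x \<noteq> z"
      by (rule AE_finite_allI[OF S(1)]) (rule AE_neq_point[OF \<Omega>_sets(2)])
    thus ?thesis by eventually_elim auto
  qed
  have "AE x in M. \<forall>k. x \<in> away S (1 / real (Suc k)) \<longrightarrow> V x < \<infinity>"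
    unfolding AE_all_countable by (intro allI 1)
  with 2 AE_space[of M] show ?thesis
  proof eventually_elim
    case (elim x)
    obtain d where d: "0 < d" "\<forall>z\<in>S. z \<noteq> x \<longrightarrow> d \<le> dist x z"
      using finite_set_avoid[OF S(1), of x] by blast
    obtain k :: nat where "1 / real (Suc k) < d" using nat_approx_posE[OF d(1)] by auto
    hence "x \<in> away S (1 / real (Suc k))"
      using d elim by (force simp: away_def dist_commute)
    thus ?case using elim by blast
  qed
qed

text \<open>The body of \<open>reduction_limit\<close> with the approximating family \<open>w\<close> exposed, since the arguments below compare
  several families.\<close>

definition reduces where
  "reduces \<nu> w u \<alpha> \<longleftrightarrow> \<nu> \<in> nonneg_measures \<Omega> \<and>
     (\<forall>\<epsilon>>0. green_solution \<Omega> G (T \<epsilon>) \<nu> (w \<epsilon>)) \<and>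
     (\<forall>\<epsilon> \<epsilon>'. 0 < \<epsilon>' \<and> \<epsilon>' \<le> \<epsilon> \<longrightarrow> (AE x in M. w \<epsilon>' x \<le> w \<epsilon> x)) \<and>
     integrable M u \<and>
     ((\<lambda>\<epsilon>. \<integral>x. \<bar>w \<epsilon> x - u x\<bar> \<partial>M) \<longlongrightarrow> 0) (at_right 0) \<and>
     (\<forall>\<phi> :: real^'n \<Rightarrow> real.
        continuous_on (closure \<Omega>) \<phi> \<and> (\<forall>x\<in>frontier \<Omega>. \<phi> x = 0) \<longrightarrow>
          integrable M (\<lambda>x. \<phi> x * bdist \<Omega> x powr \<gamma> * (Vr x * u x)) \<and>
          ((\<lambda>\<epsilon>. \<integral>x. \<phi> x * bdist \<Omega> x powr \<gamma> * (T \<epsilon> x * w \<epsilon> x) \<partial>M)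
            \<longlongrightarrow> (\<integral>x. \<phi> x * bdist \<Omega> x powr \<gamma> * (Vr x * u x) \<partial>M)
                + (\<Sum>x\<in>S. \<alpha> x * \<phi> x * bdist \<Omega> x powr \<gamma>)) (at_right 0))"

lemma reduction_limit_iff:
  "\<nu> \<in> nonneg_measures \<Omega> \<Longrightarrow> reduction_limit \<Omega> \<gamma> G V S \<nu> u \<alpha> \<longleftrightarrow> (\<exists>w. reduces \<nu> w u \<alpha>)"
  by (simp add: reduction_limit_def reduces_def)

lemma ex_reduces: "\<nu> \<in> nonneg_measures \<Omega> \<Longrightarrow> \<exists>w u \<alpha>. reduces \<nu> w u \<alpha>"
  using reduction reduction_limit_iff by blast

lemma at_right_0_I: "(\<And>\<epsilon>. 0 < \<epsilon> \<Longrightarrow> \<epsilon> < d \<Longrightarrow> P \<epsilon>) \<Longrightarrow> 0 < d \<Longrightarrow> eventually P (at_right (0::real))"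
  by (subst eventually_at_right[of 0 "1::real"]) auto

context
  fixes \<nu> w u \<alpha> assumes red: "reduces \<nu> w u \<alpha>"
begin

lemma red_nonneg: "\<nu> \<in> nonneg_measures \<Omega>"
  and red_sol: "0 < \<epsilon> \<Longrightarrow> sol (T \<epsilon>) (green_meas G \<nu>) (w \<epsilon>)"
  and red_mono: "0 < \<epsilon>' \<Longrightarrow> \<epsilon>' \<le> \<epsilon> \<Longrightarrow> AE x in M. w \<epsilon>' x \<le> w \<epsilon> x"
  and red_integrable: "integrable M u"
  and red_lim: "((\<lambda>\<epsilon>. \<integral>x. \<bar>w \<epsilon> x - u x\<bar> \<partial>M) \<longlongrightarrow> 0) (at_right 0)"
  using red by (auto simp: reduces_def green_solution_iff_sol)

lemma red_w:
  assumes "0 < \<epsilon>"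
  shows "integrable M (w \<epsilon>)" "integrable M (\<lambda>x. T \<epsilon> x * w \<epsilon> x)"
    "AE x in M. w \<epsilon> x = green_meas G \<nu> x - \<G> (\<lambda>y. T \<epsilon> y * w \<epsilon> y) x"
  using red_sol[OF assms] by (auto simp: sol_def)

text \<open>The family decreases to \<open>u\<close> in \<open>L\<^sup>1\<close>, so \<open>(u - w \<epsilon>)\<^sup>+ \<le> \<bar>w \<epsilon>' - u\<bar>\<close> for every \<open>\<epsilon>' < \<epsilon>\<close>, and the right-hand side
  tends to \<open>0\<close> in \<open>L\<^sup>1\<close>.\<close>

lemma red_le:
  assumes \<epsilon>: "0 < \<epsilon>" shows "AE x in M. u x \<le> w \<epsilon> x"
proof -
  let ?d = "\<lambda>x. max 0 (u x - w \<epsilon> x)"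
  have i: "integrable M ?d" using red_integrable red_w(1)[OF \<epsilon>] by auto
  have "eventually (\<lambda>\<epsilon>'. (\<integral>x. ?d x \<partial>M) \<le> (\<integral>x. \<bar>w \<epsilon>' x - u x\<bar> \<partial>M)) (at_right 0)"
  proof (rule at_right_0_I[OF _ \<epsilon>])
    fix \<epsilon>' :: real assume e: "0 < \<epsilon>'" "\<epsilon>' < \<epsilon>"
    show "(\<integral>x. ?d x \<partial>M) \<le> (\<integral>x. \<bar>w \<epsilon>' x - u x\<bar> \<partial>M)"
    proof (rule integral_mono_AE[OF i])
      show "integrable M (\<lambda>x. \<bar>w \<epsilon>' x - u x\<bar>)" using red_integrable red_w(1)[OF e(1)] by auto
      show "AE x in M. ?d x \<le> \<bar>w \<epsilon>' x - u x\<bar>"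
        using red_mono[OF e(1) less_imp_le[OF e(2)]] by eventually_elim auto
    qed
  qed
  from tendsto_lowerbound[OF red_lim this] have "(\<integral>x. ?d x \<partial>M) \<le> 0" by simp
  moreover have "0 \<le> (\<integral>x. ?d x \<partial>M)" by (rule Bochner_Integration.integral_nonneg) auto
  ultimately have "(\<integral>x. ?d x \<partial>M) = 0" by simp
  hence "AE x in M. ?d x = 0" using integral_nonneg_eq_0_iff_AE[OF i] by auto
  thus ?thesis by eventually_elim (auto simp: max_def split: if_splits)
qed

lemma integrable_away:
  assumes g: "g \<in> borel_measurable M" "\<And>x. x \<in> \<Omega> \<Longrightarrow> \<bar>g x\<bar> \<le> Q" and \<rho>: "0 < \<rho>"
    and off: "\<And>x. x \<in> \<Omega> \<Longrightarrow> x \<notin> away S \<rho> \<Longrightarrow> g x = 0" and h: "integrable M h"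
  shows "integrable M (\<lambda>x. g x * (Vr x * h x))"
    "\<exists>B. (\<forall>h. integrable M h \<longrightarrow> (\<bar>\<integral>x. g x * (Vr x * h x) \<partial>M\<bar> \<le> B * (\<integral>x. \<bar>h x\<bar> \<partial>M)))"
proof -
  obtain B where B: "0 \<le> B" "AE x in M. x \<in> away S \<rho> \<longrightarrow> V x \<le> ennreal B"
    by (rule V_bounded_away[OF \<rho>]) (rule that)
  have Q: "0 \<le> Q" using g(2) nonempty_\<Omega> abs_ge_zero order_trans by blast
  have bound: "AE x in M. \<bar>g x * (Vr x * h x)\<bar> \<le> Q * B * \<bar>h x\<bar>" for h
    using B(2) AE_space[of M]
  proof eventually_elim
    case (elim x)
    show ?case
    proof (cases "x \<in> away S \<rho>")
      case True
      have "Vr x \<le> B" using elim True B(1) by (intro enn2real_leI) auto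
      hence "\<bar>g x\<bar> * Vr x \<le> Q * B" using elim g(2) Q by (intro mult_mono) auto
      from mult_right_mono[OF this, of "\<bar>h x\<bar>"] show ?thesis by (simp add: abs_mult mult.assoc)
    next
      case False
      thus ?thesis using off elim Q B by simp
    qed
  qed
  have int: "integrable M (\<lambda>x. g x * (Vr x * h x))" if h: "integrable M h" for h
    by (rule Bochner_Integration.integrable_bound[of M "\<lambda>x. Q * B * \<bar>h x\<bar>"])
      (use h g(1) bound[of h] Q B in \<open>auto elim!: AE_mp\<close>)
  show "integrable M (\<lambda>x. g x * (Vr x * h x))" by (rule int[OF h])
  show "\<exists>B. (\<forall>h. integrable M h \<longrightarrow> (\<bar>\<integral>x. g x * (Vr x * h x) \<partial>M\<bar> \<le> B * (\<integral>x. \<bar>h x\<bar> \<partial>M)))"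
  proof (intro exI[of _ "Q * B"] allI impI)
    fix h :: "real^'n \<Rightarrow> real" assume h: "integrable M h"
    have "\<bar>\<integral>x. g x * (Vr x * h x) \<partial>M\<bar> \<le> (\<integral>x. \<bar>g x * (Vr x * h x)\<bar> \<partial>M)"
      by (rule integral_abs_bound)
    also have "\<dots> \<le> (\<integral>x. Q * B * \<bar>h x\<bar> \<partial>M)"
      using int[OF h] h bound[of h] by (intro integral_mono_AE) auto
    finally show "\<bar>\<integral>x. g x * (Vr x * h x) \<partial>M\<bar> \<le> Q * B * (\<integral>x. \<bar>h x\<bar> \<partial>M)" by simp
  qed
qed

lemma weak_limit_away:
  assumes g: "g \<in> borel_measurable M" "\<And>x. x \<in> \<Omega> \<Longrightarrow> \<bar>g x\<bar> \<le> Q" and \<rho>: "0 < \<rho>"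
    and off: "\<And>x. x \<in> \<Omega> \<Longrightarrow> x \<notin> away S \<rho> \<Longrightarrow> g x = 0"
  shows "((\<lambda>\<epsilon>. \<integral>x. g x * (T \<epsilon> x * w \<epsilon> x) \<partial>M) \<longlongrightarrow> (\<integral>x. g x * (Vr x * u x) \<partial>M)) (at_right 0)"
proof -
  obtain B where B: "0 \<le> B" "AE x in M. x \<in> away S \<rho> \<longrightarrow> V x \<le> ennreal B"
    by (rule V_bounded_away[OF \<rho>]) (rule that)
  from integrable_away(2)[OF g \<rho> off red_integrable]
  obtain D where D': "\<forall>h. integrable M h \<longrightarrow> \<bar>\<integral>x. g x * (Vr x * h x) \<partial>M\<bar> \<le> D * (\<integral>x. \<bar>h x\<bar> \<partial>M)"
    by (rule exE)
  note D = D'[rule_format]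
  have "eventually (\<lambda>\<epsilon>. norm ((\<integral>x. g x * (T \<epsilon> x * w \<epsilon> x) \<partial>M) - (\<integral>x. g x * (Vr x * u x) \<partial>M))
      \<le> D * (\<integral>x. \<bar>w \<epsilon> x - u x\<bar> \<partial>M)) (at_right 0)"
  proof (rule at_right_0_I[of "1 / (B + 1)"])
    show "0 < 1 / (B + 1)" using B by simp
    fix \<epsilon> :: real assume e: "0 < \<epsilon>" "\<epsilon> < 1 / (B + 1)"
    have "B \<le> 1 / \<epsilon>" using e B(1) by (simp add: field_simps)
    have "AE x in M. g x * (T \<epsilon> x * w \<epsilon> x) = g x * (Vr x * w \<epsilon> x)"
      using B(2) AE_space[of M]
    proof eventually_elim
      case (elim x)
      show ?case
      proof (cases "x \<in> away S \<rho>")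
        case True
        hence "V x \<le> ennreal (1 / \<epsilon>)" using elim \<open>B \<le> 1 / \<epsilon>\<close> ennreal_leI order_trans by blast
        thus ?thesis by (simp add: T_eq)
      qed (use off elim in auto)
    qed
    hence "(\<integral>x. g x * (T \<epsilon> x * w \<epsilon> x) \<partial>M) = (\<integral>x. g x * (Vr x * w \<epsilon> x) \<partial>M)"
      using g(1) red_w(1)[OF e(1)] by (intro integral_cong_AE) auto
    also have "\<dots> - (\<integral>x. g x * (Vr x * u x) \<partial>M) = (\<integral>x. g x * (Vr x * (w \<epsilon> x - u x)) \<partial>M)"
      using integrable_away(1)[OF g \<rho> off red_w(1)[OF e(1)]] integrable_away(1)[OF g \<rho> off red_integrable]
      by (subst Bochner_Integration.integral_diff[symmetric]) (auto simp: algebra_simps)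
    finally show "norm ((\<integral>x. g x * (T \<epsilon> x * w \<epsilon> x) \<partial>M) - (\<integral>x. g x * (Vr x * u x) \<partial>M))
      \<le> D * (\<integral>x. \<bar>w \<epsilon> x - u x\<bar> \<partial>M)"
      using D[of "\<lambda>x. w \<epsilon> x - u x"] red_w(1)[OF e(1)] red_integrable by auto
  qed
  moreover have "((\<lambda>\<epsilon>. D * (\<integral>x. \<bar>w \<epsilon> x - u x\<bar> \<partial>M)) \<longlongrightarrow> 0) (at_right 0)"
    using tendsto_mult_left[OF red_lim, of D] by simp
  ultimately have "((\<lambda>\<epsilon>. (\<integral>x. g x * (T \<epsilon> x * w \<epsilon> x) \<partial>M) - (\<integral>x. g x * (Vr x * u x) \<partial>M)) \<longlongrightarrow> 0) (at_right 0)"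
    by (rule Lim_null_comparison)
  thus ?thesis by (rule LIM_zero_cancel)
qed

text \<open>The test functions of the definition vanish on the boundary and carry the weight \<open>\<delta>\<^sup>\<gamma>\<close>. A cutoff \<open>\<eta>\<close> supported
  in small balls about \<open>S\<close>, where \<open>\<delta>\<close> is bounded below, turns any function continuous there into one of them, namely
  \<open>\<eta> * qf / \<delta>\<^sup>\<gamma>\<close>.\<close>

lemma weak_limit_near:
  assumes qf: "continuous_on (\<Omega> \<inter> (\<Union>z\<in>S. ball z \<rho>)) qf" "0 < \<rho>"
  obtains \<rho>' \<eta> where "0 < \<rho>'" "continuous_on UNIV \<eta>" "\<And>x. 0 \<le> \<eta> x \<and> \<eta> x \<le> (1::real)"
    "\<And>x. x \<in> \<Omega> \<Longrightarrow> x \<notin> away S \<rho>' \<Longrightarrow> \<eta> x = 1"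
    "integrable M (\<lambda>x. \<eta> x * qf x * (Vr x * u x))"
    "((\<lambda>\<epsilon>. \<integral>x. \<eta> x * qf x * (T \<epsilon> x * w \<epsilon> x) \<partial>M) \<longlongrightarrow>
        (\<integral>x. \<eta> x * qf x * (Vr x * u x) \<partial>M) + (\<Sum>z\<in>S. \<alpha> z * qf z)) (at_right 0)"
proof -
  obtain r0 where r0: "0 < r0" "(\<Union>z\<in>S. ball z r0) \<subseteq> \<Omega>"
    using compact_subset_open_imp_ball_epsilon_subset[OF finite_imp_compact[OF S(1)] open_\<Omega> S(2)] by blast
  define r where "r = min r0 \<rho>"
  have r: "0 < r" "r \<le> r0" "r \<le> \<rho>" using r0 qf by (auto simp: r_def)
  define \<eta> :: "real^'n \<Rightarrow> real" where "\<eta> x = min 1 (\<Sum>z\<in>S. max 0 (2 - dist z x / (r / 4)))" for x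
  have \<eta>_cont: "continuous_on A \<eta>" for A
    unfolding \<eta>_def using r by (intro continuous_intros) auto
  have \<eta>_range: "0 \<le> \<eta> x \<and> \<eta> x \<le> 1" for x
    unfolding \<eta>_def by (auto intro: sum_nonneg)
  have \<eta>_1: "\<eta> x = 1" if "z \<in> S" "dist z x < r / 4" for x z
  proof -
    have "1 \<le> max 0 (2 - dist z x / (r / 4))" using that r by (auto simp: field_simps max_def)
    also have "\<dots> \<le> (\<Sum>z\<in>S. max 0 (2 - dist z x / (r / 4)))"
      using that S by (intro member_le_sum) auto
    finally show ?thesis by (simp add: \<eta>_def)
  qed
  have \<eta>_0: "\<eta> x = 0" if "\<And>z. z \<in> S \<Longrightarrow> r / 2 < dist z x" for x
  proof -
    have "(\<Sum>z\<in>S. max 0 (2 - dist z x / (r / 4))) = 0"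
      using that r by (intro sum.neutral) (force simp: field_simps max_def)
    thus ?thesis by (simp add: \<eta>_def)
  qed
  define \<phi> where "\<phi> x = (if x \<in> \<Omega> then \<eta> x * qf x / bdist \<Omega> x powr \<gamma> else 0)" for x
  let ?U1 = "\<Omega> \<inter> (\<Union>z\<in>S. ball z r)" and ?U2 = "\<Inter>z\<in>S. {x. r / 2 < dist z x}"
  have "continuous_on ?U1 (\<lambda>x. \<eta> x * qf x / bdist \<Omega> x powr \<gamma>)"
  proof (intro continuous_on_divide continuous_on_mult \<eta>_cont continuous_on_powr continuous_on_const
      continuous_on_infdist continuous_on_id ballI)
    show "continuous_on ?U1 qf" by (rule continuous_on_subset[OF qf(1)]) (use r in auto)
    show "bdist \<Omega> x \<noteq> 0" "bdist \<Omega> x powr \<gamma> \<noteq> 0" if "x \<in> ?U1" for x using bdist_pos[of x] that by auto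
  qed
  hence c1: "continuous_on ?U1 \<phi>" by (rule continuous_on_eq) (auto simp: \<phi>_def)
  have "continuous_on ?U2 (\<lambda>x. 0 :: real)" by (rule continuous_on_const)
  hence c2: "continuous_on ?U2 \<phi>" by (rule continuous_on_eq) (auto simp: \<phi>_def \<eta>_0)
  have o2: "open ?U2" using S by (intro open_INT ballI open_Collect_less continuous_intros) auto
  have "open ?U1" using open_\<Omega> by (intro open_Int open_UN) auto
  from continuous_on_open_Un[OF this o2 c1 c2] have "continuous_on (?U1 \<union> ?U2) \<phi>" .
  moreover have "x \<in> ?U1 \<union> ?U2" for x
  proof (cases "x \<in> ?U2")
    case False
    then obtain z where z: "z \<in> S" "dist z x \<le> r / 2" by (auto simp: not_less)
    hence "x \<in> ball z r" using r by auto
    moreover have "ball z r \<subseteq> \<Omega>" using r0(2) r z(1) by (meson UN_subset_iff order_trans subset_ball)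
    ultimately show ?thesis using z by auto
  qed auto
  ultimately have cont: "continuous_on (closure \<Omega>) \<phi>" by (meson continuous_on_subset subsetI)
  have fr: "\<forall>x\<in>frontier \<Omega>. \<phi> x = 0" using open_\<Omega> by (auto simp: frontier_def interior_open \<phi>_def)
  have eq: "\<phi> x * bdist \<Omega> x powr \<gamma> = \<eta> x * qf x" if "x \<in> \<Omega>" for x
    using bdist_pos[OF that] that by (simp add: \<phi>_def)
  have main: "integrable M (\<lambda>x. \<phi> x * bdist \<Omega> x powr \<gamma> * (Vr x * u x)) \<and>
          ((\<lambda>\<epsilon>. \<integral>x. \<phi> x * bdist \<Omega> x powr \<gamma> * (T \<epsilon> x * w \<epsilon> x) \<partial>M)
            \<longlongrightarrow> (\<integral>x. \<phi> x * bdist \<Omega> x powr \<gamma> * (Vr x * u x) \<partial>M)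
                + (\<Sum>x\<in>S. \<alpha> x * \<phi> x * bdist \<Omega> x powr \<gamma>)) (at_right 0)"
    using red cont fr unfolding reduces_def by blast
  have i1: "integrable M (\<lambda>x. \<phi> x * bdist \<Omega> x powr \<gamma> * (Vr x * u x)) = integrable M (\<lambda>x. \<eta> x * qf x * (Vr x * u x))"
    by (intro Bochner_Integration.integrable_cong) (auto simp: eq)
  have i2: "(\<integral>x. \<phi> x * bdist \<Omega> x powr \<gamma> * h x \<partial>M) = (\<integral>x. \<eta> x * qf x * h x \<partial>M)" for h
    by (intro Bochner_Integration.integral_cong) (auto simp: eq)
  have i3: "(\<Sum>x\<in>S. \<alpha> x * \<phi> x * bdist \<Omega> x powr \<gamma>) = (\<Sum>z\<in>S. \<alpha> z * qf z)"
  proof (rule sum.cong[OF refl])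
    fix z assume z: "z \<in> S"
    show "\<alpha> z * \<phi> z * bdist \<Omega> z powr \<gamma> = \<alpha> z * qf z"
      using eq[of z] \<eta>_1[OF z, of z] z S r by (auto simp: mult.assoc)
  qed
  show thesis
  proof (rule that[of "r / 4" \<eta>])
    show "0 < r / 4" "continuous_on UNIV \<eta>" using r \<eta>_cont by auto
    show "0 \<le> \<eta> x \<and> \<eta> x \<le> 1" for x by (rule \<eta>_range)
    show "\<eta> x = 1" if "x \<in> \<Omega>" "x \<notin> away S (r / 4)" for x
      using \<eta>_1 that by (auto simp: away_def not_le)
  qed (use main in \<open>simp_all only: i1 i2 i3\<close>)
qed

text \<open>Convergence for test functions that are continuous only near \<open>S\<close>, with no condition at the boundary
  of \<open>\<Omega>\<close>. Away from \<open>S\<close> the potential is bounded, so there \<open>T \<epsilon> * w \<epsilon> \<rightarrow> V u\<close> in \<open>L\<^sup>1\<close> and boundedness of the test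
  function suffices. Indicators of balls and potentials of bounded functions are therefore admissible.\<close>

lemma weak_limit:
  assumes qf: "qf \<in> borel_measurable M" "\<And>x. x \<in> \<Omega> \<Longrightarrow> \<bar>qf x\<bar> \<le> Q"
    and cont: "continuous_on (\<Omega> \<inter> (\<Union>z\<in>S. ball z \<rho>)) qf" "0 < \<rho>"
  shows "integrable M (\<lambda>x. qf x * (Vr x * u x))"
    and "((\<lambda>\<epsilon>. \<integral>x. qf x * (T \<epsilon> x * w \<epsilon> x) \<partial>M) \<longlongrightarrow>
        (\<integral>x. qf x * (Vr x * u x) \<partial>M) + (\<Sum>z\<in>S. \<alpha> z * qf z)) (at_right 0)"
proof -
  obtain \<rho>' \<eta> where \<eta>: "0 < \<rho>'" "continuous_on UNIV \<eta>" "\<And>x. 0 \<le> \<eta> x \<and> \<eta> x \<le> (1::real)"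
    "\<And>x. x \<in> \<Omega> \<Longrightarrow> x \<notin> away S \<rho>' \<Longrightarrow> \<eta> x = 1"
    and i1: "integrable M (\<lambda>x. \<eta> x * qf x * (Vr x * u x))"
    and l1: "((\<lambda>\<epsilon>. \<integral>x. \<eta> x * qf x * (T \<epsilon> x * w \<epsilon> x) \<partial>M) \<longlongrightarrow>
        (\<integral>x. \<eta> x * qf x * (Vr x * u x) \<partial>M) + (\<Sum>z\<in>S. \<alpha> z * qf z)) (at_right 0)"
    by (rule weak_limit_near[OF cont]) (rule that)
  have \<eta>m: "\<eta> \<in> borel_measurable M"
    by (rule borel_measurable_lebesgue_onI) (rule borel_measurable_continuous_onI[OF \<eta>(2)])
  have Q: "0 \<le> Q" using qf(2) nonempty_\<Omega> abs_ge_zero order_trans by blast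
  have g: "(\<lambda>x. (1 - \<eta> x) * qf x) \<in> borel_measurable M"
    "x \<in> \<Omega> \<Longrightarrow> \<bar>(1 - \<eta> x) * qf x\<bar> \<le> Q" "x \<in> \<Omega> \<Longrightarrow> x \<notin> away S \<rho>' \<Longrightarrow> (1 - \<eta> x) * qf x = 0" for x
  proof -
    show "(\<lambda>x. (1 - \<eta> x) * qf x) \<in> borel_measurable M" using \<eta>m qf by simp
    show "x \<in> \<Omega> \<Longrightarrow> x \<notin> away S \<rho>' \<Longrightarrow> (1 - \<eta> x) * qf x = 0" using \<eta> by simp
    assume "x \<in> \<Omega>"
    hence "\<bar>1 - \<eta> x\<bar> * \<bar>qf x\<bar> \<le> 1 * Q" using \<eta>(3)[of x] qf Q by (intro mult_mono) auto
    thus "\<bar>(1 - \<eta> x) * qf x\<bar> \<le> Q" by (simp add: abs_mult)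
  qed
  have i2: "integrable M (\<lambda>x. (1 - \<eta> x) * qf x * (Vr x * u x))"
    by (rule integrable_away(1)[OF g(1) g(2) \<eta>(1) g(3) red_integrable])
  have l2: "((\<lambda>\<epsilon>. \<integral>x. (1 - \<eta> x) * qf x * (T \<epsilon> x * w \<epsilon> x) \<partial>M) \<longlongrightarrow>
      (\<integral>x. (1 - \<eta> x) * qf x * (Vr x * u x) \<partial>M)) (at_right 0)"
    by (rule weak_limit_away[OF g(1) g(2) \<eta>(1) g(3)])
  have split: "a * b * d + (1 - a) * b * d = b * d" for a b d :: real by (simp add: algebra_simps)
  from Bochner_Integration.integrable_add[OF i1 i2]
  show "integrable M (\<lambda>x. qf x * (Vr x * u x))" unfolding split .
  have s1: "(\<integral>x. \<eta> x * qf x * (Vr x * u x) \<partial>M) + (\<integral>x. (1 - \<eta> x) * qf x * (Vr x * u x) \<partial>M)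
      = (\<integral>x. qf x * (Vr x * u x) \<partial>M)"
    using Bochner_Integration.integral_add[OF i1 i2] unfolding split by simp
  have s2: "(\<integral>x. \<eta> x * qf x * (T \<epsilon> x * w \<epsilon> x) \<partial>M) + (\<integral>x. (1 - \<eta> x) * qf x * (T \<epsilon> x * w \<epsilon> x) \<partial>M)
      = (\<integral>x. qf x * (T \<epsilon> x * w \<epsilon> x) \<partial>M)" if \<epsilon>: "0 < \<epsilon>" for \<epsilon>
  proof -
    have bd: "integrable M (\<lambda>x. h x * (T \<epsilon> x * w \<epsilon> x))" if "h \<in> borel_measurable M" "\<And>x. x \<in> \<Omega> \<Longrightarrow> \<bar>h x\<bar> \<le> Q" for h
      by (rule integrable_bounded_times[OF that red_w(2)[OF \<epsilon>]])
    have "\<bar>\<eta> x * qf x\<bar> \<le> Q" if "x \<in> \<Omega>" for x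
    proof -
      have "\<bar>\<eta> x\<bar> * \<bar>qf x\<bar> \<le> 1 * Q" using \<eta>(3)[of x] qf(2)[OF that] Q by (intro mult_mono) auto
      thus ?thesis by (simp add: abs_mult)
    qed
    hence "integrable M (\<lambda>x. \<eta> x * qf x * (T \<epsilon> x * w \<epsilon> x))"
      using \<eta>m qf(1) by (intro bd) auto
    moreover have "integrable M (\<lambda>x. (1 - \<eta> x) * qf x * (T \<epsilon> x * w \<epsilon> x))" by (intro bd g)
    ultimately show ?thesis by (subst Bochner_Integration.integral_add[symmetric]) (auto simp: split)
  qed
  have ev: "eventually (\<lambda>\<epsilon>. (\<integral>x. \<eta> x * qf x * (T \<epsilon> x * w \<epsilon> x) \<partial>M) + (\<integral>x. (1 - \<eta> x) * qf x * (T \<epsilon> x * w \<epsilon> x) \<partial>M)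
      = (\<integral>x. qf x * (T \<epsilon> x * w \<epsilon> x) \<partial>M)) (at_right 0)"
    by (rule at_right_0_I[of 1]) (use s2 in auto)
  have "(\<integral>x. \<eta> x * qf x * (Vr x * u x) \<partial>M) + (\<Sum>z\<in>S. \<alpha> z * qf z)
      + (\<integral>x. (1 - \<eta> x) * qf x * (Vr x * u x) \<partial>M) = (\<integral>x. qf x * (Vr x * u x) \<partial>M) + (\<Sum>z\<in>S. \<alpha> z * qf z)"
    using s1 by simp
  with tendsto_add[OF l1 l2] have "((\<lambda>\<epsilon>. (\<integral>x. \<eta> x * qf x * (T \<epsilon> x * w \<epsilon> x) \<partial>M) + (\<integral>x. (1 - \<eta> x) * qf x * (T \<epsilon> x * w \<epsilon> x) \<partial>M))
      \<longlongrightarrow> (\<integral>x. qf x * (Vr x * u x) \<partial>M) + (\<Sum>z\<in>S. \<alpha> z * qf z)) (at_right 0)" by simp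
  thus "((\<lambda>\<epsilon>. \<integral>x. qf x * (T \<epsilon> x * w \<epsilon> x) \<partial>M) \<longlongrightarrow>
        (\<integral>x. qf x * (Vr x * u x) \<partial>M) + (\<Sum>z\<in>S. \<alpha> z * qf z)) (at_right 0)"
    by (rule Lim_transform_eventually) (rule ev)
qed

lemma integrable_Vu: "integrable M (\<lambda>x. Vr x * u x)"
  using weak_limit(1)[of "\<lambda>_. 1" 1 1] by simp

lemma weak_limit_ball:
  assumes h: "continuous_on \<Omega> h" "h \<in> borel_measurable M" "\<And>x. x \<in> \<Omega> \<Longrightarrow> \<bar>h x\<bar> \<le> Q"
    and y: "y \<in> S" "0 < R" and sep: "\<And>z. z \<in> S \<Longrightarrow> z \<noteq> y \<Longrightarrow> 2 * R \<le> dist y z"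
  shows "((\<lambda>\<epsilon>. \<integral>x. indicator (ball y R) x * h x * (T \<epsilon> x * w \<epsilon> x) \<partial>M) \<longlongrightarrow>
        (\<integral>x. indicator (ball y R) x * h x * (Vr x * u x) \<partial>M) + \<alpha> y * h y) (at_right 0)"
proof -
  let ?q = "\<lambda>x. indicator (ball y R) x * h x"
  have Q: "0 \<le> Q" using h(3) nonempty_\<Omega> abs_ge_zero order_trans by blast
  have im: "(indicator (ball y R) :: real^'n \<Rightarrow> real) \<in> borel_measurable M"
    by (intro borel_measurable_lebesgue_onI borel_measurable_indicator) simp
  have "continuous_on (\<Union>z\<in>S. \<Omega> \<inter> ball z R) ?q"
  proof (rule continuous_on_open_UN)
    show "open (\<Omega> \<inter> ball z R)" for z using open_\<Omega> by auto
    fix z assume z: "z \<in> S"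
    show "continuous_on (\<Omega> \<inter> ball z R) ?q"
    proof (cases "z = y")
      case True
      show ?thesis
        by (rule continuous_on_eq[OF continuous_on_subset[OF h(1), of "\<Omega> \<inter> ball z R"]]) (use True in auto)
    next
      case False
      have "x \<notin> ball y R" if "x \<in> ball z R" for x
        using that sep[OF z False] dist_triangle[of y z x] by (auto simp: dist_commute)
      hence "\<And>x. x \<in> \<Omega> \<inter> ball z R \<Longrightarrow> 0 = ?q x" by auto
      with continuous_on_const[of "\<Omega> \<inter> ball z R" "0::real"] show ?thesis by (rule continuous_on_eq)
    qed
  qed
  moreover have "(\<Union>z\<in>S. \<Omega> \<inter> ball z R) = \<Omega> \<inter> (\<Union>z\<in>S. ball z R)" by blast
  ultimately have c: "continuous_on (\<Omega> \<inter> (\<Union>z\<in>S. ball z R)) ?q" by simp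
  have b: "\<bar>?q x\<bar> \<le> Q" if "x \<in> \<Omega>" for x using h(3)[OF that] Q by (auto simp: indicator_def)
  have m: "?q \<in> borel_measurable M" using h(2) im by (rule borel_measurable_times[rotated])
  have "(\<Sum>z\<in>S. \<alpha> z * ?q z) = (\<Sum>z\<in>{y}. \<alpha> z * ?q z)"
    by (rule sum.mono_neutral_right) (use S y sep in \<open>force simp: indicator_def\<close>)+
  also have "\<dots> = \<alpha> y * h y" using y by simp
  finally show ?thesis using weak_limit(2)[OF m b c y(2)] by simp
qed

text \<open>Where \<open>w \<epsilon>\<close> is negative, \<open>\<bar>w \<epsilon>\<bar> \<le> \<bar>u\<bar>\<close>. This substitute for positivity makes negative parts uniformly
  integrable, so that no negative mass can concentrate.\<close>

lemma red_ge:
  assumes "0 < \<epsilon>" shows "AE x in M. - \<bar>Vr x * u x\<bar> \<le> T \<epsilon> x * w \<epsilon> x"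
  using red_le[OF assms] V_finite
proof eventually_elim
  case (elim x)
  have "T \<epsilon> x * (- w \<epsilon> x) \<le> T \<epsilon> x * \<bar>u x\<bar>"
    using elim(1) T_nonneg[of \<epsilon> x] by (intro mult_left_mono) auto
  also have "\<dots> \<le> Vr x * \<bar>u x\<bar>" using T_le_V[OF elim(2)] by (rule mult_right_mono) simp
  finally show ?case by (simp add: abs_mult)
qed

lemma eventually_L1_bounded:
  obtains K where "0 \<le> K" "eventually (\<lambda>\<epsilon>. (\<integral>x. \<bar>T \<epsilon> x * w \<epsilon> x\<bar> \<partial>M) \<le> K) (at_right 0)"
proof -
  let ?L = "(\<integral>x. Vr x * u x \<partial>M) + (\<Sum>z\<in>S. \<alpha> z)" and ?N = "\<integral>x. \<bar>Vr x * u x\<bar> \<partial>M"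
  have "((\<lambda>\<epsilon>. \<integral>x. T \<epsilon> x * w \<epsilon> x \<partial>M) \<longlongrightarrow> ?L) (at_right 0)"
    using weak_limit(2)[of "\<lambda>_. 1" 1 1] by simp
  hence "eventually (\<lambda>\<epsilon>. (\<integral>x. T \<epsilon> x * w \<epsilon> x \<partial>M) < ?L + 1) (at_right 0)"
    by (rule order_tendstoD(2)) simp
  hence ev: "eventually (\<lambda>\<epsilon>. (\<integral>x. \<bar>T \<epsilon> x * w \<epsilon> x\<bar> \<partial>M) \<le> ?L + 1 + 2 * ?N) (at_right 0)"
    using eventually_at_right_less[of 0]
  proof eventually_elim
    case (elim \<epsilon>)
    have "AE x in M. \<bar>T \<epsilon> x * w \<epsilon> x\<bar> \<le> T \<epsilon> x * w \<epsilon> x + 2 * \<bar>Vr x * u x\<bar>"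
      using red_ge[OF elim(2)] by eventually_elim linarith
    hence "(\<integral>x. \<bar>T \<epsilon> x * w \<epsilon> x\<bar> \<partial>M) \<le> (\<integral>x. T \<epsilon> x * w \<epsilon> x + 2 * \<bar>Vr x * u x\<bar> \<partial>M)"
      using red_w(2)[OF elim(2)] integrable_Vu by (intro integral_mono_AE) auto
    also have "\<dots> = (\<integral>x. T \<epsilon> x * w \<epsilon> x \<partial>M) + 2 * ?N"
      using red_w(2)[OF elim(2)] integrable_Vu by simp
    finally show ?case using elim by simp
  qed
  show thesis
    by (rule that[of "max 0 (?L + 1 + 2 * ?N)"]) (use ev in \<open>auto elim: eventually_mono\<close>)
qed

text \<open>The difference \<open>D\<close> of the two sides is tested with its own sign, which gives \<open>\<integral> \<bar>D\<bar> = 0\<close>. By symmetry the Green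
  operator falls on the test function, whose potential is bounded and continuous.\<close>

lemma red_identity:
  "AE x in M. u x = green_meas G \<nu> x - \<G> (\<lambda>y. Vr y * u y) x - (\<Sum>z\<in>S. \<alpha> z * G x z)"
proof -
  let ?D = "\<lambda>x. u x - (green_meas G \<nu> x - \<G> (\<lambda>y. Vr y * u y) x - (\<Sum>z\<in>S. \<alpha> z * G x z))"
  have iz: "integrable M (\<lambda>x. G x z)" if "z \<in> S" for z
  proof -
    have "integrable M (\<lambda>x. G x z) = integrable M (\<lambda>x. G z x)"
      using that S G_sym by (intro Bochner_Integration.integrable_cong) auto
    thus ?thesis using integrable_G(1) that S by auto
  qed
  note im = integrable_green_meas[OF red_nonneg] and ig = integrable_green_fun[OF integrable_Vu]
  have isum: "integrable M (\<lambda>x. \<Sum>z\<in>S. \<alpha> z * G x z)" using iz by auto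
  have iD: "integrable M ?D" using red_integrable im ig isum by auto
  define \<psi> where "\<psi> x = sgn (?D x)" for x
  have \<psi>m: "\<psi> \<in> borel_measurable M" unfolding \<psi>_def using borel_measurable_integrable[OF iD] by measurable
  have \<psi>b: "\<bar>\<psi> x\<bar> \<le> 1" for x by (simp add: \<psi>_def sgn_if)
  have mi: "integrable M (\<lambda>x. \<psi> x * h x)" if "integrable M h" for h
    by (rule integrable_bounded_times[OF \<psi>m \<psi>b that])
  note gc = green_fun_continuous[OF \<psi>m \<psi>b] and gb = green_fun_bounded[OF _ \<psi>m \<psi>b]
  have "((\<lambda>\<epsilon>. \<integral>x. \<G> \<psi> x * (T \<epsilon> x * w \<epsilon> x) \<partial>M) \<longlongrightarrow>
      (\<integral>x. \<G> \<psi> x * (Vr x * u x) \<partial>M) + (\<Sum>z\<in>S. \<alpha> z * \<G> \<psi> z)) (at_right 0)"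
    by (rule weak_limit(2)[OF gc(2) gb continuous_on_subset[OF gc(1)], of 1]) auto
  also have "(\<integral>x. \<G> \<psi> x * (Vr x * u x) \<partial>M) = (\<integral>x. \<psi> x * \<G> (\<lambda>y. Vr y * u y) x \<partial>M)"
    using green_fun_pairing[OF integrable_Vu \<psi>m \<psi>b] by simp
  also have "(\<Sum>z\<in>S. \<alpha> z * \<G> \<psi> z) = (\<integral>x. \<psi> x * (\<Sum>z\<in>S. \<alpha> z * G x z) \<partial>M)"
  proof -
    have "(\<integral>x. \<psi> x * (\<Sum>z\<in>S. \<alpha> z * G x z) \<partial>M) = (\<integral>x. (\<Sum>z\<in>S. \<alpha> z * (\<psi> x * G x z)) \<partial>M)"
      by (simp add: sum_distrib_left ac_simps)
    also have "\<dots> = (\<Sum>z\<in>S. \<alpha> z * (\<integral>x. \<psi> x * G x z \<partial>M))"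
      using mi[OF iz] by (subst Bochner_Integration.integral_sum) auto
    also have "\<dots> = (\<Sum>z\<in>S. \<alpha> z * \<G> \<psi> z)"
      unfolding green_fun_def using S G_sym
      by (intro sum.cong refl arg_cong[of _ _ "(*) _"] Bochner_Integration.integral_cong) (auto simp: ac_simps)
    finally show ?thesis by simp
  qed
  finally have l1: "((\<lambda>\<epsilon>. (\<integral>x. \<psi> x * green_meas G \<nu> x \<partial>M) - (\<integral>x. \<G> \<psi> x * (T \<epsilon> x * w \<epsilon> x) \<partial>M)) \<longlongrightarrow>
      (\<integral>x. \<psi> x * green_meas G \<nu> x \<partial>M) - ((\<integral>x. \<psi> x * \<G> (\<lambda>y. Vr y * u y) x \<partial>M)
        + (\<integral>x. \<psi> x * (\<Sum>z\<in>S. \<alpha> z * G x z) \<partial>M))) (at_right 0)"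
    by (intro tendsto_diff tendsto_const)
  have ev: "eventually (\<lambda>\<epsilon>. (\<integral>x. \<psi> x * green_meas G \<nu> x \<partial>M) - (\<integral>x. \<G> \<psi> x * (T \<epsilon> x * w \<epsilon> x) \<partial>M)
      = (\<integral>x. \<psi> x * w \<epsilon> x \<partial>M)) (at_right 0)"
  proof (rule at_right_0_I[of 1])
    fix \<epsilon> :: real assume e: "0 < \<epsilon>"
    have "(\<integral>x. \<psi> x * w \<epsilon> x \<partial>M) = (\<integral>x. \<psi> x * green_meas G \<nu> x - \<psi> x * \<G> (\<lambda>y. T \<epsilon> y * w \<epsilon> y) x \<partial>M)"
    proof (rule integral_cong_AE)
      show "AE x in M. \<psi> x * w \<epsilon> x = \<psi> x * green_meas G \<nu> x - \<psi> x * \<G> (\<lambda>y. T \<epsilon> y * w \<epsilon> y) x"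
        using red_w(3)[OF e] by eventually_elim (subst (1) right_diff_distrib[symmetric], simp)
    qed (use mi[OF red_w(1)[OF e]] mi[OF im] mi[OF integrable_green_fun[OF red_w(2)[OF e]]] in \<open>auto intro: borel_measurable_integrable\<close>)
    also have "\<dots> = (\<integral>x. \<psi> x * green_meas G \<nu> x \<partial>M) - (\<integral>x. \<psi> x * \<G> (\<lambda>y. T \<epsilon> y * w \<epsilon> y) x \<partial>M)"
      by (rule Bochner_Integration.integral_diff[OF mi[OF im] mi[OF integrable_green_fun[OF red_w(2)[OF e]]]])
    also have "(\<integral>x. \<psi> x * \<G> (\<lambda>y. T \<epsilon> y * w \<epsilon> y) x \<partial>M) = (\<integral>x. \<G> \<psi> x * (T \<epsilon> x * w \<epsilon> x) \<partial>M)"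
      by (rule green_fun_pairing[OF red_w(2)[OF e] \<psi>m \<psi>b])
    finally show "(\<integral>x. \<psi> x * green_meas G \<nu> x \<partial>M) - (\<integral>x. \<G> \<psi> x * (T \<epsilon> x * w \<epsilon> x) \<partial>M)
      = (\<integral>x. \<psi> x * w \<epsilon> x \<partial>M)" by simp
  qed simp
  have l2: "((\<lambda>\<epsilon>. \<integral>x. \<psi> x * w \<epsilon> x \<partial>M) \<longlongrightarrow> (\<integral>x. \<psi> x * u x \<partial>M)) (at_right 0)"
  proof (rule LIM_zero_cancel, rule Lim_null_comparison[OF _ red_lim], rule at_right_0_I[of 1])
    fix \<epsilon> :: real assume e: "0 < \<epsilon>"
    have i: "integrable M (\<lambda>x. w \<epsilon> x - u x)" using red_w(1)[OF e] red_integrable by auto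
    have "(\<integral>x. \<psi> x * w \<epsilon> x \<partial>M) - (\<integral>x. \<psi> x * u x \<partial>M) = (\<integral>x. \<psi> x * (w \<epsilon> x - u x) \<partial>M)"
      using mi[OF red_w(1)[OF e]] mi[OF red_integrable] by (simp add: right_diff_distrib)
    moreover have "\<bar>\<integral>x. \<psi> x * (w \<epsilon> x - u x) \<partial>M\<bar> \<le> (\<integral>x. \<bar>\<psi> x * (w \<epsilon> x - u x)\<bar> \<partial>M)"
      by (rule integral_abs_bound)
    moreover have "(\<integral>x. \<bar>\<psi> x * (w \<epsilon> x - u x)\<bar> \<partial>M) \<le> (\<integral>x. \<bar>w \<epsilon> x - u x\<bar> \<partial>M)"
      by (rule integral_mono[OF integrable_abs[OF mi[OF i]] integrable_abs[OF i]])
        (use \<psi>b in \<open>auto simp: abs_mult mult_left_le_one_le\<close>)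
    ultimately show "norm ((\<integral>x. \<psi> x * w \<epsilon> x \<partial>M) - (\<integral>x. \<psi> x * u x \<partial>M)) \<le> (\<integral>x. \<bar>w \<epsilon> x - u x\<bar> \<partial>M)"
      unfolding real_norm_def by linarith
  qed simp
  have "(\<integral>x. \<psi> x * u x \<partial>M) = (\<integral>x. \<psi> x * green_meas G \<nu> x \<partial>M) - ((\<integral>x. \<psi> x * \<G> (\<lambda>y. Vr y * u y) x \<partial>M)
        + (\<integral>x. \<psi> x * (\<Sum>z\<in>S. \<alpha> z * G x z) \<partial>M))"
    by (rule tendsto_unique[OF _ l2 Lim_transform_eventually[OF l1 ev]]) simp
  moreover have "(\<integral>x. \<psi> x * ?D x \<partial>M) = (\<integral>x. \<psi> x * u x \<partial>M) - ((\<integral>x. \<psi> x * green_meas G \<nu> x \<partial>M)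
      - (\<integral>x. \<psi> x * \<G> (\<lambda>y. Vr y * u y) x \<partial>M) - (\<integral>x. \<psi> x * (\<Sum>z\<in>S. \<alpha> z * G x z) \<partial>M))"
    using mi[OF red_integrable] mi[OF im] mi[OF ig] mi[OF isum]
    by (simp add: right_diff_distrib)
  ultimately have "(\<integral>x. \<psi> x * ?D x \<partial>M) = 0" by simp
  moreover have "\<psi> x * ?D x = \<bar>?D x\<bar>" for x by (simp add: \<psi>_def sgn_mult_self_eq abs_sgn mult.commute)
  ultimately have "(\<integral>x. \<bar>?D x\<bar> \<partial>M) = 0" by simp
  hence "AE x in M. \<bar>?D x\<bar> = 0"
    using iD by (subst (asm) integral_nonneg_eq_0_iff_AE) auto
  thus ?thesis by eventually_elim simp
qed

end

end

section \<open>Potentials of small balls; sign and linearity of the coefficients\<close>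

context green_setting
begin

text \<open>The inequality \<open>E(f - t h) \<ge> 0\<close> for the energy form. Keeping \<open>t\<close> free is more convenient than the
  Cauchy-Schwarz inequality, because \<open>t\<close> can be chosen depending on the radius alone.\<close>

lemma psd_cross:
  assumes f: "f \<in> borel_measurable M" "\<And>x. x \<in> \<Omega> \<Longrightarrow> \<bar>f x\<bar> \<le> Qf"
    and h: "h \<in> borel_measurable M" "\<And>x. x \<in> \<Omega> \<Longrightarrow> \<bar>h x\<bar> \<le> Qh"
  shows "2 * t * (\<integral>x. h x * \<G> f x \<partial>M)
    \<le> (\<integral>x. f x * \<G> f x \<partial>M) + t\<^sup>2 * (\<integral>x. h x * \<G> h x \<partial>M)"
proof -
  let ?\<phi> = "\<lambda>x. f x - t * h x" and ?g = "\<G>"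
  have i1: "integrable M (\<lambda>x. 1::real)" by simp
  have int: "integrable M g" if "g \<in> borel_measurable M" "\<And>x. x \<in> \<Omega> \<Longrightarrow> \<bar>g x\<bar> \<le> Q" for g :: "real^'n \<Rightarrow> real" and Q
    using integrable_bounded_times[OF that i1] by simp
  note i_f = int[OF f] and ih = int[OF h]
  note igf = integrable_green_fun[OF i_f] and igh = integrable_green_fun[OF ih]
  note p = integrable_bounded_times[OF f igf] integrable_bounded_times[OF f igh]
    integrable_bounded_times[OF h igf] integrable_bounded_times[OF h igh]
  have \<phi>m: "?\<phi> \<in> borel_measurable M" using f(1) h(1) by simp
  have \<phi>b: "\<bar>?\<phi> x\<bar> \<le> Qf + \<bar>t\<bar> * Qh" if "x \<in> \<Omega>" for x
  proof -
    have "\<bar>t * h x\<bar> \<le> \<bar>t\<bar> * Qh" using h(2)[OF that] by (simp add: abs_mult mult_left_mono)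
    thus ?thesis using f(2)[OF that] by linarith
  qed
  have "integrable M (\<lambda>x. (?\<phi> x)\<^sup>2)"
    using integrable_bounded_times[OF \<phi>m \<phi>b int[OF \<phi>m \<phi>b]] by (simp add: power2_eq_square)
  from G_psd[OF \<phi>m this] have "0 \<le> (\<integral>x. ?\<phi> x * ?g ?\<phi> x \<partial>M)" .
  also have "\<dots> = (\<integral>x. f x * ?g f x - t * (f x * ?g h x) - t * (h x * ?g f x) + t\<^sup>2 * (h x * ?g h x) \<partial>M)"
  proof (rule Bochner_Integration.integral_cong[OF refl])
    fix x assume "x \<in> space M"
    hence x: "x \<in> \<Omega>" by simp
    have "?g ?\<phi> x = (\<integral>y. G x y * f y - t * (G x y * h y) \<partial>M)"
      unfolding green_fun_def by (simp add: algebra_simps)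
    also have "\<dots> = ?g f x - t * ?g h x"
      using integrable_G_bounded[OF x f] integrable_G_bounded[OF x h] by (simp add: green_fun_def)
    finally have eq: "?g ?\<phi> x = ?g f x - t * ?g h x" .
    show "?\<phi> x * ?g ?\<phi> x = f x * ?g f x - t * (f x * ?g h x) - t * (h x * ?g f x) + t\<^sup>2 * (h x * ?g h x)"
      unfolding eq by (simp add: algebra_simps power2_eq_square)
  qed
  also have "\<dots> = (\<integral>x. f x * ?g f x \<partial>M) - t * (\<integral>x. f x * ?g h x \<partial>M)
      - t * (\<integral>x. h x * ?g f x \<partial>M) + t\<^sup>2 * (\<integral>x. h x * ?g h x \<partial>M)"
    using p by simp
  also have "(\<integral>x. f x * ?g h x \<partial>M) = (\<integral>x. h x * ?g f x \<partial>M)"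
    using green_fun_pairing[OF ih f] by (simp add: mult.commute)
  finally show ?thesis by simp
qed

lemma indicator_ball_measurable: "(indicator (ball y r) :: real^'n \<Rightarrow> real) \<in> borel_measurable M"
  by (intro borel_measurable_lebesgue_onI borel_measurable_indicator) simp

lemma ball_potential_nonneg: "x \<in> \<Omega> \<Longrightarrow> 0 \<le> \<G> (indicator (ball y r)) x"
  unfolding green_fun_def using G_nonneg by (intro Bochner_Integration.integral_nonneg) auto

lemma ennreal_ball_potential:
  assumes x: "x \<in> \<Omega>"
  shows "ennreal (\<G> (indicator (ball y r)) x) = (\<integral>\<^sup>+z. ennreal (G x z) * indicator (ball y r) z \<partial>M)"
proof -
  have "integrable M (\<lambda>z. G x z * indicator (ball y r) z)"
    by (rule integrable_G_bounded[OF x indicator_ball_measurable, of _ _ 1]) (simp add: indicator_def)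
  hence "ennreal (\<G> (indicator (ball y r)) x) = (\<integral>\<^sup>+z. ennreal (G x z * indicator (ball y r) z) \<partial>M)"
    unfolding green_fun_def using x G_nonneg
    by (intro nn_integral_eq_integral[symmetric] AE_I2) auto
  also have "\<dots> = (\<integral>\<^sup>+z. ennreal (G x z) * indicator (ball y r) z \<partial>M)"
    by (intro nn_integral_cong) (auto simp: indicator_def)
  finally show ?thesis .
qed

lemma nn_integral_M_le_lborel:
  assumes "h \<in> borel_measurable borel"
  shows "(\<integral>\<^sup>+z. h z \<partial>M) \<le> (\<integral>\<^sup>+z. h z \<partial>lborel)"
proof -
  have "(\<integral>\<^sup>+z. h z \<partial>M) = (\<integral>\<^sup>+z. h z * indicator \<Omega> z \<partial>lebesgue)"
    using \<Omega>_sets by (simp add: nn_integral_restrict_space)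
  also have "\<dots> \<le> (\<integral>\<^sup>+z. h z \<partial>lebesgue)" by (intro nn_integral_mono) (auto simp: indicator_def)
  also have "\<dots> = (\<integral>\<^sup>+z. h z \<partial>lborel)" using assms by (intro nn_integral_completion)
  finally show ?thesis .
qed

lemma emeasure_M_ball: 
  assumes "0 < r"
  shows "emeasure M (\<Omega> \<inter> ball y r) \<le> ennreal (unit_ball_vol CARD('n) * r ^ CARD('n))"
    "ball y r \<subseteq> \<Omega> \<Longrightarrow> emeasure M (ball y r) = ennreal (unit_ball_vol CARD('n) * r ^ CARD('n))"
proof -
  have 1: "emeasure lebesgue (ball y r) = ennreal (unit_ball_vol CARD('n) * r ^ CARD('n))"
    using emeasure_ball[OF less_imp_le[OF assms], of y] by simp
  have "emeasure M (\<Omega> \<inter> ball y r) = emeasure lebesgue (\<Omega> \<inter> ball y r)"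
    using \<Omega>_sets by (intro emeasure_restrict_space) auto
  also have "\<dots> \<le> emeasure lebesgue (ball y r)" by (intro emeasure_mono) auto
  finally show "emeasure M (\<Omega> \<inter> ball y r) \<le> ennreal (unit_ball_vol CARD('n) * r ^ CARD('n))" unfolding 1 .
  assume "ball y r \<subseteq> \<Omega>"
  hence "emeasure M (ball y r) = emeasure lebesgue (ball y r)"
    using \<Omega>_sets by (intro emeasure_restrict_space) auto
  thus "emeasure M (ball y r) = ennreal (unit_ball_vol CARD('n) * r ^ CARD('n))" unfolding 1 .
qed

lemma ball_potential_upper:
  obtains D where "0 \<le> D" "\<And>x y r. x \<in> \<Omega> \<Longrightarrow> 0 < r \<Longrightarrow> \<G> (indicator (ball y r)) x \<le> D * r powr (2 * s)"
proof -
  obtain D where D: "0 \<le> D" "\<And>(x::real^'n) y r. 0 < r \<Longrightarrow>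
    (\<integral>\<^sup>+z. riesz q x z * indicator (ball y r) z \<partial>lborel) \<le> ennreal (D * r powr (real DIM(real^'n) - q))"
    by (rule riesz_integral_ball[OF q(4) q(3)]) (rule that)
  show thesis
  proof (rule that[of "C * D"])
    show "0 \<le> C * D" using C D by simp
    fix x y :: "real^'n" and r :: real assume x: "x \<in> \<Omega>" and r: "0 < r"
    have m: "(\<lambda>z. riesz q x z * indicator (ball y r) z) \<in> borel_measurable borel"
      by (intro borel_measurable_times_ennreal borel_measurable_indicator riesz_measurable) simp_all
    have "ennreal (\<G> (indicator (ball y r)) x) \<le> (\<integral>\<^sup>+z. ennreal C * (riesz q x z * indicator (ball y r) z) \<partial>M)"
      unfolding ennreal_ball_potential[OF x]
    proof (rule nn_integral_mono_AE)
      show "AE z in M. ennreal (G x z) * indicator (ball y r) z \<le> ennreal C * (riesz q x z * indicator (ball y r) z)"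
        using AE_neq_point[OF \<Omega>_sets(2), of x] AE_space[of M]
        by eventually_elim (use x G_le_riesz in \<open>auto simp: indicator_def\<close>)
    qed
    also have "\<dots> = ennreal C * (\<integral>\<^sup>+z. riesz q x z * indicator (ball y r) z \<partial>M)"
      by (intro nn_integral_cmult borel_measurable_lebesgue_onI m)
    also have "\<dots> \<le> ennreal C * (\<integral>\<^sup>+z. riesz q x z * indicator (ball y r) z \<partial>lborel)"
      by (intro mult_left_mono nn_integral_M_le_lborel m) simp
    also have "\<dots> \<le> ennreal C * ennreal (D * r powr (real DIM(real^'n) - q))"
      by (intro mult_left_mono D r) simp
    also have "\<dots> = ennreal (C * D * r powr (2 * s))"
      using C D by (simp add: q_def mult.assoc flip: ennreal_mult)
    finally show "\<G> (indicator (ball y r)) x \<le> C * D * r powr (2 * s)"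
      using C D by (subst (asm) ennreal_le_iff) auto
  qed
qed

lemma ball_potential_far:
  assumes x: "x \<in> \<Omega>" and r: "0 < r" "2 * r \<le> dist x y"
  shows "\<G> (indicator (ball y r)) x \<le> C * (dist x y / 2) powr - q * (unit_ball_vol CARD('n) * r ^ CARD('n))"
proof -
  let ?c = "C * (dist x y / 2) powr - q"
  have c0: "0 \<le> ?c" using C by simp
  have "ennreal (\<G> (indicator (ball y r)) x) \<le> (\<integral>\<^sup>+z. ennreal ?c * indicator (\<Omega> \<inter> ball y r) z \<partial>M)"
    unfolding ennreal_ball_potential[OF x]
  proof (rule nn_integral_mono)
    fix z assume z: "z \<in> space M"
    have "G x z \<le> ?c" if "z \<in> ball y r"
    proof (rule G_far[OF x])
      show "z \<in> \<Omega>" "0 < dist x y / 2" using z r by auto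
      show "dist x y / 2 \<le> dist x z" using that r dist_triangle[of x y z] by (simp add: dist_commute)
    qed
    thus "ennreal (G x z) * indicator (ball y r) z \<le> ennreal ?c * indicator (\<Omega> \<inter> ball y r) z"
      using z by (auto simp: indicator_def intro: ennreal_leI)
  qed
  also have "\<dots> = ennreal ?c * emeasure M (\<Omega> \<inter> ball y r)"
    using \<Omega>_sets by (intro nn_integral_cmult_indicator) (auto simp: sets_restrict_space)
  also have "\<dots> \<le> ennreal ?c * ennreal (unit_ball_vol CARD('n) * r ^ CARD('n))"
    by (intro mult_left_mono emeasure_M_ball r) simp
  also have "\<dots> = ennreal (?c * (unit_ball_vol CARD('n) * r ^ CARD('n)))"
    using c0 r by (intro ennreal_mult[symmetric]) auto
  finally show ?thesis using c0 r by (subst (asm) ennreal_le_iff) auto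
qed

text \<open>Close to an interior point \<open>y\<close> the boundary factor of the model kernel is exactly \<open>1\<close>, so the kernel is
  at least \<open>c r\<^sup>2\<^sup>s\<^sup>-\<^sup>n\<close> on the whole ball.\<close>

lemma ball_potential_lower:
  assumes y: "y \<in> \<Omega>"
  obtains r0 where "0 < r0"
    "\<And>r. 0 < r \<Longrightarrow> r \<le> r0 \<Longrightarrow> c * unit_ball_vol CARD('n) * r powr (2 * s) \<le> \<G> (indicator (ball y r)) y"
proof -
  obtain r1 where r1: "0 < r1" "ball y r1 \<subseteq> \<Omega>" using open_\<Omega> y open_contains_ball by blast
  let ?d = "bdist \<Omega> y"
  have d: "0 < ?d" by (rule bdist_pos[OF y])
  show thesis
  proof (rule that[of "min r1 (?d / 2)"])
    show "0 < min r1 (?d / 2)" using r1 d by simp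
    fix r assume r: "0 < r" "r \<le> min r1 (?d / 2)"
    have sub: "ball y r \<subseteq> \<Omega>" using r1 r by auto
    have cr: "0 \<le> c * r powr - q" using c by simp
    have lower: "c * r powr - q \<le> G y z" if z: "z \<in> ball y r" "z \<noteq> y" for z
    proof -
      have z\<Omega>: "z \<in> \<Omega>" using z sub by auto
      have nz: "norm (y - z) < r" "0 < norm (y - z)" using z by (auto simp: dist_norm)
      have "?d \<le> bdist \<Omega> z + dist y z" by (rule infdist_triangle)
      hence dz: "?d / 2 \<le> bdist \<Omega> z" using z r by auto
      have "(norm (y - z))\<^sup>2 \<le> (?d / 2)\<^sup>2" using nz r by (intro power_mono) auto
      also have "\<dots> \<le> ?d * (?d / 2)" using d by (simp add: power2_eq_square)
      also have "\<dots> \<le> ?d * bdist \<Omega> z" using d dz by (intro mult_left_mono) auto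
      finally have "1 \<le> ?d * bdist \<Omega> z / (norm (y - z))\<^sup>2" using nz by (simp add: field_simps)
      hence eq: "model_kernel \<Omega> s \<gamma> y z = norm (y - z) powr - q"
        unfolding model_kernel_eq by (simp add: min_def)
      have "r powr - q \<le> norm (y - z) powr - q" using nz q by (intro powr_mono2') auto
      hence "c * r powr - q \<le> c * model_kernel \<Omega> s \<gamma> y z" unfolding eq using c by simp
      also have "\<dots> \<le> G y z" using z by (intro G_lower y z\<Omega>) auto
      finally show ?thesis .
    qed
    have "ennreal (c * r powr - q) * ennreal (unit_ball_vol CARD('n) * r ^ CARD('n)) = ennreal (c * r powr - q) * emeasure M (ball y r)"
      using emeasure_M_ball(2)[OF r(1) sub] by simp
    also have "\<dots> = (\<integral>\<^sup>+z. ennreal (c * r powr - q) * indicator (ball y r) z \<partial>M)"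
    proof (rule nn_integral_cmult_indicator[symmetric])
      show "ball y r \<in> sets M" using sub by (auto simp: sets_restrict_space intro!: image_eqI[of _ _ "ball y r"])
    qed
    also have "\<dots> \<le> (\<integral>\<^sup>+z. ennreal (G y z) * indicator (ball y r) z \<partial>M)"
    proof (rule nn_integral_mono_AE)
      show "AE z in M. ennreal (c * r powr - q) * indicator (ball y r) z \<le> ennreal (G y z) * indicator (ball y r) z"
        using AE_neq_point[OF \<Omega>_sets(2), of y]
        by eventually_elim (use lower in \<open>auto simp: indicator_def intro: ennreal_leI\<close>)
    qed
    also have "\<dots> = ennreal (\<G> (indicator (ball y r)) y)"
      by (rule ennreal_ball_potential[OF y, symmetric])
    finally have "ennreal (c * r powr - q * (unit_ball_vol CARD('n) * r ^ CARD('n)))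
        \<le> ennreal (\<G> (indicator (ball y r)) y)"
      using cr r by (simp add: ennreal_mult)
    hence "c * r powr - q * (unit_ball_vol CARD('n) * r ^ CARD('n)) \<le> \<G> (indicator (ball y r)) y"
      using ball_potential_nonneg[OF y] by (subst (asm) ennreal_le_iff) auto
    moreover have "r powr - q * r ^ CARD('n) = r powr (2 * s)"
      using r by (simp add: q_def powr_realpow[symmetric] powr_add[symmetric])
    ultimately show "c * unit_ball_vol CARD('n) * r powr (2 * s) \<le> \<G> (indicator (ball y r)) y"
      by (simp add: mult.assoc mult.left_commute)
  qed
qed

lemma ball_energy_le:
  assumes D: "\<And>x. x \<in> \<Omega> \<Longrightarrow> \<G> (indicator (ball y r)) x \<le> d" "0 \<le> d" and r: "0 < r"
  shows "(\<integral>x. indicator (ball y r) x * \<G> (indicator (ball y r)) x \<partial>M)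
    \<le> d * (unit_ball_vol CARD('n) * r ^ CARD('n))"
proof -
  let ?h = "indicator (ball y r) :: real^'n \<Rightarrow> real"
  have b: "\<bar>?h x\<bar> \<le> 1" for x by (simp add: indicator_def)
  have one: "integrable M (\<lambda>x. 1 :: real)" by simp
  have ih: "integrable M ?h"
    using integrable_bounded_times[OF indicator_ball_measurable b one] by simp
  have "(\<integral>x. ?h x * \<G> ?h x \<partial>M) \<le> (\<integral>x. d * ?h x \<partial>M)"
  proof (rule integral_mono)
    show "integrable M (\<lambda>x. ?h x * \<G> ?h x)"
      by (rule integrable_bounded_times[OF indicator_ball_measurable b integrable_green_fun[OF ih]])
    show "integrable M (\<lambda>x. d * ?h x)" using ih by simp
    show "?h x * \<G> ?h x \<le> d * ?h x" if "x \<in> space M" for x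
      using D(1)[of x] that by (auto simp: indicator_def)
  qed
  also have "\<dots> = d * (\<integral>x. ?h x \<partial>M)" by simp
  also have "(\<integral>x. ?h x \<partial>M) = measure M (\<Omega> \<inter> ball y r)"
    by (simp add: Int_commute)
  also have "measure M (\<Omega> \<inter> ball y r) \<le> unit_ball_vol CARD('n) * r ^ CARD('n)"
  proof -
    have "ennreal (measure M (\<Omega> \<inter> ball y r)) \<le> ennreal (unit_ball_vol CARD('n) * r ^ CARD('n))"
      using emeasure_M_ball(1)[OF r, of y] by (simp add: M.emeasure_eq_measure)
    thus ?thesis using r by (subst (asm) ennreal_le_iff) auto
  qed
  finally show ?thesis using D(2) by (simp add: mult_left_mono)
qed

lemma shrinking_integral:
  assumes f: "integrable M (f :: real^'n \<Rightarrow> real)"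
  shows "(\<lambda>k. \<integral>x. indicator (ball y (R / real (Suc k))) x * f x \<partial>M) \<longlonglongrightarrow> 0"
proof -
  have "(\<lambda>k. \<integral>x. indicator (ball y (R / real (Suc k))) x * f x \<partial>M) \<longlonglongrightarrow> (\<integral>x. 0 \<partial>M)"
  proof (rule integral_dominated_convergence[where w = "\<lambda>x. \<bar>f x\<bar>"])
    show "AE x in M. (\<lambda>k. indicator (ball y (R / real (Suc k))) x * f x) \<longlonglongrightarrow> 0"
      using AE_neq_point[OF \<Omega>_sets(2), of y]
    proof eventually_elim
      case (elim x)
      have "(\<lambda>k. R / real (Suc k)) \<longlonglongrightarrow> 0"
        by (rule LIMSEQ_Suc[OF lim_const_over_n])
      hence "eventually (\<lambda>k. R / real (Suc k) < dist y x) sequentially"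
        using elim by (intro order_tendstoD(2)) auto
      hence "eventually (\<lambda>k. indicator (ball y (R / real (Suc k))) x * f x = 0) sequentially"
        by eventually_elim (auto simp: indicator_def)
      thus ?case by (rule tendsto_eventually)
    qed
    show "AE x in M. norm (indicator (ball y (R / real (Suc k))) x * f x) \<le> \<bar>f x\<bar>" for k
      by (intro AE_I2) (auto simp: indicator_def)
    show "(\<lambda>x. indicator (ball y (R / real (Suc k))) x * f x) \<in> borel_measurable M" for k
      using indicator_ball_measurable borel_measurable_integrable[OF f] by (rule borel_measurable_times)
  qed (use f in auto)
  thus ?thesis by simp
qed

end

context reduction_setting
begin

lemma isolating_radius:
  assumes y: "y \<in> S"
  obtains R where "0 < R" "ball y R \<subseteq> \<Omega>" "\<And>z. z \<in> S \<Longrightarrow> z \<noteq> y \<Longrightarrow> 2 * R \<le> dist y z"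
proof -
  obtain r1 where r1: "0 < r1" "ball y r1 \<subseteq> \<Omega>" using open_\<Omega> y S open_contains_ball by blast
  obtain d where d: "0 < d" "\<forall>z\<in>S. z \<noteq> y \<longrightarrow> d \<le> dist y z"
    using finite_set_avoid[OF S(1), of y] by auto
  show thesis
    by (rule that[of "min r1 (d / 2)"]) (use r1 d in auto)
qed

lemma const_one: "continuous_on \<Omega> (\<lambda>x. 1 :: real)" "(\<lambda>x. 1 :: real) \<in> borel_measurable M" "\<bar>1 :: real\<bar> \<le> 1"
  by auto

text \<open>On a small ball about \<open>y\<close> the mass of \<open>T \<epsilon> * w \<epsilon>\<close> is at least \<open>- \<integral> \<bar>V u\<bar>\<close> over that ball. In the limit \<open>\<epsilon> \<rightarrow> 0\<close>
  this bounds \<open>\<alpha> y\<close> below by minus twice such an integral, which vanishes as the ball shrinks.\<close>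

lemma coefficient_nonneg:
  assumes red: "reduces \<nu> w u \<alpha>" and y: "y \<in> S"
  shows "0 \<le> \<alpha> y"
proof -
  obtain R where R: "0 < R" "ball y R \<subseteq> \<Omega>" "\<And>z. z \<in> S \<Longrightarrow> z \<noteq> y \<Longrightarrow> 2 * R \<le> dist y z"
    by (rule isolating_radius[OF y]) (rule that)
  note iV = integrable_Vu[OF red]
  let ?i = "\<lambda>k. indicator (ball y (R / real (Suc k))) :: real^'n \<Rightarrow> real"
  have ib: "integrable M (\<lambda>x. ?i k x * f x)" if "integrable M f" for f k
    by (rule integrable_bounded_times[where Q = 1, OF indicator_ball_measurable _ that]) (simp add: indicator_def)
  have le: "- (\<integral>x. ?i k x * \<bar>Vr x * u x\<bar> \<partial>M) - (\<integral>x. ?i k x * (Vr x * u x) \<partial>M) \<le> \<alpha> y" for k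
  proof -
    have Rk: "0 < R / real (Suc k)" "R / real (Suc k) \<le> R" using R(1) by (auto simp: field_simps)
    have "((\<lambda>\<epsilon>. \<integral>x. ?i k x * 1 * (T \<epsilon> x * w \<epsilon> x) \<partial>M) \<longlongrightarrow>
        (\<integral>x. ?i k x * 1 * (Vr x * u x) \<partial>M) + \<alpha> y * 1) (at_right 0)"
    proof (rule weak_limit_ball[OF red const_one y Rk(1)])
      fix z assume "z \<in> S" "z \<noteq> y"
      thus "2 * (R / real (Suc k)) \<le> dist y z" using R(3)[of z] Rk by linarith
    qed
    moreover have "eventually (\<lambda>\<epsilon>. - (\<integral>x. ?i k x * \<bar>Vr x * u x\<bar> \<partial>M) \<le> (\<integral>x. ?i k x * 1 * (T \<epsilon> x * w \<epsilon> x) \<partial>M)) (at_right 0)"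
    proof (rule at_right_0_I[of 1])
      fix \<epsilon> :: real assume e: "0 < \<epsilon>"
      have "(\<integral>x. - (?i k x * \<bar>Vr x * u x\<bar>) \<partial>M) \<le> (\<integral>x. ?i k x * (T \<epsilon> x * w \<epsilon> x) \<partial>M)"
      proof (rule integral_mono_AE)
        show "integrable M (\<lambda>x. - (?i k x * \<bar>Vr x * u x\<bar>))" using ib[OF integrable_abs[OF iV]] by simp
        show "integrable M (\<lambda>x. ?i k x * (T \<epsilon> x * w \<epsilon> x))" by (rule ib[OF red_w(2)[OF red e]])
        show "AE x in M. - (?i k x * \<bar>Vr x * u x\<bar>) \<le> ?i k x * (T \<epsilon> x * w \<epsilon> x)"
          using red_ge[OF red e] by eventually_elim (auto simp: indicator_def)
      qed
      thus "- (\<integral>x. ?i k x * \<bar>Vr x * u x\<bar> \<partial>M) \<le> (\<integral>x. ?i k x * 1 * (T \<epsilon> x * w \<epsilon> x) \<partial>M)" by simp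
    qed simp
    ultimately have "- (\<integral>x. ?i k x * \<bar>Vr x * u x\<bar> \<partial>M) \<le> (\<integral>x. ?i k x * 1 * (Vr x * u x) \<partial>M) + \<alpha> y * 1"
      by (rule tendsto_lowerbound) simp
    thus ?thesis by simp
  qed
  have "(\<lambda>k. - (\<integral>x. ?i k x * \<bar>Vr x * u x\<bar> \<partial>M) - (\<integral>x. ?i k x * (Vr x * u x) \<partial>M)) \<longlonglongrightarrow> - 0 - 0"
    by (intro tendsto_diff tendsto_minus shrinking_integral iV integrable_abs)
  hence "- 0 - 0 \<le> \<alpha> y"
    by (rule LIMSEQ_le_const2) (intro exI[of _ 0] allI impI le)
  thus ?thesis by simp
qed

lemma
  assumes r1: "reduces \<nu>1 w1 u1 \<alpha>1" and r2: "reduces \<nu>2 w2 u2 \<alpha>2" and r3: "reduces \<nu>3 w3 u3 \<alpha>3"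
    and lin: "AE x in M. green_meas G \<nu>3 x = a * green_meas G \<nu>1 x + b * green_meas G \<nu>2 x"
  shows family_linear: "0 < \<epsilon> \<Longrightarrow> AE x in M. w3 \<epsilon> x = a * w1 \<epsilon> x + b * w2 \<epsilon> x"
    and limit_linear: "AE x in M. u3 x = a * u1 x + b * u2 x"
    and coefficient_linear: "y \<in> S \<Longrightarrow> \<alpha>3 y = a * \<alpha>1 y + b * \<alpha>2 y"
proof -
  show w: "AE x in M. w3 \<epsilon> x = a * w1 \<epsilon> x + b * w2 \<epsilon> x" if e: "0 < \<epsilon>" for \<epsilon>
    by (rule sol_unique[OF T_measurable T_nonneg T_le[OF e] red_sol[OF r3 e]
          sol_add[OF red_sol[OF r1 e] red_sol[OF r2 e]] lin])
  note i = red_integrable[OF r1] red_integrable[OF r2] red_integrable[OF r3]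
  let ?d = "\<lambda>x. \<bar>u3 x - (a * u1 x + b * u2 x)\<bar>"
  have "eventually (\<lambda>\<epsilon>. (\<integral>x. ?d x \<partial>M) \<le> (\<integral>x. \<bar>w3 \<epsilon> x - u3 x\<bar> \<partial>M) + \<bar>a\<bar> * (\<integral>x. \<bar>w1 \<epsilon> x - u1 x\<bar> \<partial>M)
      + \<bar>b\<bar> * (\<integral>x. \<bar>w2 \<epsilon> x - u2 x\<bar> \<partial>M)) (at_right 0)"
  proof (rule at_right_0_I[of 1])
    fix \<epsilon> :: real assume e: "0 < \<epsilon>"
    note iw = red_w(1)[OF r1 e] red_w(1)[OF r2 e] red_w(1)[OF r3 e]
    have "(\<integral>x. ?d x \<partial>M) \<le> (\<integral>x. \<bar>w3 \<epsilon> x - u3 x\<bar> + \<bar>a\<bar> * \<bar>w1 \<epsilon> x - u1 x\<bar> + \<bar>b\<bar> * \<bar>w2 \<epsilon> x - u2 x\<bar> \<partial>M)"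
    proof (rule integral_mono_AE)
      show "AE x in M. ?d x \<le> \<bar>w3 \<epsilon> x - u3 x\<bar> + \<bar>a\<bar> * \<bar>w1 \<epsilon> x - u1 x\<bar> + \<bar>b\<bar> * \<bar>w2 \<epsilon> x - u2 x\<bar>"
        using w[OF e]
      proof eventually_elim
        case (elim x)
        have "u3 x - (a * u1 x + b * u2 x) = - (w3 \<epsilon> x - u3 x) + a * (w1 \<epsilon> x - u1 x) + b * (w2 \<epsilon> x - u2 x)"
          unfolding elim by (simp add: algebra_simps)
        thus ?case
          using abs_mult[of a "w1 \<epsilon> x - u1 x"] abs_mult[of b "w2 \<epsilon> x - u2 x"] by linarith
      qed
    qed (use i iw in auto)
    also have "\<dots> = (\<integral>x. \<bar>w3 \<epsilon> x - u3 x\<bar> \<partial>M) + \<bar>a\<bar> * (\<integral>x. \<bar>w1 \<epsilon> x - u1 x\<bar> \<partial>M)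
      + \<bar>b\<bar> * (\<integral>x. \<bar>w2 \<epsilon> x - u2 x\<bar> \<partial>M)" using i iw by simp
    finally show "(\<integral>x. ?d x \<partial>M) \<le> \<dots>" .
  qed simp
  moreover have "((\<lambda>\<epsilon>. (\<integral>x. \<bar>w3 \<epsilon> x - u3 x\<bar> \<partial>M) + \<bar>a\<bar> * (\<integral>x. \<bar>w1 \<epsilon> x - u1 x\<bar> \<partial>M)
      + \<bar>b\<bar> * (\<integral>x. \<bar>w2 \<epsilon> x - u2 x\<bar> \<partial>M)) \<longlongrightarrow> 0 + \<bar>a\<bar> * 0 + \<bar>b\<bar> * 0) (at_right 0)"
    by (intro tendsto_add tendsto_mult tendsto_const red_lim[OF r1] red_lim[OF r2] red_lim[OF r3])
  ultimately have "(\<integral>x. ?d x \<partial>M) \<le> 0"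
    using tendsto_lowerbound[of _ "0 + \<bar>a\<bar> * 0 + \<bar>b\<bar> * 0" "at_right (0::real)" "\<integral>x. ?d x \<partial>M"] by simp
  moreover have id: "integrable M ?d" using i by auto
  moreover have "0 \<le> (\<integral>x. ?d x \<partial>M)" by (rule Bochner_Integration.integral_nonneg) simp
  ultimately have "AE x in M. ?d x = 0" by (subst integral_nonneg_eq_0_iff_AE[symmetric]) auto
  thus u: "AE x in M. u3 x = a * u1 x + b * u2 x" by eventually_elim simp
  show "\<alpha>3 y = a * \<alpha>1 y + b * \<alpha>2 y" if y: "y \<in> S"
  proof -
    obtain R where R: "0 < R" "ball y R \<subseteq> \<Omega>" "\<And>z. z \<in> S \<Longrightarrow> z \<noteq> y \<Longrightarrow> 2 * R \<le> dist y z"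
      by (rule isolating_radius[OF y]) (rule that)
    let ?i = "indicator (ball y R) :: real^'n \<Rightarrow> real"
    have ib: "integrable M (\<lambda>x. ?i x * f x)" if "integrable M f" for f
      by (rule integrable_bounded_times[where Q = 1, OF indicator_ball_measurable _ that]) (simp add: indicator_def)
    have lim: "((\<lambda>\<epsilon>. \<integral>x. ?i x * (T \<epsilon> x * w \<epsilon> x) \<partial>M) \<longlongrightarrow> (\<integral>x. ?i x * (Vr x * u x) \<partial>M) + \<alpha> y) (at_right 0)"
      if "reduces \<nu> w u \<alpha>" for \<nu> w u \<alpha>
      using weak_limit_ball[OF that const_one y R(1) R(3)] by simp
    have l: "((\<lambda>\<epsilon>. a * (\<integral>x. ?i x * (T \<epsilon> x * w1 \<epsilon> x) \<partial>M) + b * (\<integral>x. ?i x * (T \<epsilon> x * w2 \<epsilon> x) \<partial>M)) \<longlongrightarrow>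
        a * ((\<integral>x. ?i x * (Vr x * u1 x) \<partial>M) + \<alpha>1 y) + b * ((\<integral>x. ?i x * (Vr x * u2 x) \<partial>M) + \<alpha>2 y)) (at_right 0)"
      by (intro tendsto_add tendsto_mult tendsto_const lim[OF r1] lim[OF r2])
    have ev: "eventually (\<lambda>\<epsilon>. a * (\<integral>x. ?i x * (T \<epsilon> x * w1 \<epsilon> x) \<partial>M) + b * (\<integral>x. ?i x * (T \<epsilon> x * w2 \<epsilon> x) \<partial>M)
        = (\<integral>x. ?i x * (T \<epsilon> x * w3 \<epsilon> x) \<partial>M)) (at_right 0)"
    proof (rule at_right_0_I[of 1])
      fix \<epsilon> :: real assume e: "0 < \<epsilon>"
      note iw = ib[OF red_w(2)[OF r1 e]] ib[OF red_w(2)[OF r2 e]] ib[OF red_w(2)[OF r3 e]]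
      have "(\<integral>x. ?i x * (T \<epsilon> x * w3 \<epsilon> x) \<partial>M) = (\<integral>x. a * (?i x * (T \<epsilon> x * w1 \<epsilon> x)) + b * (?i x * (T \<epsilon> x * w2 \<epsilon> x)) \<partial>M)"
      proof (rule integral_cong_AE)
        show "AE x in M. ?i x * (T \<epsilon> x * w3 \<epsilon> x) = a * (?i x * (T \<epsilon> x * w1 \<epsilon> x)) + b * (?i x * (T \<epsilon> x * w2 \<epsilon> x))"
          using w[OF e] by eventually_elim (simp add: algebra_simps)
      qed (use iw in auto)
      also have "\<dots> = a * (\<integral>x. ?i x * (T \<epsilon> x * w1 \<epsilon> x) \<partial>M) + b * (\<integral>x. ?i x * (T \<epsilon> x * w2 \<epsilon> x) \<partial>M)"
        using iw by simp
      finally show "a * (\<integral>x. ?i x * (T \<epsilon> x * w1 \<epsilon> x) \<partial>M) + b * (\<integral>x. ?i x * (T \<epsilon> x * w2 \<epsilon> x) \<partial>M)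
        = (\<integral>x. ?i x * (T \<epsilon> x * w3 \<epsilon> x) \<partial>M)" by simp
    qed simp
    have eq1: "(\<integral>x. ?i x * (Vr x * u3 x) \<partial>M) + \<alpha>3 y
        = a * ((\<integral>x. ?i x * (Vr x * u1 x) \<partial>M) + \<alpha>1 y) + b * ((\<integral>x. ?i x * (Vr x * u2 x) \<partial>M) + \<alpha>2 y)"
      by (rule tendsto_unique[OF _ lim[OF r3] Lim_transform_eventually[OF l ev]]) simp
    note iv = ib[OF integrable_Vu[OF r1]] ib[OF integrable_Vu[OF r2]] ib[OF integrable_Vu[OF r3]]
    have "(\<integral>x. ?i x * (Vr x * u3 x) \<partial>M) = (\<integral>x. a * (?i x * (Vr x * u1 x)) + b * (?i x * (Vr x * u2 x)) \<partial>M)"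
    proof (rule integral_cong_AE)
      show "AE x in M. ?i x * (Vr x * u3 x) = a * (?i x * (Vr x * u1 x)) + b * (?i x * (Vr x * u2 x))"
        using u by eventually_elim (simp add: algebra_simps)
    qed (use iv in auto)
    also have "\<dots> = a * (\<integral>x. ?i x * (Vr x * u1 x) \<partial>M) + b * (\<integral>x. ?i x * (Vr x * u2 x) \<partial>M)"
      using iv by simp
    finally show ?thesis using eq1 by (simp add: algebra_simps)
  qed
qed

end

section \<open>No concentration where the datum vanishes\<close>

lemma abs_le_of_both_signs:
  fixes t X B :: real
  assumes "0 < t" "2 * t * X \<le> B" "2 * (- t) * X \<le> B"
  shows "t * \<bar>X\<bar> \<le> B / 2"
  using assms by (cases "0 \<le> X") auto

context reduction_setting
begin

text \<open>Let \<open>f\<close> be \<open>T \<epsilon> * w \<epsilon>\<close> on the ball of radius \<open>R / 2\<close> about \<open>y\<close>, and \<open>g\<close> the rest. Then \<open>\<G> f = G \<nu> - w \<epsilon> - \<G> g\<close>, and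
  the term \<open>- f * w \<epsilon> = - T \<epsilon> * (w \<epsilon>)\<^sup>2\<close> of the energy density has a favourable sign, so the energy is at most the \<open>L\<^sup>1\<close>
  norm of \<open>f\<close> times a bound for \<open>G \<nu>\<close> and \<open>\<G> g\<close> on the ball. The bound for \<open>\<G> g\<close> is the point: the part of \<open>g\<close>
  near the ball is bounded uniformly in \<open>\<epsilon>\<close>, being in an annulus where \<open>V\<close> is bounded and \<open>\<nu>\<close> vanishes, and the
  rest is far away and bounded in \<open>L\<^sup>1\<close>. For fixed \<open>\<epsilon>\<close> the function \<open>w \<epsilon>\<close> is bounded on the ball itself, with a bound
  depending on \<open>\<epsilon>\<close>; this only serves to make \<open>f\<close> an admissible test function.\<close>

lemma energy_bounded:
  assumes red: "reduces \<nu> w u \<alpha>" and y: "y \<in> S"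
    and R: "0 < R" "ball y R \<subseteq> \<Omega>" "\<And>z. z \<in> S \<Longrightarrow> z \<noteq> y \<Longrightarrow> 2 * R \<le> dist y z"
    and off: "AE x in \<nu>. x \<notin> ball y R"
  obtains E where "0 \<le> E" "eventually (\<lambda>\<epsilon>. \<exists>f Q. f \<in> borel_measurable M \<and> (\<forall>x\<in>\<Omega>. \<bar>f x\<bar> \<le> (Q::real)) \<and>
      (AE x in M. f x = indicator (ball y (R / 2)) x * (T \<epsilon> x * w \<epsilon> x)) \<and>
      (\<integral>x. f x * \<G> f x \<partial>M) \<le> E) (at_right 0)"
proof -
  note \<nu> = red_nonneg[OF red]
  note n = nonneg_measuresD[OF \<nu>]
  have "\<forall>r. \<exists>B. 0 < r \<longrightarrow> 0 \<le> B \<and> (AE x in M. x \<in> away S r \<longrightarrow> V x \<le> ennreal B)"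
  proof
    fix r :: real
    show "\<exists>B. 0 < r \<longrightarrow> 0 \<le> B \<and> (AE x in M. x \<in> away S r \<longrightarrow> V x \<le> ennreal B)"
    proof (cases "0 < r")
      case True
      obtain B where "0 \<le> B" "AE x in M. x \<in> away S r \<longrightarrow> V x \<le> ennreal B"
        by (rule V_bounded_away[OF True]) (rule that)
      thus ?thesis by (intro exI[of _ B]) simp
    qed simp
  qed
  from choice[OF this] obtain b
    where b: "\<forall>r. 0 < r \<longrightarrow> 0 \<le> b r \<and> (AE x in M. x \<in> away S r \<longrightarrow> V x \<le> ennreal (b r))"
    by (rule exE)
  have Tb: "AE x in M. x \<in> away S r \<longrightarrow> \<bar>T \<epsilon> x\<bar> \<le> b r" if r: "0 < r" for r \<epsilon>
  proof -
    have b0: "0 \<le> b r" and Vb: "AE x in M. x \<in> away S r \<longrightarrow> V x \<le> ennreal (b r)"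
      using b r by auto
    show ?thesis using Vb V_finite
    proof eventually_elim
      case (elim x)
      show ?case
      proof
        assume "x \<in> away S r"
        hence "Vr x \<le> b r" using elim(1) b0 by (intro enn2real_leI) auto
        thus "\<bar>T \<epsilon> x\<bar> \<le> b r" using T_le_V[OF elim(2), of \<epsilon>] T_nonneg[of \<epsilon> x] by simp
      qed
    qed
  qed
  define F2 where "F2 = {a. R \<le> dist y a}"
  define F1 where "F1 = insert y F2"
  have F1S: "away F1 r \<subseteq> away S r" for r
  proof -
    have "S \<subseteq> F1"
    proof
      fix z assume z: "z \<in> S"
      show "z \<in> F1"
      proof (cases "z = y")
        case False
        hence "R \<le> dist y z" using R(1) R(3)[OF z] by linarith
        thus ?thesis by (simp add: F1_def F2_def)
      qed (simp add: F1_def)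
    qed
    thus ?thesis by (auto simp: away_def)
  qed
  have annulus: "x \<in> away F1 (R / 4)" if "x \<in> \<Omega>" "R / 4 \<le> dist y x" "dist y x \<le> 3 * R / 4" for x
  proof -
    have "R / 4 \<le> dist a x" if "R \<le> dist y a" for a
      using that \<open>dist y x \<le> 3 * R / 4\<close> dist_triangle[of y a x] by (simp add: dist_commute)
    thus ?thesis using that by (auto simp: away_def F1_def F2_def)
  qed
  have inner: "x \<in> away F2 (R / 2)" if "x \<in> \<Omega>" "x \<in> ball y (R / 2)" for x
  proof -
    have "R / 2 \<le> dist a x" if "R \<le> dist y a" for a
      using that \<open>x \<in> ball y (R / 2)\<close> dist_triangle[of y a x] by (simp add: dist_commute)
    thus ?thesis using that by (auto simp: away_def F2_def)
  qed
  have off_F: "AE x in \<nu>. x \<notin> away F r" if "0 < r" "F2 \<subseteq> F" for r F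
    using off
  proof eventually_elim
    case (elim x)
    hence "x \<in> F" using that(2) by (auto simp: F2_def)
    thus "x \<notin> away F r" using that(1) by (force simp: away_def)
  qed
  have off1: "AE x in \<nu>. x \<notin> away F1 r" and off2: "AE x in \<nu>. x \<notin> away F2 r" if "0 < r" for r
    by (rule off_F[OF that], simp add: F1_def subset_insertI)+
  obtain K0 where K0: "0 \<le> K0" "eventually (\<lambda>\<epsilon>. (\<integral>x. \<bar>T \<epsilon> x * w \<epsilon> x\<bar> \<partial>M) \<le> K0) (at_right 0)"
    by (rule eventually_L1_bounded[OF red]) (rule that)
  define K where "K = K0 + (\<integral>x. \<bar>u x\<bar> \<partial>M) + 1 + measure \<nu> \<Omega>"
  have u0: "0 \<le> (\<integral>x. \<bar>u x\<bar> \<partial>M)" by (rule Bochner_Integration.integral_nonneg) simp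
  have K: "0 \<le> K" "K0 \<le> K" "(\<integral>x. \<bar>u x\<bar> \<partial>M) + 1 \<le> K" "measure \<nu> \<Omega> \<le> K"
    unfolding K_def using K0(1) u0 measure_nonneg[of \<nu> \<Omega>] by linarith+
  have R4: "0 < R / 4" "0 < R / 2" using R by auto
  obtain C0 where C0: "\<And>W w \<nu>. locally_controlled F1 b K W w \<nu> \<Longrightarrow> AE x in M. x \<in> away F1 (R / 4) \<longrightarrow> \<bar>w x\<bar> \<le> C0"
    by (rule locally_controlled_bounded[OF K(1) R4(1)]) (rule that)
  define \<beta> where "\<beta> = b (R / 4) * \<bar>C0\<bar>"
  define \<kappa> where "\<kappa> = C * (R / 4) powr - q"
  have \<beta>: "0 \<le> \<beta>" using b R4 by (simp add: \<beta>_def)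
  have \<kappa>: "0 \<le> \<kappa>" using C by (simp add: \<kappa>_def)
  define Cg where "Cg = C1 * \<beta> + \<kappa> * K"
  define C3 where "C3 = C * (R / 2) powr - q * K + Cg"
  have C3: "0 \<le> C3" using C C1(1) \<beta> \<kappa> K by (simp add: C3_def Cg_def)
  have step: "\<exists>f Q. f \<in> borel_measurable M \<and> (\<forall>x\<in>\<Omega>. \<bar>f x\<bar> \<le> (Q::real)) \<and>
      (AE x in M. f x = indicator (ball y (R / 2)) x * (T \<epsilon> x * w \<epsilon> x)) \<and>
      (\<integral>x. f x * \<G> f x \<partial>M) \<le> C3 * K"
    if e: "0 < \<epsilon>" and e1: "(\<integral>x. \<bar>T \<epsilon> x * w \<epsilon> x\<bar> \<partial>M) \<le> K0" and e2: "(\<integral>x. \<bar>w \<epsilon> x - u x\<bar> \<partial>M) < 1" for \<epsilon>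
  proof -
    note iw = red_w[OF red e]
    have TwK: "(\<integral>x. \<bar>T \<epsilon> x * w \<epsilon> x\<bar> \<partial>M) \<le> K" using e1 K by linarith
    have "(\<integral>x. \<bar>w \<epsilon> x\<bar> \<partial>M) \<le> (\<integral>x. \<bar>w \<epsilon> x - u x\<bar> + \<bar>u x\<bar> \<partial>M)"
      using iw(1) red_integrable[OF red] by (intro integral_mono) auto
    also have "\<dots> = (\<integral>x. \<bar>w \<epsilon> x - u x\<bar> \<partial>M) + (\<integral>x. \<bar>u x\<bar> \<partial>M)"
      using iw(1) red_integrable[OF red] by simp
    finally have wK: "(\<integral>x. \<bar>w \<epsilon> x\<bar> \<partial>M) \<le> K" using e2 K by linarith
    have lc1: "locally_controlled F1 b K (T \<epsilon>) (w \<epsilon>) \<nu>"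
      unfolding locally_controlled_def
    proof (intro conjI allI impI)
      show "AE x in M. x \<in> away F1 r \<longrightarrow> \<bar>T \<epsilon> x\<bar> \<le> b r" if "0 < r" for r
        using Tb[OF that, of \<epsilon>] by eventually_elim (use F1S in auto)
    qed (use \<nu> K wK TwK off1 red_sol[OF red e] in auto)
    have lc2: "locally_controlled F2 (\<lambda>_. 1 / \<epsilon>) K (T \<epsilon>) (w \<epsilon>) \<nu>"
      unfolding locally_controlled_def
    proof (intro conjI allI impI)
      show "AE x in M. x \<in> away F2 r \<longrightarrow> \<bar>T \<epsilon> x\<bar> \<le> 1 / \<epsilon>" for r
        using T_nonneg T_le[OF e] by (intro AE_I2) auto
    qed (use \<nu> K wK TwK off2 red_sol[OF red e] in auto)
    obtain Q where Q: "\<And>W w \<nu>. locally_controlled F2 (\<lambda>_. 1 / \<epsilon>) K W w \<nu> \<Longrightarrow> AE x in M. x \<in> away F2 (R / 2) \<longrightarrow> \<bar>w x\<bar> \<le> Q"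
      by (rule locally_controlled_bounded[OF K(1) R4(2)]) (rule that)
    let ?i = "indicator (ball y (R / 2)) :: real^'n \<Rightarrow> real"
    \<comment> \<open>The clipping changes \<open>f\<close> on a null set only and makes it bounded everywhere.\<close>
    define f where "f x = ?i x * (T \<epsilon> x * max (- \<bar>Q\<bar>) (min \<bar>Q\<bar> (w \<epsilon> x)))" for x
    have im: "?i \<in> borel_measurable M" by (rule indicator_ball_measurable)
    have fm: "f \<in> borel_measurable M"
      unfolding f_def[abs_def] using im T_measurable borel_measurable_integrable[OF iw(1)]
      by (intro borel_measurable_times borel_measurable_max borel_measurable_min borel_measurable_const) auto
    have fb: "\<bar>f x\<bar> \<le> 1 / \<epsilon> * \<bar>Q\<bar>" for x
    proof -
      have "\<bar>T \<epsilon> x\<bar> * \<bar>max (- \<bar>Q\<bar>) (min \<bar>Q\<bar> (w \<epsilon> x))\<bar> \<le> 1 / \<epsilon> * \<bar>Q\<bar>"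
        using T_nonneg[of \<epsilon> x] T_le[OF e, of x] e by (intro mult_mono) auto
      thus ?thesis using e by (simp add: f_def abs_mult indicator_def)
    qed
    have fAE: "AE x in M. f x = ?i x * (T \<epsilon> x * w \<epsilon> x)"
      using Q[OF lc2] AE_space[of M]
    proof eventually_elim
      case (elim x)
      show ?case
      proof (cases "x \<in> ball y (R / 2)")
        case True
        hence "\<bar>w \<epsilon> x\<bar> \<le> \<bar>Q\<bar>" using elim inner[of x] by auto
        hence "max (- \<bar>Q\<bar>) (min \<bar>Q\<bar> (w \<epsilon> x)) = w \<epsilon> x" by linarith
        thus ?thesis by (simp add: f_def)
      qed (simp add: f_def)
    qed
    have i1: "integrable M (\<lambda>x. 1::real)" by simp
    have i_f: "integrable M f" using integrable_bounded_times[OF fm fb i1] by simp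
    define g where "g x = (1 - ?i x) * (T \<epsilon> x * w \<epsilon> x)" for x
    have ig: "integrable M g"
      unfolding g_def[abs_def]
    proof (rule integrable_bounded_times[where Q = 1, OF _ _ iw(2)])
      show "(\<lambda>x. 1 - ?i x) \<in> borel_measurable M"
        by (intro borel_measurable_diff borel_measurable_const im)
    qed (simp add: indicator_def)
    have split: "AE x in M. \<G> (\<lambda>y. T \<epsilon> y * w \<epsilon> y) x = \<G> f x + \<G> g x"
      using green_fun_add_AE[OF i_f ig, of 1 1] AE_space[of M]
    proof eventually_elim
      case (elim x)
      have "\<G> (\<lambda>y. T \<epsilon> y * w \<epsilon> y) x = \<G> (\<lambda>y. 1 * f y + 1 * g y) x"
      proof (rule green_fun_cong_AE)
        show "AE y in M. T \<epsilon> y * w \<epsilon> y = 1 * f y + 1 * g y"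
          using fAE by eventually_elim (simp add: g_def algebra_simps)
      qed (use elim iw i_f ig in \<open>auto intro: borel_measurable_integrable\<close>)
      thus ?case using elim by simp
    qed
    have gAE: "AE z in M. x \<in> \<Omega> \<inter> ball y (R / 2) \<longrightarrow> \<bar>G x z * g z\<bar> \<le> G x z * \<beta> + \<kappa> * \<bar>T \<epsilon> z * w \<epsilon> z\<bar>" for x
      using Tb[OF R4(1), of \<epsilon>] C0[OF lc1] AE_space[of M]
    proof eventually_elim
      case (elim z)
      show ?case
      proof
        assume x: "x \<in> \<Omega> \<inter> ball y (R / 2)"
        have z: "z \<in> \<Omega>" using elim by simp
        have G0: "0 \<le> G x z" using G_nonneg x z by auto
        \<comment> \<open>inside the ball, in the annulus, or at distance at least \<open>R / 4\<close> from \<open>x\<close>\<close>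
        consider "z \<in> ball y (R / 2)" | "R / 2 \<le> dist y z" "dist y z \<le> 3 * R / 4" | "3 * R / 4 < dist y z"
          by fastforce
        thus "\<bar>G x z * g z\<bar> \<le> G x z * \<beta> + \<kappa> * \<bar>T \<epsilon> z * w \<epsilon> z\<bar>"
        proof cases
          case 1
          thus ?thesis using G0 \<beta> \<kappa> by (simp add: g_def)
        next
          case 2
          hence a: "z \<in> away F1 (R / 4)" using annulus[OF z] R by auto
          have "\<bar>T \<epsilon> z\<bar> \<le> b (R / 4)" "\<bar>w \<epsilon> z\<bar> \<le> \<bar>C0\<bar>" using elim a F1S by auto
          hence "\<bar>T \<epsilon> z\<bar> * \<bar>w \<epsilon> z\<bar> \<le> \<beta>" unfolding \<beta>_def by (intro mult_mono) auto
          moreover have "\<bar>g z\<bar> \<le> \<bar>T \<epsilon> z\<bar> * \<bar>w \<epsilon> z\<bar>" by (simp add: g_def indicator_def abs_mult)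
          ultimately have "G x z * \<bar>g z\<bar> \<le> G x z * \<beta>" using G0 by (intro mult_left_mono) auto
          thus ?thesis using G0 \<kappa> by (simp add: abs_mult add_increasing2)
        next
          case 3
          have "R / 4 \<le> dist x z" using 3 x dist_triangle[of y z x] by auto
          hence "G x z \<le> \<kappa>" unfolding \<kappa>_def using x z R4 by (intro G_far) auto
          moreover have "\<bar>g z\<bar> \<le> \<bar>T \<epsilon> z * w \<epsilon> z\<bar>" by (simp add: g_def indicator_def)
          ultimately have "G x z * \<bar>g z\<bar> \<le> \<kappa> * \<bar>T \<epsilon> z * w \<epsilon> z\<bar>" using G0 \<kappa> by (intro mult_mono) auto
          thus ?thesis using G0 \<beta> by (simp add: abs_mult add_increasing)
        qed
      qed
    qed
    have gbound: "AE x in M. x \<in> ball y (R / 2) \<longrightarrow> \<bar>\<G> g x\<bar> \<le> Cg"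
      using AE_integrable_G[OF ig] AE_space[of M]
    proof eventually_elim
      case (elim x)
      show ?case
      proof
        assume xb: "x \<in> ball y (R / 2)"
        have x: "x \<in> \<Omega>" using elim by simp
        have "\<bar>\<G> g x\<bar> \<le> (\<integral>z. \<bar>G x z * g z\<bar> \<partial>M)"
          unfolding green_fun_def by (rule integral_abs_bound)
        also have "\<dots> \<le> (\<integral>z. G x z * \<beta> + \<kappa> * \<bar>T \<epsilon> z * w \<epsilon> z\<bar> \<partial>M)"
        proof (rule integral_mono_AE)
          show "AE z in M. \<bar>G x z * g z\<bar> \<le> G x z * \<beta> + \<kappa> * \<bar>T \<epsilon> z * w \<epsilon> z\<bar>"
            using gAE[of x] by eventually_elim (use x xb in auto)
        qed (use elim integrable_G(1)[OF x] iw(2) in auto)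
        also have "\<dots> = (\<integral>z. G x z \<partial>M) * \<beta> + \<kappa> * (\<integral>z. \<bar>T \<epsilon> z * w \<epsilon> z\<bar> \<partial>M)"
          using integrable_G(1)[OF x] iw(2) by simp
        also have "\<dots> \<le> C1 * \<beta> + \<kappa> * K"
          using integrable_G(2)[OF x] TwK \<beta> \<kappa> by (intro add_mono mult_left_mono mult_right_mono)
        finally show "\<bar>\<G> g x\<bar> \<le> Cg" by (simp add: Cg_def)
      qed
    qed
    have \<nu>bound: "green_meas G \<nu> x \<le> C * (R / 2) powr - q * K" if x: "x \<in> \<Omega>" "x \<in> ball y (R / 2)" for x
    proof -
      have "AE z in \<nu>. R / 2 \<le> dist x z"
        using off
      proof eventually_elim
        case (elim z)
        thus ?case using x(2) dist_triangle[of y z x] by (simp add: not_less)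
      qed
      from green_meas_far[OF \<nu> x(1) R4(2) this]
      have "green_meas G \<nu> x \<le> C * (R / 2) powr - q * measure \<nu> \<Omega>" .
      also have "\<dots> \<le> C * (R / 2) powr - q * K" using C K by (intro mult_left_mono) auto
      finally show ?thesis .
    qed
    have point: "AE x in M. f x * \<G> f x \<le> C3 * \<bar>T \<epsilon> x * w \<epsilon> x\<bar>"
      using fAE split gbound iw(3) AE_space[of M]
    proof eventually_elim
      case (elim x)
      show ?case
      proof (cases "x \<in> ball y (R / 2)")
        case False
        thus ?thesis using elim(1) C3 by simp
      next
        case True
        have x: "x \<in> \<Omega>" using elim by simp
        let ?a = "T \<epsilon> x * w \<epsilon> x" and ?p = "green_meas G \<nu> x" and ?g = "\<G> g x"
        have fx: "f x = ?a" using elim(1) True by simp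
        have "w \<epsilon> x = ?p - (\<G> f x + ?g)" using elim(2,4) by simp
        hence gf: "\<G> f x = ?p - ?g - w \<epsilon> x" by linarith
        have "0 \<le> ?a * w \<epsilon> x" using T_nonneg[of \<epsilon> x] by (simp add: mult.assoc)
        hence "f x * \<G> f x \<le> ?a * (?p - ?g)"
          unfolding fx gf by (simp add: right_diff_distrib)
        also have "\<dots> \<le> \<bar>?a\<bar> * \<bar>?p - ?g\<bar>" by (metis abs_ge_self abs_mult)
        also have "\<dots> \<le> \<bar>?a\<bar> * C3"
        proof (rule mult_left_mono)
          have "\<bar>?g\<bar> \<le> Cg" using elim(3) True by blast
          thus "\<bar>?p - ?g\<bar> \<le> C3"
            using \<nu>bound[OF x True] green_meas_nonneg[OF \<nu> x] unfolding C3_def by linarith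
        qed simp
        finally show ?thesis by (simp add: mult.commute)
      qed
    qed
    have "(\<integral>x. f x * \<G> f x \<partial>M) \<le> (\<integral>x. C3 * \<bar>T \<epsilon> x * w \<epsilon> x\<bar> \<partial>M)"
      using point iw(2) integrable_bounded_times[OF fm fb integrable_green_fun[OF i_f]]
      by (intro integral_mono_AE) auto
    also have "\<dots> \<le> C3 * K" using TwK C3 by (simp add: mult_left_mono)
    finally have "(\<integral>x. f x * \<G> f x \<partial>M) \<le> C3 * K" .
    thus ?thesis using fm fb fAE by (intro exI[of _ f] exI[of _ "1 / \<epsilon> * \<bar>Q\<bar>"]) simp
  qed
  have ev: "eventually (\<lambda>\<epsilon>. (\<integral>x. \<bar>w \<epsilon> x - u x\<bar> \<partial>M) < 1) (at_right 0)"
    by (rule order_tendstoD(2)[OF red_lim[OF red]]) simp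
  show thesis
  proof (rule that[of "C3 * K"])
    show "0 \<le> C3 * K" using C3 K by simp
    show "eventually (\<lambda>\<epsilon>. \<exists>f Q. f \<in> borel_measurable M \<and> (\<forall>x\<in>\<Omega>. \<bar>f x\<bar> \<le> (Q::real)) \<and>
      (AE x in M. f x = indicator (ball y (R / 2)) x * (T \<epsilon> x * w \<epsilon> x)) \<and>
      (\<integral>x. f x * \<G> f x \<partial>M) \<le> C3 * K) (at_right 0)"
      using K0(2) ev eventually_at_right_less[of 0] by eventually_elim (rule step)
  qed
qed

text \<open>As \<open>\<epsilon> \<rightarrow> 0\<close>, the pairing of \<open>f\<close> with the potential of a ball converges, and the limit carries \<open>\<alpha> y\<close> times the
  value of that potential at \<open>y\<close>.\<close>

lemma energy_limit:
  assumes red: "reduces \<nu> w u \<alpha>" and y: "y \<in> S"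
    and R: "0 < R" "ball y R \<subseteq> \<Omega>" "\<And>z. z \<in> S \<Longrightarrow> z \<noteq> y \<Longrightarrow> 2 * R \<le> dist y z"
    and off: "AE x in \<nu>. x \<notin> ball y R"
  obtains E where "0 \<le> E" "\<And>r t. 2 * t * ((\<integral>x. indicator (ball y (R / 2)) x * \<G> (indicator (ball y r)) x * (Vr x * u x) \<partial>M)
        + \<alpha> y * \<G> (indicator (ball y r)) y)
      \<le> E + t\<^sup>2 * (\<integral>x. indicator (ball y r) x * \<G> (indicator (ball y r)) x \<partial>M)"
proof -
  obtain E where E: "0 \<le> E" "eventually (\<lambda>\<epsilon>. \<exists>f Q. f \<in> borel_measurable M \<and> (\<forall>x\<in>\<Omega>. \<bar>f x\<bar> \<le> (Q::real)) \<and>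
      (AE x in M. f x = indicator (ball y (R / 2)) x * (T \<epsilon> x * w \<epsilon> x)) \<and>
      (\<integral>x. f x * \<G> f x \<partial>M) \<le> E) (at_right 0)"
    by (rule energy_bounded[OF red y R off]) (assumption | rule that)+
  show thesis
  proof (rule that[OF E(1)])
    fix r t :: real
    let ?h = "indicator (ball y r) :: real^'n \<Rightarrow> real" and ?i = "indicator (ball y (R / 2)) :: real^'n \<Rightarrow> real"
    let ?g = "\<G> ?h"
    have hb: "\<bar>?h x\<bar> \<le> 1" for x by (simp add: indicator_def)
    note hm = indicator_ball_measurable[of y r]
    note gc = green_fun_continuous[OF hm hb] and gb = green_fun_bounded[OF _ hm hb]
    have R2: "0 < R / 2" "\<And>z. z \<in> S \<Longrightarrow> z \<noteq> y \<Longrightarrow> 2 * (R / 2) \<le> dist y z"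
    proof -
      show "0 < R / 2" using R(1) by simp
      fix z assume "z \<in> S" "z \<noteq> y"
      thus "2 * (R / 2) \<le> dist y z" using R(1) R(3)[of z] by linarith
    qed
    have lim: "((\<lambda>\<epsilon>. 2 * t * (\<integral>x. ?i x * ?g x * (T \<epsilon> x * w \<epsilon> x) \<partial>M)) \<longlongrightarrow>
        2 * t * ((\<integral>x. ?i x * ?g x * (Vr x * u x) \<partial>M) + \<alpha> y * ?g y)) (at_right 0)"
      by (intro tendsto_mult tendsto_const weak_limit_ball[OF red gc gb y R2])
    have "eventually (\<lambda>\<epsilon>. 2 * t * (\<integral>x. ?i x * ?g x * (T \<epsilon> x * w \<epsilon> x) \<partial>M)
        \<le> E + t\<^sup>2 * (\<integral>x. ?h x * ?g x \<partial>M)) (at_right 0)"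
      using E(2) eventually_at_right_less[of 0]
    proof eventually_elim
      case (elim \<epsilon>)
      note e = elim(2)
      from elim(1) obtain f Q where f: "f \<in> borel_measurable M" "\<forall>x\<in>\<Omega>. \<bar>f x\<bar> \<le> (Q::real)"
        "AE x in M. f x = ?i x * (T \<epsilon> x * w \<epsilon> x)" "(\<integral>x. f x * \<G> f x \<partial>M) \<le> E"
        by (elim exE conjE)
      have fb: "\<bar>f x\<bar> \<le> Q" if "x \<in> \<Omega>" for x using f(2) that by blast
      have i1: "integrable M (\<lambda>x. 1::real)" by simp
      have i_f: "integrable M f" using integrable_bounded_times[OF f(1) fb i1] by simp
      have "2 * t * (\<integral>x. ?h x * \<G> f x \<partial>M) \<le> E + t\<^sup>2 * (\<integral>x. ?h x * ?g x \<partial>M)"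
        using psd_cross[OF f(1) fb hm hb, of t] f(4) by linarith
      also have "(\<integral>x. ?h x * \<G> f x \<partial>M) = (\<integral>x. ?g x * f x \<partial>M)"
        by (rule green_fun_pairing[OF i_f hm hb])
      also have "\<dots> = (\<integral>x. ?i x * ?g x * (T \<epsilon> x * w \<epsilon> x) \<partial>M)"
      proof (rule integral_cong_AE)
        show "AE x in M. ?g x * f x = ?i x * ?g x * (T \<epsilon> x * w \<epsilon> x)"
          using f(3) by eventually_elim simp
        show "(\<lambda>x. ?g x * f x) \<in> borel_measurable M"
          using gc(2) f(1) by (rule borel_measurable_times)
        show "(\<lambda>x. ?i x * ?g x * (T \<epsilon> x * w \<epsilon> x)) \<in> borel_measurable M"
          by (intro borel_measurable_times indicator_ball_measurable gc(2) borel_measurable_integrable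
              red_w(2)[OF red e])
      qed
      finally show ?case .
    qed
    with lim show "2 * t * ((\<integral>x. ?i x * ?g x * (Vr x * u x) \<partial>M) + \<alpha> y * ?g y)
      \<le> E + t\<^sup>2 * (\<integral>x. ?h x * ?g x \<partial>M)"
      by (rule tendsto_upperbound) simp
  qed
qed

text \<open>The potential \<open>g r\<close> of the ball of radius \<open>r\<close> about \<open>y\<close> is of order \<open>r\<^sup>2\<^sup>s\<close> at \<open>y\<close>, and its energy is
  \<open>O(r\<^sup>n\<^sup>+\<^sup>2\<^sup>s)\<close>. The choice \<open>t = \<plusminus> r\<^sup>-\<^sup>n\<^sup>/\<^sup>2\<^sup>-\<^sup>s\<close> makes the right-hand side of the energy inequality bounded and
  leaves \<open>\<bar>\<integral> g r * V u + \<alpha> y * g r y\<bar> = O(r\<^sup>n\<^sup>/\<^sup>2\<^sup>+\<^sup>s)\<close>. After division by \<open>r\<^sup>2\<^sup>s\<close> both the right-hand side and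
  the integral tend to \<open>0\<close>, the integral because \<open>g r / r\<^sup>2\<^sup>s\<close> is bounded and tends to \<open>0\<close> off \<open>y\<close>.\<close>

lemma coefficient_zero_off_support:
  assumes red: "reduces \<nu> w u \<alpha>" and y: "y \<in> S" and R': "0 < R'" and off': "AE x in \<nu>. x \<notin> ball y R'"
  shows "\<alpha> y = 0"
proof -
  let ?N = "real CARD('n)"
  have y\<Omega>: "y \<in> \<Omega>" using y S by auto
  obtain R1 where R1: "0 < R1" "ball y R1 \<subseteq> \<Omega>" "\<And>z. z \<in> S \<Longrightarrow> z \<noteq> y \<Longrightarrow> 2 * R1 \<le> dist y z"
    by (rule isolating_radius[OF y]) (rule that)
  define R where "R = min R1 R'"
  have R: "0 < R" "ball y R \<subseteq> \<Omega>" "\<And>z. z \<in> S \<Longrightarrow> z \<noteq> y \<Longrightarrow> 2 * R \<le> dist y z"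
  proof -
    show "0 < R" using R1 R' by (simp add: R_def)
    show "ball y R \<subseteq> \<Omega>" using R1(2) by (auto simp: R_def)
    fix z assume "z \<in> S" "z \<noteq> y"
    thus "2 * R \<le> dist y z" using R1(3)[of z] by (simp add: R_def min_def)
  qed
  have off: "AE x in \<nu>. x \<notin> ball y R" using off' by eventually_elim (auto simp: R_def)
  obtain E where E: "0 \<le> E" "\<And>r t. 2 * t * ((\<integral>x. indicator (ball y (R / 2)) x * \<G> (indicator (ball y r)) x * (Vr x * u x) \<partial>M)
        + \<alpha> y * \<G> (indicator (ball y r)) y)
      \<le> E + t\<^sup>2 * (\<integral>x. indicator (ball y r) x * \<G> (indicator (ball y r)) x \<partial>M)"
    by (rule energy_limit[OF red y R off]) (assumption | rule that)+
  obtain D where D: "0 \<le> D" "\<And>x y r. x \<in> \<Omega> \<Longrightarrow> 0 < r \<Longrightarrow> \<G> (indicator (ball y r)) x \<le> D * r powr (2 * s)"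
    by (rule ball_potential_upper) (rule that)
  obtain r0 where r0: "0 < r0"
    "\<And>r. 0 < r \<Longrightarrow> r \<le> r0 \<Longrightarrow> c * unit_ball_vol CARD('n) * r powr (2 * s) \<le> \<G> (indicator (ball y r)) y"
    by (rule ball_potential_lower[OF y\<Omega>]) (rule that)
  define v where "v = unit_ball_vol ?N"
  have v: "0 < v" by (simp add: v_def)
  let ?i = "indicator (ball y (R / 2)) :: real^'n \<Rightarrow> real"
  define g where "g r = \<G> (indicator (ball y r))" for r
  note g0 = ball_potential_nonneg[of _ y, folded g_def]
  have gm: "g r \<in> borel_measurable M" for r
    unfolding g_def by (rule green_fun_continuous(2)[OF indicator_ball_measurable, of _ _ 1]) (simp add: indicator_def)
  note iV = integrable_Vu[OF red]
  have iint: "integrable M (\<lambda>x. ?i x * g r x * h x)" if "0 < r" "integrable M h" for r h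
  proof (rule integrable_bounded_times[OF _ _ that(2)])
    show "(\<lambda>x. ?i x * g r x) \<in> borel_measurable M"
      by (intro borel_measurable_times indicator_ball_measurable gm)
    show "\<bar>?i x * g r x\<bar> \<le> D * r powr (2 * s)" if "x \<in> \<Omega>" for x
      using g0[OF that, of r] D(2)[OF that \<open>0 < r\<close>, of y, folded g_def] D(1) by (simp add: indicator_def)
  qed
  have key: "\<bar>\<alpha> y\<bar> * (c * v) \<le> (E + D * v) / 2 * r powr (?N / 2 - s)
      + (\<integral>x. r powr (- 2 * s) * (?i x * g r x * \<bar>Vr x * u x\<bar>) \<partial>M)" if r: "0 < r" "r \<le> r0" for r
  proof -
    let ?I = "(\<integral>x. ?i x * g r x * (Vr x * u x) \<partial>M)"
    define \<tau> where "\<tau> = r powr - (?N / 2 + s)"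
    have \<tau>: "0 < \<tau>" using r by (simp add: \<tau>_def)
    have en: "(\<integral>x. indicator (ball y r) x * g r x \<partial>M) \<le> D * r powr (2 * s) * (v * r ^ CARD('n))"
      unfolding g_def v_def by (rule ball_energy_le) (use D r in auto)
    have "\<tau>\<^sup>2 = r powr - (?N + 2 * s)"
    proof -
      have "- (?N / 2 + s) + - (?N / 2 + s) = - (?N + 2 * s)" by simp
      thus ?thesis unfolding \<tau>_def power2_eq_square powr_add[symmetric] by (simp only:)
    qed
    moreover have "r powr (2 * s) * r ^ CARD('n) = r powr (?N + 2 * s)"
      using r by (simp add: powr_realpow[symmetric] powr_add[symmetric] add.commute)
    ultimately have one: "\<tau>\<^sup>2 * (r powr (2 * s) * r ^ CARD('n)) = 1"
      using r by (simp only: powr_add[symmetric]) simp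
    have "\<tau>\<^sup>2 * (\<integral>x. indicator (ball y r) x * g r x \<partial>M) \<le> \<tau>\<^sup>2 * (D * r powr (2 * s) * (v * r ^ CARD('n)))"
      using en by (intro mult_left_mono) auto
    also have "\<dots> = D * v * (\<tau>\<^sup>2 * (r powr (2 * s) * r ^ CARD('n)))" by (simp only: ac_simps)
    finally have en': "\<tau>\<^sup>2 * (\<integral>x. indicator (ball y r) x * g r x \<partial>M) \<le> D * v" unfolding one by simp
    have "2 * \<tau> * (?I + \<alpha> y * g r y) \<le> E + D * v" "2 * (- \<tau>) * (?I + \<alpha> y * g r y) \<le> E + D * v"
      using E(2)[of \<tau> r, folded g_def] E(2)[of "- \<tau>" r, folded g_def] en' by auto
    hence "\<tau> * \<bar>?I + \<alpha> y * g r y\<bar> \<le> (E + D * v) / 2" by (rule abs_le_of_both_signs[OF \<tau>])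
    hence le1: "r powr (?N / 2 + s) * (\<tau> * \<bar>?I + \<alpha> y * g r y\<bar>) \<le> r powr (?N / 2 + s) * ((E + D * v) / 2)"
      by (rule mult_left_mono) simp
    have "r powr (?N / 2 + s) * \<tau> = 1"
      unfolding \<tau>_def powr_add[symmetric] using r by simp
    hence I: "\<bar>?I + \<alpha> y * g r y\<bar> \<le> (E + D * v) / 2 * r powr (?N / 2 + s)"
      using le1 by (simp only: mult.assoc[symmetric] mult_1 mult.commute[of "r powr (?N / 2 + s)" "(E + D * v) / 2"])
    have absI: "\<bar>?I\<bar> \<le> (\<integral>x. ?i x * g r x * \<bar>Vr x * u x\<bar> \<partial>M)"
    proof -
      have "\<bar>?I\<bar> \<le> (\<integral>x. \<bar>?i x * g r x * (Vr x * u x)\<bar> \<partial>M)" by (rule integral_abs_bound)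
      also have "\<dots> = (\<integral>x. ?i x * g r x * \<bar>Vr x * u x\<bar> \<partial>M)"
        using g0 by (intro Bochner_Integration.integral_cong) (auto simp: abs_mult)
      finally show ?thesis .
    qed
    have "\<bar>\<alpha> y\<bar> * (c * v * r powr (2 * s)) \<le> \<bar>\<alpha> y\<bar> * g r y"
      unfolding g_def v_def by (intro mult_left_mono r0 r) simp
    also have "\<dots> = \<bar>\<alpha> y * g r y\<bar>" using g0[OF y\<Omega>, of r] by (simp add: abs_mult)
    also have "\<dots> \<le> (E + D * v) / 2 * r powr (?N / 2 + s) + (\<integral>x. ?i x * g r x * \<bar>Vr x * u x\<bar> \<partial>M)"
      using I absI by linarith
    finally have le: "\<bar>\<alpha> y\<bar> * (c * v * r powr (2 * s)) \<le> \<dots>" .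
    have p1: "r powr (- 2 * s) * r powr (2 * s) = 1" "r powr (- 2 * s) * r powr (?N / 2 + s) = r powr (?N / 2 - s)"
      using r unfolding powr_add[symmetric] by auto
    have "\<bar>\<alpha> y\<bar> * (c * v) = r powr (- 2 * s) * (\<bar>\<alpha> y\<bar> * (c * v * r powr (2 * s)))"
      using p1(1) by (simp add: ac_simps)
    also have "\<dots> \<le> r powr (- 2 * s) * ((E + D * v) / 2 * r powr (?N / 2 + s) + (\<integral>x. ?i x * g r x * \<bar>Vr x * u x\<bar> \<partial>M))"
      by (rule mult_left_mono[OF le]) simp
    also have "\<dots> = (E + D * v) / 2 * r powr (?N / 2 - s) + (\<integral>x. r powr (- 2 * s) * (?i x * g r x * \<bar>Vr x * u x\<bar>) \<partial>M)"
      unfolding distrib_left p1(2)[symmetric] integral_mult_right_zero by (simp only: ac_simps)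
    finally show ?thesis .
  qed
  define \<rho> where "\<rho> k = r0 / real (Suc k)" for k
  have \<rho>: "0 < \<rho> k" "\<rho> k \<le> r0" for k using r0 by (auto simp: \<rho>_def field_simps)
  have \<rho>0: "\<rho> \<longlonglongrightarrow> 0" unfolding \<rho>_def[abs_def] by (rule LIMSEQ_Suc[OF lim_const_over_n])
  have pow0: "(\<lambda>k. \<rho> k powr a) \<longlonglongrightarrow> 0" if "0 < a" for a
    by (rule tendsto_zero_powrI[OF \<rho>0 tendsto_const _ that]) (intro always_eventually allI less_imp_le \<rho>(1))
  have l2: "(\<lambda>k. \<integral>x. \<rho> k powr (- 2 * s) * (?i x * g (\<rho> k) x * \<bar>Vr x * u x\<bar>) \<partial>M) \<longlonglongrightarrow> (\<integral>x. 0 \<partial>M)"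
  proof (rule integral_dominated_convergence[where w = "\<lambda>x. D * \<bar>Vr x * u x\<bar>"])
    show "(\<lambda>x. \<rho> k powr (- 2 * s) * (?i x * g (\<rho> k) x * \<bar>Vr x * u x\<bar>)) \<in> borel_measurable M" for k
      by (intro borel_measurable_times borel_measurable_const indicator_ball_measurable gm
          borel_measurable_abs borel_measurable_integrable iV)
    show "AE x in M. norm (\<rho> k powr (- 2 * s) * (?i x * g (\<rho> k) x * \<bar>Vr x * u x\<bar>)) \<le> D * \<bar>Vr x * u x\<bar>" for k
    proof (rule AE_I2)
      fix x assume "x \<in> space M"
      hence x: "x \<in> \<Omega>" by simp
      have "\<rho> k powr (- 2 * s) * (?i x * g (\<rho> k) x) \<le> \<rho> k powr (- 2 * s) * (D * \<rho> k powr (2 * s))"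
        using g0[OF x, of "\<rho> k"] D(2)[OF x \<rho>(1), of y k, folded g_def] D(1)
        by (intro mult_left_mono) (auto simp: indicator_def)
      also have "\<dots> = D * (\<rho> k powr (- 2 * s) * \<rho> k powr (2 * s))" by (simp only: ac_simps)
      also have "\<rho> k powr (- 2 * s) * \<rho> k powr (2 * s) = 1"
        using \<rho>(1)[of k] unfolding powr_add[symmetric] by simp
      finally have "\<rho> k powr (- 2 * s) * (?i x * g (\<rho> k) x) \<le> D" by simp
      from mult_right_mono[OF this, of "\<bar>Vr x * u x\<bar>"]
      show "norm (\<rho> k powr (- 2 * s) * (?i x * g (\<rho> k) x * \<bar>Vr x * u x\<bar>)) \<le> D * \<bar>Vr x * u x\<bar>"
        using g0[OF x, of "\<rho> k"] by (simp add: abs_mult mult.assoc)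
    qed
    show "AE x in M. (\<lambda>k. \<rho> k powr (- 2 * s) * (?i x * g (\<rho> k) x * \<bar>Vr x * u x\<bar>)) \<longlonglongrightarrow> 0"
      using AE_neq_point[OF \<Omega>_sets(2), of y] AE_space[of M]
    proof eventually_elim
      case (elim x)
      have x: "x \<in> \<Omega>" using elim by simp
      let ?c = "C * (dist x y / 2) powr - q * v * \<bar>Vr x * u x\<bar>"
      have c0: "0 \<le> C * (dist x y / 2) powr - q * v" using C v by simp
      have "eventually (\<lambda>k. \<rho> k < dist x y / 2) sequentially"
        using elim by (intro order_tendstoD(2)[OF \<rho>0]) simp
      hence ev: "eventually (\<lambda>k. norm (\<rho> k powr (- 2 * s) * (?i x * g (\<rho> k) x * \<bar>Vr x * u x\<bar>)) \<le> ?c * \<rho> k powr q) sequentially"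
      proof eventually_elim
        case (elim k)
        have "g (\<rho> k) x \<le> C * (dist x y / 2) powr - q * (v * \<rho> k ^ CARD('n))"
          unfolding g_def v_def using elim by (intro ball_potential_far[OF x \<rho>(1)]) simp
        hence "?i x * g (\<rho> k) x \<le> C * (dist x y / 2) powr - q * v * \<rho> k ^ CARD('n)"
          using mult_nonneg_nonneg[OF c0 zero_le_power[OF less_imp_le[OF \<rho>(1)[of k]]], of "CARD('n)"]
          by (cases "x \<in> ball y (R / 2)") (simp_all add: mult.assoc del: mem_ball)
        hence "\<rho> k powr (- 2 * s) * (?i x * g (\<rho> k) x) \<le> \<rho> k powr (- 2 * s) * (C * (dist x y / 2) powr - q * v * \<rho> k ^ CARD('n))"
          by (intro mult_left_mono) auto
        also have "\<dots> = C * (dist x y / 2) powr - q * v * (\<rho> k powr (- 2 * s) * \<rho> k ^ CARD('n))" by (simp only: ac_simps)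
        also have "\<rho> k powr (- 2 * s) * \<rho> k ^ CARD('n) = \<rho> k powr q"
          using \<rho>(1)[of k] by (simp add: powr_realpow[symmetric] powr_add[symmetric] q_def)
        finally have le: "\<rho> k powr (- 2 * s) * (?i x * g (\<rho> k) x) \<le> C * (dist x y / 2) powr - q * v * \<rho> k powr q" .
        have "norm (\<rho> k powr (- 2 * s) * (?i x * g (\<rho> k) x * \<bar>Vr x * u x\<bar>))
            = \<rho> k powr (- 2 * s) * (?i x * g (\<rho> k) x) * \<bar>Vr x * u x\<bar>"
          using g0[OF x, of "\<rho> k"] by (simp add: abs_mult)
        also have "\<dots> \<le> (C * (dist x y / 2) powr - q * v * \<rho> k powr q) * \<bar>Vr x * u x\<bar>"
          by (rule mult_right_mono[OF le]) simp
        also have "\<dots> = ?c * \<rho> k powr q" by (simp only: ac_simps)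
        finally show ?case .
      qed
      have "(\<lambda>k. ?c * \<rho> k powr q) \<longlonglongrightarrow> 0"
        using tendsto_mult_left[OF pow0[OF q(1)], of ?c] by simp
      with ev show ?case by (rule Lim_null_comparison)
    qed
  qed (use iV in auto)
  have "0 < ?N / 2 - s" using dim s by simp
  hence "(\<lambda>k. (E + D * v) / 2 * \<rho> k powr (?N / 2 - s)
      + (\<integral>x. \<rho> k powr (- 2 * s) * (?i x * g (\<rho> k) x * \<bar>Vr x * u x\<bar>) \<partial>M)) \<longlonglongrightarrow> (E + D * v) / 2 * 0 + (\<integral>x. 0 \<partial>M)"
    by (intro tendsto_add tendsto_mult tendsto_const pow0 l2)
  hence "\<bar>\<alpha> y\<bar> * (c * v) \<le> (E + D * v) / 2 * 0 + (\<integral>x. 0 \<partial>M)"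
    by (rule LIMSEQ_le_const) (intro exI[of _ 0] allI impI key \<rho>)
  hence "\<bar>\<alpha> y\<bar> * (c * v) \<le> 0" by simp
  thus ?thesis using c v by (simp add: mult_le_0_iff)
qed

end

section \<open>No concentration without an atom\<close>

text \<open>A gliding hump: functions tending to \<open>0\<close> in \<open>L\<^sup>1\<close> have a subsequence that stays summable after
  multiplication with \<open>2\<^sup>j\<close>. A functional that is monotone and finite on the sum is then \<open>O(2\<^sup>-\<^sup>j)\<close> along the
  subsequence.\<close>

lemma rapid_sum:
  fixes h :: "nat \<Rightarrow> 'a \<Rightarrow> ennreal"
  assumes meas: "\<And>k. h k \<in> borel_measurable m" and lim: "(\<lambda>k. \<integral>\<^sup>+x. h k x \<partial>m) \<longlonglongrightarrow> 0"
  obtains \<kappa> where "\<And>j. j \<le> \<kappa> j" "(\<integral>\<^sup>+x. (\<Sum>j. ennreal (2 ^ j) * h (\<kappa> j) x) \<partial>m) < \<infinity>"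
proof -
  have "\<forall>j. \<exists>k. j \<le> k \<and> (\<integral>\<^sup>+x. h k x \<partial>m) < ennreal ((1 / 4) ^ j)"
  proof
    fix j :: nat
    have "eventually (\<lambda>k. (\<integral>\<^sup>+x. h k x \<partial>m) < ennreal ((1 / 4) ^ j)) sequentially"
      by (rule order_tendstoD(2)[OF lim]) simp
    hence "eventually (\<lambda>k. j \<le> k \<and> (\<integral>\<^sup>+x. h k x \<partial>m) < ennreal ((1 / 4) ^ j)) sequentially"
      using eventually_ge_at_top[of j] by eventually_elim simp
    thus "\<exists>k. j \<le> k \<and> (\<integral>\<^sup>+x. h k x \<partial>m) < ennreal ((1 / 4) ^ j)"
      by (rule eventually_happens'[rotated]) simp
  qed
  from choice[OF this] obtain \<kappa>
    where \<kappa>: "\<forall>j. j \<le> \<kappa> j \<and> (\<integral>\<^sup>+x. h (\<kappa> j) x \<partial>m) < ennreal ((1 / 4) ^ j)" by (rule exE)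
  show thesis
  proof (rule that[of \<kappa>])
    show "j \<le> \<kappa> j" for j using \<kappa> by blast
    have "(\<integral>\<^sup>+x. (\<Sum>j. ennreal (2 ^ j) * h (\<kappa> j) x) \<partial>m) = (\<Sum>j. \<integral>\<^sup>+x. ennreal (2 ^ j) * h (\<kappa> j) x \<partial>m)"
      by (intro nn_integral_suminf borel_measurable_times_ennreal borel_measurable_const meas)
    also have "\<dots> = (\<Sum>j. ennreal (2 ^ j) * (\<integral>\<^sup>+x. h (\<kappa> j) x \<partial>m))"
      by (simp only: nn_integral_cmult[OF meas])
    also have "\<dots> \<le> (\<Sum>j. ennreal ((1 / 2) ^ j))"
    proof (intro suminf_le summableI)
      fix j
      have "ennreal (2 ^ j) * (\<integral>\<^sup>+x. h (\<kappa> j) x \<partial>m) \<le> ennreal (2 ^ j) * ennreal ((1 / 4) ^ j)"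
        using \<kappa> by (intro mult_left_mono) (auto intro: less_imp_le)
      also have "\<dots> = ennreal (2 ^ j * (1 / 4) ^ j)" by (rule ennreal_mult[symmetric]) simp_all
      also have "(2::real) ^ j * (1 / 4) ^ j = (1 / 2) ^ j" by (simp flip: power_mult_distrib)
      finally show "ennreal (2 ^ j) * (\<integral>\<^sup>+x. h (\<kappa> j) x \<partial>m) \<le> ennreal ((1 / 2) ^ j)" .
    qed
    also have "\<dots> = ennreal (\<Sum>j. (1 / 2) ^ j)"
      by (intro suminf_ennreal2 summable_geometric) auto
    also have "\<dots> < \<infinity>" by simp
    finally show "(\<integral>\<^sup>+x. (\<Sum>j. ennreal (2 ^ j) * h (\<kappa> j) x) \<partial>m) < \<infinity>" .
  qed
qed

context green_setting
begin

lemma push_potential_finite: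
  assumes m: "(\<lambda>x. x) \<in> measurable m B\<Omega>" and f: "f \<in> borel_measurable m" "(\<integral>\<^sup>+x. f x \<partial>m) < \<infinity>"
  shows "AE x in M. (\<integral>\<^sup>+y. f y * G x y \<partial>m) < \<infinity>"
  using AE_integrable_G_meas[OF push_nonneg[OF m f]] AE_space[of M]
proof eventually_elim
  case (elim x)
  hence x: "x \<in> \<Omega>" by simp
  have gb: "(\<lambda>y. ennreal (G x y)) \<in> borel_measurable B\<Omega>" using G_measurable_snd(1)[OF x id_B\<Omega>] by simp
  have "(\<integral>\<^sup>+y. f y * G x y \<partial>m) = (\<integral>\<^sup>+y. ennreal (G x y) \<partial>push m f)"
    by (rule nn_integral_push[OF m f(1) gb, symmetric])
  also have "\<dots> \<le> (\<integral>\<^sup>+y. ennreal (norm (G x y)) \<partial>push m f)"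
    by (intro nn_integral_mono ennreal_leI) simp
  also have "\<dots> < \<infinity>" using elim(1) by (simp add: integrable_iff_bounded)
  finally show ?case .
qed

lemma green_meas_push_linear:
  assumes m: "(\<lambda>x. x) \<in> measurable m B\<Omega>"
    and f1: "f1 \<in> borel_measurable m" "(\<integral>\<^sup>+x. f1 x \<partial>m) < \<infinity>"
    and f2: "f2 \<in> borel_measurable m" "(\<integral>\<^sup>+x. f2 x \<partial>m) < \<infinity>"
    and f: "\<And>x. x \<in> space m \<Longrightarrow> f x = ennreal a * f1 x + ennreal b * f2 x" "f \<in> borel_measurable m"
    and ab: "0 \<le> a" "0 \<le> b"
  shows "AE x in M. green_meas G (push m f) x = a * green_meas G (push m f1) x + b * green_meas G (push m f2) x"
  using push_potential_finite[OF m f1] push_potential_finite[OF m f2] AE_space[of M]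
proof eventually_elim
  case (elim x)
  hence x: "x \<in> \<Omega>" by simp
  have gm: "(\<lambda>y. ennreal (G x y)) \<in> borel_measurable m" using G_measurable_snd(1)[OF x m] by simp
  have "(\<integral>\<^sup>+y. f y * G x y \<partial>m) = (\<integral>\<^sup>+y. ennreal a * (f1 y * G x y) + ennreal b * (f2 y * G x y) \<partial>m)"
    by (intro nn_integral_cong) (simp add: f(1) algebra_simps)
  also have "\<dots> = ennreal a * (\<integral>\<^sup>+y. f1 y * G x y \<partial>m) + ennreal b * (\<integral>\<^sup>+y. f2 y * G x y \<partial>m)"
    using f1 f2 gm by (simp add: nn_integral_add nn_integral_cmult)
  finally have "enn2real (\<integral>\<^sup>+y. f y * G x y \<partial>m)
      = enn2real (ennreal a * (\<integral>\<^sup>+y. f1 y * G x y \<partial>m)) + enn2real (ennreal b * (\<integral>\<^sup>+y. f2 y * G x y \<partial>m))"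
    using elim by (simp add: enn2real_plus ennreal_mult_less_top)
  thus ?case using ab
    by (simp add: green_meas_push[OF m f1(1) x] green_meas_push[OF m f2(1) x] green_meas_push[OF m f(2) x] enn2real_mult)
qed

lemma green_meas_eq_push:
  assumes "\<nu> \<in> nonneg_measures \<Omega>" "x \<in> \<Omega>"
  shows "green_meas G (push \<nu> (\<lambda>_. 1)) x = green_meas G \<nu> x"
proof -
  note n = nonneg_measuresD[OF assms(1)]
  have "green_meas G \<nu> x = enn2real (\<integral>\<^sup>+y. G x y \<partial>\<nu>)"
    unfolding green_meas_def
    using G_measurable_snd(1)[OF assms(2) n(4)] assms(2) G_nonneg n(2)
    by (intro integral_eq_nn_integral AE_I2) auto
  thus ?thesis using green_meas_push[OF n(4), of "\<lambda>_. 1" x] assms(2) by simp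
qed

lemma green_meas_push_real:
  assumes f: "integrable M f" "\<And>x. x \<in> \<Omega> \<Longrightarrow> 0 \<le> f x" and x: "x \<in> \<Omega>"
  shows "green_meas G (push M (\<lambda>x. ennreal (f x))) x = \<G> f x"
proof -
  have fm: "f \<in> borel_measurable M" by (rule borel_measurable_integrable[OF f(1)])
  have "\<G> f x = enn2real (\<integral>\<^sup>+y. ennreal (G x y * f y) \<partial>M)"
    unfolding green_fun_def using fm G_measurable_snd(1)[OF x id_M] f(2) G_nonneg x
    by (intro integral_eq_nn_integral AE_I2) auto
  also have "(\<integral>\<^sup>+y. ennreal (G x y * f y) \<partial>M) = (\<integral>\<^sup>+y. ennreal (f y) * ennreal (G x y) \<partial>M)"
    using f(2) G_nonneg x by (intro nn_integral_cong) (simp add: ennreal_mult mult.commute)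
  finally show ?thesis using green_meas_push[OF id_M, of "\<lambda>x. ennreal (f x)" x] fm x by simp
qed

lemma green_fun_L1:
  assumes f: "integrable M f"
  shows "(\<integral>x. \<bar>\<G> f x\<bar> \<partial>M) \<le> C1 * (\<integral>x. \<bar>f x\<bar> \<partial>M)"
proof -
  define \<psi> where "\<psi> x = sgn (\<G> f x)" for x
  have \<psi>m: "\<psi> \<in> borel_measurable M" unfolding \<psi>_def using borel_measurable_integrable[OF integrable_green_fun[OF f]] by measurable
  have \<psi>b: "\<bar>\<psi> x\<bar> \<le> 1" for x by (simp add: \<psi>_def sgn_if)
  note gc = green_fun_continuous[OF \<psi>m \<psi>b] and gb = green_fun_bounded[OF _ \<psi>m \<psi>b]
  have "(\<integral>x. \<bar>\<G> f x\<bar> \<partial>M) = (\<integral>x. \<psi> x * \<G> f x \<partial>M)"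
    by (simp add: \<psi>_def abs_sgn mult.commute)
  also have "\<dots> = (\<integral>x. \<G> \<psi> x * f x \<partial>M)" by (rule green_fun_pairing[OF f \<psi>m \<psi>b])
  also have "\<dots> \<le> (\<integral>x. C1 * \<bar>f x\<bar> \<partial>M)"
  proof (rule integral_mono)
    show "integrable M (\<lambda>x. \<G> \<psi> x * f x)" by (rule integrable_bounded_times[OF gc(2) gb f])
    show "integrable M (\<lambda>x. C1 * \<bar>f x\<bar>)" using f by simp
    fix x assume "x \<in> space M"
    hence "\<bar>\<G> \<psi> x\<bar> \<le> C1" using gb[of x] by simp
    from mult_right_mono[OF this, of "\<bar>f x\<bar>"]
    have "\<bar>\<G> \<psi> x * f x\<bar> \<le> C1 * \<bar>f x\<bar>" by (simp only: abs_mult abs_ge_zero)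
    thus "\<G> \<psi> x * f x \<le> C1 * \<bar>f x\<bar>" by linarith
  qed
  finally show ?thesis by simp
qed

end

context reduction_setting
begin

text \<open>Let \<open>h\<^sub>j\<close> be indicators of balls about \<open>y\<close> whose \<open>\<nu>\<close>-mass decreases rapidly. Removing the part of \<open>\<nu>\<close> outside a ball
  does not change the coefficient at \<open>y\<close>, so \<open>\<nu>\<close> and \<open>h\<^sub>j \<nu>\<close> have the same one. The measure \<open>F \<nu>\<close> with
  \<open>F = \<Sum>j. 2\<^sup>j h\<^sub>j\<close> dominates \<open>2\<^sup>j h\<^sub>j \<nu>\<close>, and coefficients are nonnegative and additive, so
  \<open>2\<^sup>j \<alpha> y\<close> is at most the coefficient of \<open>F \<nu>\<close>, for every \<open>j\<close>.\<close>

lemma coefficient_zero_no_atom: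
  assumes red: "reduces \<nu> w u \<alpha>" and y: "y \<in> S" and atom: "emeasure \<nu> {y} = 0"
  shows "\<alpha> y = 0"
proof -
  note \<nu> = red_nonneg[OF red]
  note n = nonneg_measuresD[OF \<nu>]
  interpret \<nu>: finite_measure \<nu> by (rule n)
  have y\<Omega>: "y \<in> \<Omega>" using y S by auto
  define b where "b k = \<Omega> \<inter> ball y (1 / real (Suc k))" for k
  have bs: "b k \<in> sets \<nu>" for k by (auto simp: b_def n(1) sets_restrict_space)
  define h :: "nat \<Rightarrow> real^'n \<Rightarrow> ennreal" where "h k = indicator (b k)" for k
  have hm: "h k \<in> borel_measurable \<nu>" for k unfolding h_def using bs by simp
  have "(\<lambda>k. emeasure \<nu> (b k)) \<longlonglongrightarrow> emeasure \<nu> (\<Inter>k. b k)"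
  proof (rule Lim_emeasure_decseq)
    show "range b \<subseteq> sets \<nu>" using bs by auto
    show "decseq b"
    proof (rule decseq_SucI)
      fix k
      have "1 / real (Suc (Suc k)) \<le> 1 / real (Suc k)" by (intro divide_left_mono) auto
      thus "b (Suc k) \<subseteq> b k" by (auto simp: b_def)
    qed
  qed simp
  also have "(\<Inter>k. b k) = {y}"
  proof (intro equalityI subsetI)
    fix x assume x: "x \<in> (\<Inter>k. b k)"
    show "x \<in> {y}"
    proof (rule ccontr)
      assume "x \<notin> {y}"
      hence "0 < dist y x" by simp
      then obtain k where "1 / real (Suc k) < dist y x" by (rule nat_approx_posE)
      moreover have "x \<in> b k" using x by blast
      ultimately show False by (simp add: b_def)
    qed
  qed (use y\<Omega> in \<open>auto simp: b_def\<close>)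
  finally have "(\<lambda>k. \<integral>\<^sup>+x. h k x \<partial>\<nu>) \<longlonglongrightarrow> 0"
    unfolding h_def using bs atom by simp
  with hm obtain \<kappa> where \<kappa>: "\<And>j. j \<le> \<kappa> j" "(\<integral>\<^sup>+x. (\<Sum>j. ennreal (2 ^ j) * h (\<kappa> j) x) \<partial>\<nu>) < \<infinity>"
    by (rule rapid_sum) (rule that)
  define F where "F x = (\<Sum>j. ennreal (2 ^ j) * h (\<kappa> j) x)" for x
  have Fm: "F \<in> borel_measurable \<nu>"
    unfolding F_def[abs_def] by (intro borel_measurable_suminf_order borel_measurable_times_ennreal borel_measurable_const hm)
  have Ff: "(\<integral>\<^sup>+x. F x \<partial>\<nu>) < \<infinity>" using \<kappa>(2) by (simp only: F_def)
  from ex_reduces[OF push_nonneg[OF n(4) Fm Ff]] obtain wF uF aF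
    where redF: "reduces (push \<nu> F) wF uF aF" by (elim exE)
  have hle: "h k x \<le> 1" for k x by (simp add: h_def indicator_def)
  have one: "(\<integral>\<^sup>+x. 1 \<partial>\<nu>) < \<infinity>" by (simp add: less_top[symmetric])
  have hf: "(\<integral>\<^sup>+x. h k x \<partial>\<nu>) < \<infinity>" for k
    by (rule le_less_trans[OF nn_integral_mono[OF hle] one])
  have bound: "2 ^ j * \<alpha> y \<le> aF y" for j
  proof -
    let ?k = "\<kappa> j"
    let ?co = "\<lambda>x. 1 - h ?k x" and ?rest = "\<lambda>x. F x - ennreal (2 ^ j) * h ?k x"
    have com: "?co \<in> borel_measurable \<nu>" using hm by simp
    have restm: "?rest \<in> borel_measurable \<nu>" using Fm hm by simp
    have cof: "(\<integral>\<^sup>+x. ?co x \<partial>\<nu>) < \<infinity>"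
      by (rule le_less_trans[OF nn_integral_mono one]) (rule diff_le_self_ennreal)
    have restf: "(\<integral>\<^sup>+x. ?rest x \<partial>\<nu>) < \<infinity>"
      by (rule le_less_trans[OF nn_integral_mono Ff]) (rule diff_le_self_ennreal)
    from ex_reduces[OF push_nonneg[OF n(4) hm[of "\<kappa> j"] hf[of "\<kappa> j"]]] obtain wh uh ah
      where redh: "reduces (push \<nu> (h ?k)) wh uh ah" by (elim exE)
    from ex_reduces[OF push_nonneg[OF n(4) com cof]] obtain wc uc ac
      where redc: "reduces (push \<nu> ?co) wc uc ac" by (elim exE)
    from ex_reduces[OF push_nonneg[OF n(4) restm restf]] obtain wr ur ar
      where redr: "reduces (push \<nu> ?rest) wr ur ar" by (elim exE)
    have c1: "AE x in M. green_meas G \<nu> x = 1 * green_meas G (push \<nu> (h ?k)) x + 1 * green_meas G (push \<nu> ?co) x"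
    proof -
      have "AE x in M. green_meas G (push \<nu> (\<lambda>_. 1)) x = 1 * green_meas G (push \<nu> (h ?k)) x + 1 * green_meas G (push \<nu> ?co) x"
        by (rule green_meas_push_linear[OF n(4) hm hf com cof]) (use hle in \<open>auto simp: add_diff_inverse_ennreal\<close>)
      thus ?thesis using AE_space[of M] by eventually_elim (simp add: green_meas_eq_push[OF \<nu>])
    qed
    have c2: "AE x in M. green_meas G (push \<nu> F) x = 2 ^ j * green_meas G (push \<nu> (h ?k)) x + 1 * green_meas G (push \<nu> ?rest) x"
    proof (rule green_meas_push_linear[OF n(4) hm hf restm restf])
      fix x
      have "ennreal (2 ^ j) * h ?k x \<le> F x" unfolding F_def by (rule ennreal_le_suminf)
      thus "F x = ennreal (2 ^ j) * h ?k x + ennreal 1 * ?rest x" by (simp add: add_diff_inverse_ennreal)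
    qed (use Fm in auto)
    have "AE x in push \<nu> ?co. x \<notin> ball y (1 / real (Suc ?k))"
    proof -
      have "(\<integral>\<^sup>+x. indicator (b ?k) x \<partial>push \<nu> ?co) = (\<integral>\<^sup>+x. ?co x * indicator (b ?k) x \<partial>\<nu>)"
        using bs n(1) by (intro nn_integral_push[OF n(4) com]) simp
      also have "\<dots> = (\<integral>\<^sup>+x. 0 \<partial>\<nu>)" by (intro nn_integral_cong) (simp add: h_def indicator_def)
      finally have "emeasure (push \<nu> ?co) (b ?k) = 0" using bs n(1) by (simp add: push_def)
      hence "b ?k \<in> null_sets (push \<nu> ?co)" using bs n(1) by (simp add: null_sets_def push_def)
      hence "AE x in push \<nu> ?co. x \<notin> b ?k" by (rule AE_not_in)
      thus ?thesis using AE_space[of "push \<nu> ?co"]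
        by eventually_elim (auto simp: b_def push_def)
    qed
    hence "ac y = 0" by (rule coefficient_zero_off_support[OF redc y, rotated]) simp
    hence "\<alpha> y = ah y" using coefficient_linear[OF redh redc red c1 y] by simp
    moreover have "aF y = 2 ^ j * ah y + 1 * ar y" by (rule coefficient_linear[OF redh redr redF c2 y])
    ultimately show ?thesis using coefficient_nonneg[OF redr y] by simp
  qed
  have "\<alpha> y \<le> 0"
  proof (rule ccontr)
    assume "\<not> \<alpha> y \<le> 0"
    hence pos: "0 < \<alpha> y" by simp
    obtain j where "aF y / \<alpha> y < 2 ^ j" using real_arch_pow[of 2 "aF y / \<alpha> y"] by auto
    hence "aF y < 2 ^ j * \<alpha> y" using pos by (simp add: field_simps)
    thus False using bound[of j] by simp
  qed
  thus ?thesis using coefficient_nonneg[OF red y] by simp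
qed

section \<open>Stability\<close>

text \<open>The family increases with \<open>\<epsilon>\<close>, and as \<open>\<epsilon> \<rightarrow> \<infinity>\<close> the truncated potential \<open>T \<epsilon> \<le> 1 / \<epsilon>\<close> disappears, so that \<open>w \<epsilon>\<close>
  tends to \<open>G \<nu>\<close>. The constant \<open>2 * C1\<close> is where the perturbation \<open>\<G> (T \<epsilon> * w \<epsilon>)\<close> has norm at most half that of \<open>w \<epsilon>\<close>.\<close>

lemma red_le_green:
  assumes red: "reduces \<nu> w u \<alpha>" and e: "0 < \<epsilon>"
  shows "AE x in M. w \<epsilon> x \<le> green_meas G \<nu> x"
proof -
  note im = integrable_green_meas[OF red_nonneg[OF red]]
  let ?A = "\<integral>x. \<bar>green_meas G \<nu> x\<bar> \<partial>M" and ?d = "\<lambda>x. max 0 (w \<epsilon> x - green_meas G \<nu> x)"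
  have id: "integrable M ?d" using red_w(1)[OF red e] im by auto
  have bound: "(\<integral>x. ?d x \<partial>M) \<le> (2 * ?A * C1) * (1 / real (Suc k))" if k: "\<epsilon> \<le> real (Suc k)" "2 * C1 \<le> real (Suc k)" for k
  proof -
    define t where "t = real (Suc k)"
    have t: "0 < t" "\<epsilon> \<le> t" "2 * C1 \<le> t" using k by (auto simp: t_def)
    note iw = red_w[OF red t(1)]
    have Tw: "(\<integral>x. \<bar>T t x * w t x\<bar> \<partial>M) \<le> 1 / t * (\<integral>x. \<bar>w t x\<bar> \<partial>M)"
    proof -
      have "(\<integral>x. \<bar>T t x * w t x\<bar> \<partial>M) \<le> (\<integral>x. 1 / t * \<bar>w t x\<bar> \<partial>M)"
      proof (rule integral_mono)
        show "\<bar>T t x * w t x\<bar> \<le> 1 / t * \<bar>w t x\<bar>" for x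
          unfolding abs_mult using T_nonneg[of t x] T_le[OF t(1), of x] by (intro mult_right_mono) auto
      qed (use iw in auto)
      thus ?thesis by simp
    qed
    let ?g = "\<G> (\<lambda>y. T t y * w t y)"
    note ig = integrable_green_fun[OF iw(2)]
    have "(\<integral>x. \<bar>?g x\<bar> \<partial>M) \<le> C1 * (\<integral>x. \<bar>T t x * w t x\<bar> \<partial>M)" by (rule green_fun_L1[OF iw(2)])
    also have "\<dots> \<le> C1 * (1 / t * (\<integral>x. \<bar>w t x\<bar> \<partial>M))" by (intro mult_left_mono Tw) (use C1(1) in simp)
    finally have g: "(\<integral>x. \<bar>?g x\<bar> \<partial>M) \<le> C1 / t * (\<integral>x. \<bar>w t x\<bar> \<partial>M)" by simp
    have "(\<integral>x. \<bar>w t x\<bar> \<partial>M) \<le> (\<integral>x. \<bar>green_meas G \<nu> x\<bar> + \<bar>?g x\<bar> \<partial>M)"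
    proof (rule integral_mono_AE)
      show "AE x in M. \<bar>w t x\<bar> \<le> \<bar>green_meas G \<nu> x\<bar> + \<bar>?g x\<bar>"
        using iw(3) by eventually_elim linarith
    qed (use iw im ig in auto)
    also have "\<dots> = ?A + (\<integral>x. \<bar>?g x\<bar> \<partial>M)" using im ig by simp
    also have "\<dots> \<le> ?A + C1 / t * (\<integral>x. \<bar>w t x\<bar> \<partial>M)" using g by simp
    also have "C1 / t * (\<integral>x. \<bar>w t x\<bar> \<partial>M) \<le> 1 / 2 * (\<integral>x. \<bar>w t x\<bar> \<partial>M)"
      using t by (intro mult_right_mono Bochner_Integration.integral_nonneg) (auto simp: field_simps)
    finally have w: "(\<integral>x. \<bar>w t x\<bar> \<partial>M) \<le> 2 * ?A" by simp
    have "(\<integral>x. ?d x \<partial>M) \<le> (\<integral>x. \<bar>?g x\<bar> \<partial>M)"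
    proof (rule integral_mono_AE[OF id])
      show "AE x in M. ?d x \<le> \<bar>?g x\<bar>"
        using iw(3) red_mono[OF red e t(2)] by eventually_elim linarith
    qed (use ig in auto)
    also have "\<dots> \<le> C1 / t * (2 * ?A)"
      by (rule order_trans[OF g mult_left_mono[OF w]]) (use C1(1) t in simp)
    finally show ?thesis by (simp add: t_def ac_simps)
  qed
  have ev: "eventually (\<lambda>k. (\<integral>x. ?d x \<partial>M) \<le> (2 * ?A * C1) * (1 / real (Suc k))) sequentially"
  proof -
    obtain k0 :: nat where k0: "max \<epsilon> (2 * C1) \<le> real k0" using real_arch_simple by blast
    show ?thesis using eventually_ge_at_top[of k0]
    proof eventually_elim
      case (elim k)
      hence "max \<epsilon> (2 * C1) \<le> real (Suc k)" using k0 by linarith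
      thus ?case by (intro bound) auto
    qed
  qed
  have "(\<lambda>k. (2 * ?A * C1) * (1 / real (Suc k))) \<longlonglongrightarrow> (2 * ?A * C1) * 0"
    by (intro tendsto_mult tendsto_const LIMSEQ_Suc[OF lim_const_over_n])
  from tendsto_lowerbound[OF this ev] have "(\<integral>x. ?d x \<partial>M) \<le> 0" by simp
  moreover have "0 \<le> (\<integral>x. ?d x \<partial>M)" by (rule Bochner_Integration.integral_nonneg) simp
  ultimately have "AE x in M. ?d x = 0"
    using id by (subst integral_nonneg_eq_0_iff_AE[symmetric]) auto
  thus ?thesis by eventually_elim (simp add: max_def split: if_splits)
qed

text \<open>By linearity, \<open>2\<^sup>j w\<close> is the solution for \<open>F\<close>, which is at least \<open>uF\<close>, minus the solution for the rest
  of \<open>F\<close>, which is at most its potential. Hence \<open>2\<^sup>j w\<close> lies between \<open>uF - G F\<close> and \<open>G F\<close>.\<close>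

lemma family_small_if_dominated:
  assumes m: "(\<lambda>x. x) \<in> measurable m B\<Omega>"
    and F: "F \<in> borel_measurable m" "(\<integral>\<^sup>+x. F x \<partial>m) < \<infinity>" and redF: "reduces (push m F) wF uF aF"
    and f: "f \<in> borel_measurable m" "\<And>x. ennreal (2 ^ j) * f x \<le> F x"
    and red: "reduces (push m f) w u \<alpha>" and e: "0 < \<epsilon>"
  shows "(\<integral>\<^sup>+x. f x \<partial>m) < \<infinity> \<Longrightarrow> AE x in M. \<bar>w \<epsilon> x\<bar> \<le> (1 / 2) ^ j * (green_meas G (push m F) x + \<bar>uF x\<bar>)"
proof -
  assume ff: "(\<integral>\<^sup>+x. f x \<partial>m) < \<infinity>"
  let ?rest = "\<lambda>x. F x - ennreal (2 ^ j) * f x"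
  have restm: "?rest \<in> borel_measurable m" using F f by simp
  have restf: "(\<integral>\<^sup>+x. ?rest x \<partial>m) < \<infinity>"
    by (rule le_less_trans[OF nn_integral_mono F(2)]) (rule diff_le_self_ennreal)
  from ex_reduces[OF push_nonneg[OF m restm restf]] obtain wr ur ar
    where redr: "reduces (push m ?rest) wr ur ar" by (elim exE)
  have lin: "AE x in M. green_meas G (push m F) x = 2 ^ j * green_meas G (push m f) x + 1 * green_meas G (push m ?rest) x"
    by (rule green_meas_push_linear[OF m f(1) ff restm restf])
      (use F f(2) in \<open>auto simp: add_diff_inverse_ennreal\<close>)
  show ?thesis
    using lin family_linear[OF red redr redF lin e] red_le_green[OF red e] red_le_green[OF redr e]
      red_le[OF redF e] AE_space[of M]
  proof eventually_elim
    case (elim x)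
    hence x: "x \<in> \<Omega>" by simp
    have g: "0 \<le> green_meas G (push m f) x" "0 \<le> green_meas G (push m ?rest) x"
      by (rule green_meas_nonneg[OF red_nonneg[OF red] x], rule green_meas_nonneg[OF red_nonneg[OF redr] x])
    let ?P = "(2::real) ^ j"
    have P: "0 < ?P" by simp
    have "?P * w \<epsilon> x \<le> ?P * green_meas G (push m f) x" using elim(3) by (intro mult_left_mono) auto
    hence u1: "?P * w \<epsilon> x \<le> green_meas G (push m F) x + \<bar>uF x\<bar>" using elim(1) g by linarith
    have "0 \<le> ?P * green_meas G (push m f) x" using g by simp
    hence u2: "- (green_meas G (push m F) x + \<bar>uF x\<bar>) \<le> ?P * w \<epsilon> x" using elim(1,2,4,5) by linarith
    have "\<bar>?P * w \<epsilon> x\<bar> \<le> green_meas G (push m F) x + \<bar>uF x\<bar>" using u1 u2 by linarith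
    hence "?P * \<bar>w \<epsilon> x\<bar> \<le> green_meas G (push m F) x + \<bar>uF x\<bar>" by (simp add: abs_mult)
    from mult_left_mono[OF this, of "(1 / 2) ^ j"]
    have "(1 / 2) ^ j * ?P * \<bar>w \<epsilon> x\<bar> \<le> (1 / 2) ^ j * (green_meas G (push m F) x + \<bar>uF x\<bar>)" by simp
    moreover have "(1 / 2) ^ j * ?P = 1" by (simp flip: power_mult_distrib)
    ultimately show ?case by simp
  qed
qed

text \<open>Since \<open>V v = T \<epsilon> * v + (V - T \<epsilon>) * v\<close>, the difference \<open>w \<epsilon> - v\<close> is the truncated solution whose datum is
  \<open>(V - T \<epsilon>) * v\<close>. This datum tends to \<open>0\<close> in \<open>L\<^sup>1\<close>. Its positive and negative parts are nonnegative measures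
  below the terms of a rapid sum \<open>F\<close>, along a sequence of values of \<open>\<epsilon>\<close>; hence their solutions tend to \<open>0\<close>.\<close>

lemma stability:
  assumes red: "reduces \<nu> w u \<alpha>" and v: "sol Vr (green_meas G \<nu>) v"
  shows "AE x in M. u x = v x"
proof -
  have iv: "integrable M v" and iVv: "integrable M (\<lambda>x. Vr x * v x)"
    and veq: "AE x in M. v x = green_meas G \<nu> x - \<G> (\<lambda>y. Vr y * v y) x"
    using v by (auto simp: sol_def)
  have vm: "v \<in> borel_measurable M" by (rule borel_measurable_integrable[OF iv])
  define ek where "ek k = 1 / real (Suc k)" for k
  have ek: "0 < ek k" for k by (simp add: ek_def)
  define d where "d k x = max 0 (Vr x - T (ek k) x)" for k x
  have dm: "d k \<in> borel_measurable M" for k unfolding d_def by measurable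
  have dle: "0 \<le> d k x" "d k x \<le> Vr x" for k x using T_nonneg[of "ek k" x] by (auto simp: d_def)
  define h where "h k x = ennreal (d k x * \<bar>v x\<bar>)" for k x
  have hm: "h k \<in> borel_measurable M" for k unfolding h_def[abs_def] using dm vm by simp
  have "(\<lambda>k. \<integral>\<^sup>+x. h k x \<partial>M) \<longlonglongrightarrow> (\<integral>\<^sup>+x. 0 \<partial>M)"
  proof (rule nn_integral_dominated_convergence[where w = "\<lambda>x. ennreal \<bar>Vr x * v x\<bar>"])
    show "AE x in M. h k x \<le> ennreal \<bar>Vr x * v x\<bar>" for k
      unfolding h_def using dle by (intro AE_I2 ennreal_leI) (simp add: abs_mult mult_right_mono)
    show "(\<integral>\<^sup>+x. ennreal \<bar>Vr x * v x\<bar> \<partial>M) < \<infinity>" using iVv by (simp add: integrable_iff_bounded)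
    show "AE x in M. (\<lambda>k. h k x) \<longlonglongrightarrow> 0"
      using V_finite
    proof eventually_elim
      case (elim x)
      obtain k0 :: nat where k0: "Vr x \<le> real k0" using real_arch_simple by blast
      have "h k x = 0" if "k0 \<le> k" for k
      proof -
        have "V x = ennreal (Vr x)" using elim by simp
        also have "\<dots> \<le> ennreal (1 / ek k)" using k0 that by (intro ennreal_leI) (simp add: ek_def)
        finally have "T (ek k) x = Vr x" by (rule T_eq)
        thus ?thesis by (simp add: h_def d_def)
      qed
      hence "eventually (\<lambda>k. h k x = 0) sequentially" unfolding eventually_sequentially by blast
      thus ?case by (rule tendsto_eventually)
    qed
  qed (use hm iVv vm in auto)
  hence lim: "(\<lambda>k. \<integral>\<^sup>+x. h k x \<partial>M) \<longlonglongrightarrow> 0" by simp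
  obtain \<kappa> where \<kappa>: "\<And>j. j \<le> \<kappa> j" "(\<integral>\<^sup>+x. (\<Sum>j. ennreal (2 ^ j) * h (\<kappa> j) x) \<partial>M) < \<infinity>"
    by (rule rapid_sum[OF hm lim]) (rule that)
  define F where "F x = (\<Sum>j. ennreal (2 ^ j) * h (\<kappa> j) x)" for x
  have Fm: "F \<in> borel_measurable M"
    unfolding F_def[abs_def] by (intro borel_measurable_suminf_order borel_measurable_times_ennreal borel_measurable_const hm)
  have Ff: "(\<integral>\<^sup>+x. F x \<partial>M) < \<infinity>" using \<kappa>(2) by (simp only: F_def)
  from ex_reduces[OF push_nonneg[OF id_M Fm Ff]] obtain wF uF aF
    where redF: "reduces (push M F) wF uF aF" by (elim exE)
  define H where "H x = green_meas G (push M F) x + \<bar>uF x\<bar>" for x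
  have iH: "integrable M H" unfolding H_def[abs_def]
    using integrable_green_meas[OF red_nonneg[OF redF]] red_integrable[OF redF] by auto
  have close: "AE x in M. \<bar>w (ek (\<kappa> j)) x - v x\<bar> \<le> 2 * (1 / 2) ^ j * H x" for j
  proof -
    let ?k = "\<kappa> j"
    let ?e = "ek ?k"
    \<comment> \<open>For \<open>\<sigma> = \<plusminus>1\<close> these are the positive and negative parts of \<open>(V - T \<epsilon>) * v\<close>.\<close>
    define fp where "fp \<sigma> x = d ?k x * max 0 (\<sigma> * v x)" for \<sigma> x
    have fpm: "fp \<sigma> \<in> borel_measurable M" for \<sigma> unfolding fp_def[abs_def] using dm vm by simp
    have fp0: "0 \<le> fp \<sigma> x" for \<sigma> x using dle by (simp add: fp_def)
    have fple: "fp \<sigma> x \<le> d ?k x * \<bar>v x\<bar>" if "\<bar>\<sigma>\<bar> = 1" for \<sigma> x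
      unfolding fp_def using dle that by (intro mult_left_mono) (auto simp: abs_if split: if_splits)
    have fpV: "\<bar>fp \<sigma> x\<bar> \<le> \<bar>Vr x * v x\<bar>" if "\<bar>\<sigma>\<bar> = 1" for \<sigma> x
    proof -
      have "d ?k x * \<bar>v x\<bar> \<le> Vr x * \<bar>v x\<bar>" using dle by (intro mult_right_mono) auto
      thus ?thesis using fple[OF that, of x] fp0[of \<sigma> x] by (simp add: abs_mult)
    qed
    have ifp: "integrable M (fp \<sigma>)" if "\<bar>\<sigma>\<bar> = 1" for \<sigma>
      by (rule Bochner_Integration.integrable_bound[OF iVv fpm]) (use fpV[OF that] in \<open>auto intro!: AE_I2\<close>)
    have fm: "(\<lambda>x. ennreal (fp \<sigma> x)) \<in> borel_measurable M" for \<sigma> using fpm by simp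
    have ff: "(\<integral>\<^sup>+x. ennreal (fp \<sigma> x) \<partial>M) < \<infinity>" if "\<bar>\<sigma>\<bar> = 1" for \<sigma>
      using ifp[OF that] fp0 by (simp add: integrable_iff_bounded)
    have fF: "ennreal (2 ^ j) * ennreal (fp \<sigma> x) \<le> F x" if "\<bar>\<sigma>\<bar> = 1" for \<sigma> x
    proof -
      have "ennreal (2 ^ j) * ennreal (fp \<sigma> x) \<le> ennreal (2 ^ j) * h ?k x"
        unfolding h_def using fple[OF that] by (intro mult_left_mono ennreal_leI) auto
      also have "\<dots> \<le> F x" unfolding F_def by (rule ennreal_le_suminf)
      finally show ?thesis .
    qed
    have s1: "\<bar>1::real\<bar> = 1" "\<bar>- 1::real\<bar> = 1" by auto
    from ex_reduces[OF push_nonneg[OF id_M fm ff[OF s1(1)]]] obtain wp up ap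
      where redp: "reduces (push M (\<lambda>x. ennreal (fp 1 x))) wp up ap" by (elim exE)
    from ex_reduces[OF push_nonneg[OF id_M fm ff[OF s1(2)]]] obtain wn un an
      where redn: "reduces (push M (\<lambda>x. ennreal (fp (- 1) x))) wn un an" by (elim exE)
    note sp = family_small_if_dominated[OF id_M Fm Ff redF fm fF[OF s1(1)] redp ek[of "\<kappa> j"] ff[OF s1(1)], folded H_def]
    note sn = family_small_if_dominated[OF id_M Fm Ff redF fm fF[OF s1(2)] redn ek[of "\<kappa> j"] ff[OF s1(2)], folded H_def]
    have iTv: "integrable M (\<lambda>x. T ?e x * v x)"
      by (rule integrable_bounded_times[OF T_measurable _ iv, of _ "1 / ?e"])
        (use T_nonneg[of ?e] T_le[OF ek, of ?k] in auto)
    have gp: "green_meas G (push M (\<lambda>x. ennreal (fp \<sigma> x))) x = \<G> (fp \<sigma>) x"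
      if "\<bar>\<sigma>\<bar> = 1" "x \<in> \<Omega>" for \<sigma> x
      by (rule green_meas_push_real[OF ifp[OF that(1)] fp0 that(2)])
    have Vsplit: "AE x in M. Vr x * v x = 1 * (T ?e x * v x) + 1 * (1 * fp 1 x + (- 1) * fp (- 1) x)"
      using V_finite
    proof eventually_elim
      case (elim x)
      have "fp 1 x - fp (- 1) x = d ?k x * (max 0 (v x) - max 0 (- v x))"
        by (simp add: fp_def right_diff_distrib)
      also have "max 0 (v x) - max 0 (- v x) = v x" by simp
      also have "d ?k x = Vr x - T ?e x" using T_le_V[OF elim, of ?e] by (simp add: d_def)
      finally show ?case by (simp add: left_diff_distrib)
    qed
    let ?pv = "\<lambda>x. 1 * (1 * green_meas G \<nu> x + (- 1) * green_meas G (push M (\<lambda>x. ennreal (fp 1 x))) x)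
        + 1 * green_meas G (push M (\<lambda>x. ennreal (fp (- 1) x))) x"
    have ipn: "integrable M (\<lambda>x. 1 * fp 1 x + (- 1) * fp (- 1) x)" using ifp[OF s1(1)] ifp[OF s1(2)] by simp
    have combine: "r = 1 * (1 * p + - 1 * a) + 1 * b - t"
      if "r = p - A" "A = B" "B = 1 * t + 1 * D" "D = 1 * a + - 1 * b" for r p A B t D a b :: real
      using that by simp
    have solv: "sol (T ?e) ?pv v"
      unfolding sol_def
    proof (intro conjI iv iTv)
      show "AE x in M. v x = ?pv x - \<G> (\<lambda>y. T ?e y * v y) x"
        using veq green_fun_add_AE[OF iTv ipn, of 1 1]
          green_fun_add_AE[OF ifp[OF s1(1)] ifp[OF s1(2)], of 1 "- 1"] AE_space[of M]
      proof eventually_elim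
        case (elim x)
        hence x: "x \<in> \<Omega>" by simp
        have "\<G> (\<lambda>y. Vr y * v y) x
            = \<G> (\<lambda>y. 1 * (T ?e y * v y) + 1 * (1 * fp 1 y + (- 1) * fp (- 1) y)) x"
          by (rule green_fun_cong_AE[OF _ _ Vsplit x])
            (use borel_measurable_integrable[OF iVv] borel_measurable_integrable[OF iTv] fpm in auto)
        thus ?case unfolding gp[OF s1(1) x] gp[OF s1(2) x] by (rule combine[OF elim(1) _ elim(2) elim(3)])
      qed
    qed
    have solw: "sol (T ?e) ?pv (\<lambda>x. 1 * (1 * w ?e x + (- 1) * wp ?e x) + 1 * wn ?e x)"
      by (intro sol_add red_sol[OF red ek] red_sol[OF redp ek] red_sol[OF redn ek])
    have "AE x in M. v x = 1 * (1 * w ?e x + (- 1) * wp ?e x) + 1 * wn ?e x"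
      by (rule sol_unique[OF T_measurable T_nonneg T_le[OF ek] solv solw]) simp
    thus ?thesis using sp sn
    proof eventually_elim
      case (elim x)
      have "v x = w ?e x - wp ?e x + wn ?e x" using elim(1) by simp
      hence "\<bar>w ?e x - v x\<bar> \<le> \<bar>wp ?e x\<bar> + \<bar>wn ?e x\<bar>" by linarith
      also have "\<dots> \<le> (1 / 2) ^ j * H x + (1 / 2) ^ j * H x" using elim(2,3) by (rule add_mono)
      also have "\<dots> = 2 * (1 / 2) ^ j * H x" by (simp only: mult_2 distrib_right)
      finally show ?case .
    qed
  qed
  have seq: "filterlim (\<lambda>j. ek (\<kappa> j)) (at_right 0) sequentially"
  proof (rule tendsto_imp_filterlim_at_right)
    show "eventually (\<lambda>j. 0 < ek (\<kappa> j)) sequentially"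
      by (intro always_eventually allI ek)
    show "(\<lambda>j. ek (\<kappa> j)) \<longlonglongrightarrow> 0"
    proof (rule tendsto_sandwich[OF _ _ tendsto_const LIMSEQ_Suc[OF lim_const_over_n[of 1]]])
      show "eventually (\<lambda>j. 0 \<le> ek (\<kappa> j)) sequentially" by (simp add: ek_def)
      show "eventually (\<lambda>j. ek (\<kappa> j) \<le> 1 / real (Suc j)) sequentially"
        using \<kappa>(1) by (intro always_eventually allI) (auto simp: ek_def intro!: divide_left_mono)
    qed
  qed
  have l1: "(\<lambda>j. \<integral>x. \<bar>w (ek (\<kappa> j)) x - u x\<bar> \<partial>M) \<longlonglongrightarrow> 0"
    by (rule filterlim_compose[OF red_lim[OF red] seq])
  have l2: "(\<lambda>j. (1 / 2) ^ j * (2 * (\<integral>x. H x \<partial>M)) ) \<longlonglongrightarrow> 0 * (2 * (\<integral>x. H x \<partial>M))"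
    by (intro tendsto_mult tendsto_const LIMSEQ_power_zero) simp
  have iuv: "integrable M (\<lambda>x. \<bar>u x - v x\<bar>)" using red_integrable[OF red] iv by auto
  have "(\<integral>x. \<bar>u x - v x\<bar> \<partial>M) \<le> (\<integral>x. \<bar>w (ek (\<kappa> j)) x - u x\<bar> \<partial>M) + (1 / 2) ^ j * (2 * (\<integral>x. H x \<partial>M))" for j
  proof -
    note iw = red_w(1)[OF red ek]
    have "(\<integral>x. \<bar>u x - v x\<bar> \<partial>M) \<le> (\<integral>x. \<bar>w (ek (\<kappa> j)) x - u x\<bar> + 2 * (1 / 2) ^ j * H x \<partial>M)"
    proof (rule integral_mono_AE[OF iuv])
      show "AE x in M. \<bar>u x - v x\<bar> \<le> \<bar>w (ek (\<kappa> j)) x - u x\<bar> + 2 * (1 / 2) ^ j * H x"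
        using close[of j] by eventually_elim linarith
    qed (use iw red_integrable[OF red] iH in auto)
    also have "\<dots> = (\<integral>x. \<bar>w (ek (\<kappa> j)) x - u x\<bar> \<partial>M) + (1 / 2) ^ j * (2 * (\<integral>x. H x \<partial>M))"
      using iw red_integrable[OF red] iH by simp
    finally show ?thesis .
  qed
  hence "(\<integral>x. \<bar>u x - v x\<bar> \<partial>M) \<le> 0 + 0 * (2 * (\<integral>x. H x \<partial>M))"
    by (intro LIMSEQ_le_const[OF tendsto_add[OF l1 l2]]) auto
  moreover have "0 \<le> (\<integral>x. \<bar>u x - v x\<bar> \<partial>M)" by (rule Bochner_Integration.integral_nonneg) simp
  ultimately have "(\<integral>x. \<bar>u x - v x\<bar> \<partial>M) = 0" by simp
  hence "AE x in M. \<bar>u x - v x\<bar> = 0"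
    using iuv by (subst (asm) integral_nonneg_eq_0_iff_AE) auto
  thus ?thesis by eventually_elim simp
qed

end

section \<open>The coefficients of a measure\<close>

context reduction_setting
begin

lemma emeasure_M_pos: "emeasure M \<Omega> \<noteq> 0"
proof
  assume 0: "emeasure M \<Omega> = 0"
  obtain y where y: "y \<in> \<Omega>" using nonempty_\<Omega> by auto
  obtain r where r: "0 < r" "ball y r \<subseteq> \<Omega>" using open_\<Omega> y open_contains_ball by blast
  have "emeasure M (ball y r) \<le> emeasure M \<Omega>" by (rule emeasure_mono[OF r(2)]) simp
  hence "ennreal (unit_ball_vol CARD('n) * r ^ CARD('n)) = 0"
    using emeasure_M_ball(2)[OF r] 0 by simp
  moreover have "0 < unit_ball_vol CARD('n) * r ^ CARD('n)" using r by simp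
  ultimately show False by (simp add: ennreal_eq_0_iff)
qed

lemma green_fun_scale: "\<G> (\<lambda>y. k * f y) x = k * \<G> f x"
  unfolding green_fun_def by (simp add: mult.left_commute)

lemma dirac_coefficient_off:
  assumes red: "reduces (dirac \<Omega> x) w u \<alpha>" and x: "x \<in> \<Omega>" and y: "y \<in> S" "y \<noteq> x"
  shows "\<alpha> y = 0"
proof (rule coefficient_zero_no_atom[OF red y(1)])
  have "y \<in> \<Omega>" using y S by auto
  hence "{y} \<in> sets B\<Omega>" by (auto simp: sets_restrict_space intro!: image_eqI[of _ _ "{y}"])
  thus "emeasure (dirac \<Omega> x) {y} = 0" using y x by (simp add: dirac_def)
qed

lemma dirac_identity:
  assumes red: "reduces (dirac \<Omega> x) w u \<alpha>" and x: "x \<in> \<Omega>"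
  shows "AE t in M. u t = (1 - (if x \<in> S then \<alpha> x else 0)) * G t x - \<G> (\<lambda>y. Vr y * u y) t"
  using red_identity[OF red] AE_space[of M]
proof eventually_elim
  case (elim t)
  hence t: "t \<in> \<Omega>" by simp
  have "(\<Sum>z\<in>S. \<alpha> z * G t z) = (\<Sum>z\<in>S. if z = x then \<alpha> x * G t x else 0)"
    using dirac_coefficient_off[OF red x] by (intro sum.cong) auto
  also have "\<dots> = (if x \<in> S then \<alpha> x else 0) * G t x" using S by simp
  finally show ?case using elim(1) green_meas_dirac[OF t x] by (simp add: algebra_simps)
qed

lemma solvable_if_coefficient_neq_1:
  assumes red: "reduces (dirac \<Omega> x) w u \<alpha>" and x: "x \<in> \<Omega>" and ne: "(if x \<in> S then \<alpha> x else 0) \<noteq> 1"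
  shows "x \<notin> unsolvable_points \<Omega> G V"
proof -
  define k where "k = 1 / (1 - (if x \<in> S then \<alpha> x else 0))"
  have k: "k * (1 - (if x \<in> S then \<alpha> x else 0)) = 1" using ne by (simp add: k_def)
  have swap: "(\<lambda>y. Vr y * (k * u y)) = (\<lambda>y. k * (Vr y * u y))" by (simp add: mult.left_commute)
  have "green_solution \<Omega> G Vr (dirac \<Omega> x) (\<lambda>y. k * u y)"
    unfolding green_solution_def swap
  proof (intro conjI)
    show "integrable M (\<lambda>y. k * u y)" "integrable M (\<lambda>y. k * (Vr y * u y))"
      using red_integrable[OF red] integrable_Vu[OF red] by auto
    show "AE t in M. k * u t = green_meas G (dirac \<Omega> x) t - \<G> (\<lambda>y. k * (Vr y * u y)) t"
      using dirac_identity[OF red x] AE_space[of M]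
    proof eventually_elim
      case (elim t)
      hence t: "t \<in> \<Omega>" by simp
      have "k * u t = k * (1 - (if x \<in> S then \<alpha> x else 0)) * G t x - k * \<G> (\<lambda>y. Vr y * u y) t"
        unfolding elim(1) mult.assoc by (rule right_diff_distrib)
      thus ?case unfolding k green_fun_scale green_meas_dirac[OF t x] by simp
    qed
  qed
  thus ?thesis unfolding unsolvable_points_def by blast
qed

text \<open>By stability the limit is the solution \<open>v\<close>. The equations of \<open>u\<close> and \<open>v\<close> differ by \<open>\<alpha> x * G t x\<close>, and the
  kernel is positive off the diagonal.\<close>

lemma coefficient_zero_if_solvable:
  assumes red: "reduces (dirac \<Omega> x) w u \<alpha>" and x: "x \<in> S" and solvable: "x \<notin> unsolvable_points \<Omega> G V"
  shows "\<alpha> x = 0"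
proof (rule ccontr)
  assume ne: "\<alpha> x \<noteq> 0"
  have x\<Omega>: "x \<in> \<Omega>" using x S by auto
  obtain v where v: "green_solution \<Omega> G Vr (dirac \<Omega> x) v"
    using solvable x\<Omega> unfolding unsolvable_points_def by blast
  have sv: "sol Vr (green_meas G (dirac \<Omega> x)) v" using v by (simp add: green_solution_iff_sol)
  have uv: "AE t in M. u t = v t" by (rule stability[OF red sv])
  have iVv: "integrable M (\<lambda>y. Vr y * v y)" using sv by (simp add: sol_def)
  have veq: "AE t in M. v t = green_meas G (dirac \<Omega> x) t - \<G> (\<lambda>y. Vr y * v y) t"
    using sv by (simp add: sol_def)
  have "AE t in M. False"
    using dirac_identity[OF red x\<Omega>] uv veq AE_neq_point[OF \<Omega>_sets(2), of x] AE_space[of M]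
  proof eventually_elim
    case (elim t)
    hence t: "t \<in> \<Omega>" by simp
    have "\<G> (\<lambda>y. Vr y * u y) t = \<G> (\<lambda>y. Vr y * v y) t"
    proof (rule green_fun_cong_AE[OF _ _ _ t])
      show "AE y in M. Vr y * u y = Vr y * v y" using uv by eventually_elim simp
    qed (use borel_measurable_integrable[OF iVv] borel_measurable_integrable[OF integrable_Vu[OF red]] in auto)
    hence "\<alpha> x * G t x = 0"
      using elim(1,2,3) x green_meas_dirac[OF t x\<Omega>] by (simp add: algebra_simps)
    thus False using ne G_pos[OF t x\<Omega> elim(4)] by simp
  qed
  hence "emeasure M (space M) = 0"
    by (simp add: AE_iff_measurable[OF sets.top[of M]])
  thus False using emeasure_M_pos by simp
qed

text \<open>Outside \<open>S\<close> there is no coefficient, and \<open>u\<close> itself solves the equation with datum \<open>\<delta>\<^sub>x\<close>.\<close>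

lemma unsolvable_subset: "unsolvable_points \<Omega> G V \<subseteq> S"
proof
  fix x assume x: "x \<in> unsolvable_points \<Omega> G V"
  hence x\<Omega>: "x \<in> \<Omega>" by (simp add: unsolvable_points_def)
  from ex_reduces[OF dirac_nonneg[OF x\<Omega>]] obtain w u \<alpha> where red: "reduces (dirac \<Omega> x) w u \<alpha>"
    by (elim exE)
  show "x \<in> S"
  proof (rule ccontr)
    assume "x \<notin> S"
    hence "(if x \<in> S then \<alpha> x else 0) \<noteq> 1" by simp
    from solvable_if_coefficient_neq_1[OF red x\<Omega> this] x show False by blast
  qed
qed

lemma coefficient_eq:
  assumes red: "reduces \<nu> w u \<alpha>" and x: "x \<in> S"
  shows "\<alpha> x = (if x \<in> unsolvable_points \<Omega> G V then measure \<nu> {x} else 0)"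
proof -
  note \<nu> = red_nonneg[OF red]
  note n = nonneg_measuresD[OF \<nu>]
  interpret \<nu>: finite_measure \<nu> by (rule n)
  have x\<Omega>: "x \<in> \<Omega>" using x S by auto
  have xs: "{x} \<in> sets \<nu>" using x\<Omega> by (auto simp: n(1) sets_restrict_space intro!: image_eqI[of _ _ "{x}"])
  let ?f1 = "indicator {x} :: real^'n \<Rightarrow> ennreal" and ?f2 = "indicator (\<Omega> - {x}) :: real^'n \<Rightarrow> ennreal"
  have s2: "\<Omega> - {x} \<in> sets \<nu>" using sets.compl_sets[OF xs] n(2) by simp
  have m: "?f1 \<in> borel_measurable \<nu>" "?f2 \<in> borel_measurable \<nu>" using xs s2 by auto
  have fin: "(\<integral>\<^sup>+y. ?f1 y \<partial>\<nu>) < \<infinity>" "(\<integral>\<^sup>+y. ?f2 y \<partial>\<nu>) < \<infinity>"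
    using xs s2 by (auto simp: \<nu>.emeasure_eq_measure)
  from ex_reduces[OF dirac_nonneg[OF x\<Omega>]] obtain wd ud ad where redd: "reduces (dirac \<Omega> x) wd ud ad"
    by (elim exE)
  from ex_reduces[OF push_nonneg[OF n(4) m(2) fin(2)]] obtain wr ur ar
    where redr: "reduces (push \<nu> ?f2) wr ur ar" by (elim exE)
  have "AE t in M. green_meas G (push \<nu> (\<lambda>_. 1)) t = 1 * green_meas G (push \<nu> ?f1) t + 1 * green_meas G (push \<nu> ?f2) t"
    by (rule green_meas_push_linear[OF n(4) m(1) fin(1) m(2) fin(2)]) (auto simp: n(2) indicator_def)
  hence lin: "AE t in M. green_meas G \<nu> t = measure \<nu> {x} * green_meas G (dirac \<Omega> x) t + 1 * green_meas G (push \<nu> ?f2) t"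
    using AE_space[of M]
  proof eventually_elim
    case (elim t)
    hence t: "t \<in> \<Omega>" by simp
    have "(\<integral>\<^sup>+y. ?f1 y * G t y \<partial>\<nu>) = (\<integral>\<^sup>+y. ennreal (G t x) * ?f1 y \<partial>\<nu>)"
      by (intro nn_integral_cong) (auto simp: indicator_def)
    also have "\<dots> = ennreal (G t x) * ennreal (measure \<nu> {x})"
      using xs by (subst nn_integral_cmult_indicator) (auto simp: \<nu>.emeasure_eq_measure)
    finally have "green_meas G (push \<nu> ?f1) t = G t x * measure \<nu> {x}"
      using G_nonneg[OF t x\<Omega>] by (simp add: green_meas_push[OF n(4) m(1) t] enn2real_mult)
    thus ?case using elim(1) green_meas_eq_push[OF \<nu> t] green_meas_dirac[OF t x\<Omega>] by (simp add: mult.commute)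
  qed
  have "ar x = 0"
  proof (rule coefficient_zero_no_atom[OF redr x])
    have xb: "{x} \<in> sets B\<Omega>" using xs n(1) by simp
    have "(\<integral>\<^sup>+y. indicator {x} y \<partial>push \<nu> ?f2) = (\<integral>\<^sup>+y. ?f2 y * indicator {x} y \<partial>\<nu>)"
      using xb by (intro nn_integral_push[OF n(4) m(2)]) simp
    also have "\<dots> = (\<integral>\<^sup>+y. 0 \<partial>\<nu>)" by (intro nn_integral_cong) (simp add: indicator_def)
    finally show "emeasure (push \<nu> ?f2) {x} = 0" using xb by (simp add: push_def)
  qed
  hence 1: "\<alpha> x = measure \<nu> {x} * ad x"
    using coefficient_linear[OF redd redr red lin x] by simp
  show ?thesis
  proof (cases "x \<in> unsolvable_points \<Omega> G V")
    case True
    hence "ad x = 1" using solvable_if_coefficient_neq_1[OF redd x\<Omega>] x by auto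
    thus ?thesis using 1 True by simp
  next
    case False
    thus ?thesis using 1 coefficient_zero_if_solvable[OF redd x False] by simp
  qed
qed

lemma reduction_coeff_eq:
  assumes \<nu>: "\<nu> \<in> nonneg_measures \<Omega>" and x: "x \<in> S"
  shows "reduction_coeff \<Omega> \<gamma> G V S \<nu> x = (if x \<in> unsolvable_points \<Omega> G V then measure \<nu> {x} else 0)"
proof -
  have "\<exists>\<alpha> u. reduction_limit \<Omega> \<gamma> G V S \<nu> u \<alpha>" using reduction[OF \<nu>] by blast
  from someI_ex[OF this] obtain u where "reduction_limit \<Omega> \<gamma> G V S \<nu> u (reduction_coeff \<Omega> \<gamma> G V S \<nu>)"
    unfolding reduction_coeff_def by (elim exE)
  then obtain w where "reduces \<nu> w u (reduction_coeff \<Omega> \<gamma> G V S \<nu>)"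
    unfolding reduction_limit_iff[OF \<nu>] by (elim exE)
  from coefficient_eq[OF this x] show ?thesis .
qed

end

section \<open>The positive part of a signed measure\<close>

lemma ennreal_add_le: "ennreal (a + b) \<le> ennreal a + ennreal b"
proof -
  have "ennreal (a + b) \<le> ennreal (max 0 a + max 0 b)" by (intro ennreal_leI) auto
  also have "\<dots> = ennreal (max 0 a) + ennreal (max 0 b)" by (rule ennreal_plus) auto
  also have "\<dots> = ennreal a + ennreal b" by (simp add: max_def ennreal_neg)
  finally show ?thesis .
qed

lemma ennreal_sum_le: "ennreal (sum f {..<n}) \<le> (\<Sum>i<n::nat. ennreal (f i))"
proof (induction n)
  case (Suc n)
  have "ennreal (sum f {..<Suc n}) \<le> ennreal (sum f {..<n}) + ennreal (f n)"
    using ennreal_add_le by simp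
  also have "\<dots> \<le> (\<Sum>i<n. ennreal (f i)) + ennreal (f n)" by (rule add_right_mono[OF Suc.IH])
  finally show ?case by simp
qed simp

locale signed_measure =
  fixes \<Omega> :: "(real^'n) set" and \<mu> :: "(real^'n) set \<Rightarrow> real"
  assumes \<Omega>_borel: "\<Omega> \<in> sets borel" and signed: "\<mu> \<in> signed_measures \<Omega>"
begin

abbreviation \<A> :: "(real^'n) set set" where "\<A> \<equiv> sets (restrict_space borel \<Omega>)"

definition pos_var :: "(real^'n) set \<Rightarrow> ennreal" where
  "pos_var X = (SUP B \<in> {B \<in> \<A>. B \<subseteq> X}. ennreal (\<mu> B))"

lemma top_\<A>: "\<Omega> \<in> \<A>" "X \<in> \<A> \<Longrightarrow> X \<subseteq> \<Omega>"
  using sets.top[of "restrict_space borel \<Omega>"] sets.sets_into_space[of X "restrict_space borel \<Omega>"]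
  by (auto simp: space_restrict_space)

lemma sums_UN: "range D \<subseteq> \<A> \<Longrightarrow> disjoint_family D \<Longrightarrow> (\<lambda>i::nat. \<mu> (D i)) sums \<mu> (\<Union>i. D i)"
  using signed unfolding signed_measures_def by blast

lemma empty: "\<mu> {} = 0"
proof -
  have "(\<lambda>i::nat. \<mu> ((\<lambda>_. {}) i)) sums \<mu> (\<Union>i::nat. {})"
    by (rule sums_UN) (auto simp: disjoint_family_on_def)
  hence "summable (\<lambda>i::nat. \<mu> {})" by (simp add: sums_iff)
  thus ?thesis by (simp add: summable_const_iff)
qed

lemma additive: "X \<in> \<A> \<Longrightarrow> Y \<in> \<A> \<Longrightarrow> X \<inter> Y = {} \<Longrightarrow> \<mu> (X \<union> Y) = \<mu> X + \<mu> Y"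
proof -
  assume *: "X \<in> \<A>" "Y \<in> \<A>" "X \<inter> Y = {}"
  have "(\<lambda>i. \<mu> (binaryset X Y i)) sums \<mu> (\<Union>i. binaryset X Y i)"
    by (rule sums_UN) (use * in \<open>auto simp: disjoint_family_on_def binaryset_def\<close>)
  moreover have "(\<lambda>i. \<mu> (binaryset X Y i)) sums (\<mu> X + \<mu> Y)"
    by (rule binaryset_sums) (rule empty)
  ultimately show ?thesis using sums_unique2 by (metis UN_binaryset_eq)
qed

lemma diff: "X \<in> \<A> \<Longrightarrow> Y \<in> \<A> \<Longrightarrow> Y \<subseteq> X \<Longrightarrow> \<mu> (X - Y) = \<mu> X - \<mu> Y"
  using additive[of Y "X - Y"] by (simp add: Un_absorb1)

lemma pos_var_upper: "B \<in> \<A> \<Longrightarrow> B \<subseteq> X \<Longrightarrow> ennreal (\<mu> B) \<le> pos_var X"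
  unfolding pos_var_def by (rule SUP_upper) simp

lemma pos_var_least: "(\<And>B. B \<in> \<A> \<Longrightarrow> B \<subseteq> X \<Longrightarrow> ennreal (\<mu> B) \<le> c) \<Longrightarrow> pos_var X \<le> c"
  unfolding pos_var_def by (rule SUP_least) simp

lemma pos_var_mono: "X \<subseteq> Y \<Longrightarrow> pos_var X \<le> pos_var Y"
  by (intro pos_var_least pos_var_upper) auto

lemma pos_var_empty: "pos_var {} = 0"
  using pos_var_least[of "{}" 0] by (auto simp: empty)

text \<open>In the extended nonnegative reals a subset of negative measure counts as \<open>0\<close>; such a subset is
  replaced by the empty set before two subsets are united.\<close>

lemma pos_var_superadditive:
  assumes "X \<inter> Y = {}"
  shows "pos_var X + pos_var Y \<le> pos_var (X \<union> Y)"
proof (cases "pos_var (X \<union> Y) = top")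
  case False
  have ne: "{B \<in> \<A>. B \<subseteq> Z} \<noteq> {}" for Z by auto
  have 1: "ennreal (\<mu> B) + pos_var Y \<le> pos_var (X \<union> Y)" if B: "B \<in> \<A>" "B \<subseteq> X" for B
  proof -
    have "ennreal (\<mu> B) + ennreal (\<mu> C) \<le> pos_var (X \<union> Y)" if C: "C \<in> \<A>" "C \<subseteq> Y" for C
    proof -
      have BC: "B \<union> C \<in> \<A>" using B C by auto
      have eq: "\<mu> (B \<union> C) = \<mu> B + \<mu> C" using B C assms by (intro additive) auto
      consider "0 \<le> \<mu> B" "0 \<le> \<mu> C" | "\<mu> B < 0" | "\<mu> C < 0" by linarith
      thus ?thesis
      proof cases
        case 1
        hence "ennreal (\<mu> B) + ennreal (\<mu> C) = ennreal (\<mu> (B \<union> C))" by (simp add: eq)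
        also have "\<dots> \<le> pos_var (X \<union> Y)" using BC B C by (intro pos_var_upper) auto
        finally show ?thesis .
      next
        case 2
        hence "ennreal (\<mu> B) + ennreal (\<mu> C) = ennreal (\<mu> C)" by (simp add: ennreal_neg)
        also have "\<dots> \<le> pos_var (X \<union> Y)" using C by (intro pos_var_upper) auto
        finally show ?thesis .
      next
        case 3
        hence "ennreal (\<mu> B) + ennreal (\<mu> C) = ennreal (\<mu> B)" by (simp add: ennreal_neg)
        also have "\<dots> \<le> pos_var (X \<union> Y)" using B by (intro pos_var_upper) auto
        finally show ?thesis .
      qed
    qed
    hence "(SUP C \<in> {C \<in> \<A>. C \<subseteq> Y}. ennreal (\<mu> B) + ennreal (\<mu> C)) \<le> pos_var (X \<union> Y)"
      by (intro SUP_least) auto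
    thus ?thesis unfolding pos_var_def[of Y] using ennreal_SUP_add_right[OF ne, of "ennreal (\<mu> B)"] by simp
  qed
  hence "(SUP B \<in> {B \<in> \<A>. B \<subseteq> X}. ennreal (\<mu> B) + pos_var Y) \<le> pos_var (X \<union> Y)"
    by (intro SUP_least) auto
  thus ?thesis unfolding pos_var_def[of X] using ennreal_SUP_add_left[OF ne] by simp
qed simp

lemma pos_var_countably_additive: "countably_additive \<A> pos_var"
proof (rule countably_additiveI)
  fix D :: "nat \<Rightarrow> (real^'n) set"
  assume D: "range D \<subseteq> \<A>" "disjoint_family D" "(\<Union>i. D i) \<in> \<A>"
  show "(\<Sum>i. pos_var (D i)) = pos_var (\<Union>i. D i)"
  proof (rule antisym)
    have partial: "sum (\<lambda>i. pos_var (D i)) {..<n} \<le> pos_var (\<Union>i<n. D i)" for n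
    proof (induction n)
      case (Suc n)
      have "D i \<inter> D n = {}" if "i < n" for i
        by (rule disjoint_family_onD[OF D(2)]) (use that in auto)
      hence "(\<Union>i<n. D i) \<inter> D n = {}" by blast
      from pos_var_superadditive[OF this] have "pos_var (\<Union>i<n. D i) + pos_var (D n) \<le> pos_var (\<Union>i<Suc n. D i)"
        by (simp add: lessThan_Suc Un_commute)
      with add_right_mono[OF Suc.IH, of "pos_var (D n)"]
      have "sum (\<lambda>i. pos_var (D i)) {..<n} + pos_var (D n) \<le> pos_var (\<Union>i<Suc n. D i)" by (rule order_trans)
      thus ?case by simp
    qed (simp add: pos_var_empty)
    have "sum (\<lambda>i. pos_var (D i)) {..<n} \<le> pos_var (\<Union>i. D i)" for n
      by (rule order_trans[OF partial pos_var_mono]) auto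
    thus "(\<Sum>i. pos_var (D i)) \<le> pos_var (\<Union>i. D i)" by (intro suminf_le_const summableI)
    show "pos_var (\<Union>i. D i) \<le> (\<Sum>i. pos_var (D i))"
    proof (rule pos_var_least)
      fix B assume B: "B \<in> \<A>" "B \<subseteq> (\<Union>i. D i)"
      have "(\<lambda>i. \<mu> (B \<inter> D i)) sums \<mu> (\<Union>i. B \<inter> D i)"
      proof (rule sums_UN)
        show "range (\<lambda>i. B \<inter> D i) \<subseteq> \<A>" using B D by auto
        show "disjoint_family (\<lambda>i. B \<inter> D i)" using D(2) unfolding disjoint_family_on_def by blast
      qed
      moreover have "(\<Union>i. B \<inter> D i) = B" using B by blast
      ultimately have "(\<lambda>n. \<Sum>i<n. \<mu> (B \<inter> D i)) \<longlonglongrightarrow> \<mu> B" by (simp add: sums_def)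
      hence "(\<lambda>n. ennreal (\<Sum>i<n. \<mu> (B \<inter> D i))) \<longlonglongrightarrow> ennreal (\<mu> B)" by (rule tendsto_ennrealI)
      moreover have "ennreal (\<Sum>i<n. \<mu> (B \<inter> D i)) \<le> (\<Sum>i. pos_var (D i))" for n
      proof -
        have "ennreal (\<Sum>i<n. \<mu> (B \<inter> D i)) \<le> (\<Sum>i<n. ennreal (\<mu> (B \<inter> D i)))" by (rule ennreal_sum_le)
        also have "\<dots> \<le> (\<Sum>i<n. pos_var (D i))" using B D by (intro sum_mono pos_var_upper) auto
        also have "\<dots> \<le> (\<Sum>i. pos_var (D i))" by (intro sum_le_suminf summableI) auto
        finally show ?thesis .
      qed
      ultimately show "ennreal (\<mu> B) \<le> (\<Sum>i. pos_var (D i))"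
        by (intro LIMSEQ_le_const2) auto
    qed
  qed
qed

text \<open>A subset \<open>E\<close> with \<open>\<mu> E > \<bar>\<mu> X\<bar> + \<bar>N\<bar>\<close> and its complement in \<open>X\<close> both have measure of absolute value at least
  \<open>N\<close>, and one of the two again has infinite positive variation.\<close>

lemma pos_var_infinite_step:
  assumes X: "X \<in> \<A>" "pos_var X = top"
  shows "\<exists>Y. (Y \<in> \<A> \<and> pos_var Y = top \<and> N \<le> \<bar>\<mu> Y\<bar>) \<and> Y \<subseteq> X"
proof -
  have "ennreal (\<bar>\<mu> X\<bar> + \<bar>N\<bar>) < pos_var X" using X by simp
  then obtain E where E: "E \<in> \<A>" "E \<subseteq> X" "ennreal (\<bar>\<mu> X\<bar> + \<bar>N\<bar>) < ennreal (\<mu> E)"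
    unfolding pos_var_def less_SUP_iff by auto
  have big: "\<bar>\<mu> X\<bar> + \<bar>N\<bar> < \<mu> E" using E(3) by (subst (asm) ennreal_less_iff) auto
  have XE: "X - E \<in> \<A>" using X E by auto
  have "pos_var X \<le> pos_var E + pos_var (X - E)"
  proof (rule pos_var_least)
    fix B assume B: "B \<in> \<A>" "B \<subseteq> X"
    have "\<mu> ((B \<inter> E) \<union> (B - E)) = \<mu> (B \<inter> E) + \<mu> (B - E)" using B E by (intro additive) auto
    moreover have "(B \<inter> E) \<union> (B - E) = B" by blast
    ultimately have "ennreal (\<mu> B) \<le> ennreal (\<mu> (B \<inter> E)) + ennreal (\<mu> (B - E))"
      using ennreal_add_le by simp
    also have "\<dots> \<le> pos_var E + pos_var (X - E)" using B E by (intro add_mono pos_var_upper) auto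
    finally show "ennreal (\<mu> B) \<le> pos_var E + pos_var (X - E)" .
  qed
  hence "pos_var E + pos_var (X - E) = top" using X by (simp add: top_unique)
  then consider "pos_var E = top" | "pos_var (X - E) = top" by (auto simp: ennreal_add_eq_top)
  thus ?thesis
  proof cases
    case 1
    thus ?thesis using E big by (intro exI[of _ E]) auto
  next
    case 2
    have "\<mu> (X - E) = \<mu> X - \<mu> E" by (rule diff[OF X(1) E(1,2)])
    hence "N \<le> \<bar>\<mu> (X - E)\<bar>" using big by linarith
    thus ?thesis using 2 XE by (intro exI[of _ "X - E"]) auto
  qed
qed

text \<open>Otherwise there is a decreasing sequence \<open>Y\<close> along which \<open>\<bar>\<mu>\<bar>\<close> is unbounded. But \<open>\<mu> (Y n)\<close> converges, because
  the differences \<open>Y n - Y (Suc n)\<close> are disjoint and their measures form a telescoping convergent series.\<close>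

lemma pos_var_finite: "pos_var \<Omega> \<noteq> top"
proof
  assume "pos_var \<Omega> = top"
  hence "\<exists>Y. Y \<in> \<A> \<and> pos_var Y = top \<and> real 0 \<le> \<bar>\<mu> Y\<bar>" using top_\<A> by auto
  from dependent_nat_choice[of "\<lambda>n Y. Y \<in> \<A> \<and> pos_var Y = top \<and> real n \<le> \<bar>\<mu> Y\<bar>" "\<lambda>n X Y. Y \<subseteq> X", OF this]
  obtain Y where Y: "\<And>n. Y n \<in> \<A>" "\<And>n. real n \<le> \<bar>\<mu> (Y n)\<bar>" "\<And>n. Y (Suc n) \<subseteq> Y n"
    using pos_var_infinite_step by metis
  have anti: "Y m \<subseteq> Y n" if "n \<le> m" for n m
    using lift_Suc_antimono_le[of Y, OF Y(3) that] .
  let ?D = "\<lambda>n. Y n - Y (Suc n)"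
  have "(\<lambda>n. \<mu> (?D n)) sums \<mu> (\<Union>n. ?D n)"
  proof (rule sums_UN)
    show "range ?D \<subseteq> \<A>" using Y by auto
    show "disjoint_family ?D"
      unfolding disjoint_family_on_def
    proof (intro ballI impI)
      fix m n :: nat assume "m \<noteq> n"
      thus "?D m \<inter> ?D n = {}"
        using anti[of "Suc m" n] anti[of "Suc n" m] by (cases "m < n") auto
    qed
  qed
  hence "(\<lambda>n. \<Sum>i<n. \<mu> (?D i)) \<longlonglongrightarrow> \<mu> (\<Union>n. ?D n)" by (simp add: sums_def)
  moreover have "(\<Sum>i<n. \<mu> (?D i)) = \<mu> (Y 0) - \<mu> (Y n)" for n
    by (induction n) (simp_all add: diff[OF Y(1) Y(1) Y(3)])
  ultimately have "(\<lambda>n. \<mu> (Y 0) - (\<mu> (Y 0) - \<mu> (Y n))) \<longlonglongrightarrow> \<mu> (Y 0) - \<mu> (\<Union>n. ?D n)"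
    by (intro tendsto_diff tendsto_const) simp
  hence "convergent (\<lambda>n. \<mu> (Y n))" by (auto simp: convergent_def)
  hence "Bseq (\<lambda>n. \<mu> (Y n))" by (rule convergent_imp_Bseq)
  then obtain K where K: "\<And>n. \<bar>\<mu> (Y n)\<bar> \<le> K" by (auto simp: Bseq_def)
  obtain n :: nat where "K < real n" using reals_Archimedean2 by blast
  thus False using K[of n] Y(2)[of n] by linarith
qed

lemma sets_pos_part: "sets (pos_part \<Omega> \<mu>) = \<A>"
  unfolding pos_part_def
  using sets.space_closed[of "restrict_space borel \<Omega>"] sets.sigma_sets_eq[of "restrict_space borel \<Omega>"]
  by (simp add: space_restrict_space sets_measure_of)

lemma emeasure_pos_part: "X \<in> \<A> \<Longrightarrow> emeasure (pos_part \<Omega> \<mu>) X = pos_var X"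
  unfolding pos_part_def pos_var_def[symmetric, abs_def]
proof (rule emeasure_measure_of_sigma)
  show "sigma_algebra \<Omega> \<A>"
    using sets.sigma_algebra_axioms[of "restrict_space borel \<Omega>"] by (simp add: space_restrict_space)
  show "positive \<A> pos_var" by (simp add: positive_def pos_var_empty)
qed (rule pos_var_countably_additive)

lemma pos_part_nonneg: "pos_part \<Omega> \<mu> \<in> nonneg_measures \<Omega>"
proof -
  have "space (pos_part \<Omega> \<mu>) = \<Omega>"
    using sets_eq_imp_space_eq[of "pos_part \<Omega> \<mu>" "restrict_space borel \<Omega>"] sets_pos_part
    by (simp add: space_restrict_space)
  hence "finite_measure (pos_part \<Omega> \<mu>)"
    using emeasure_pos_part[OF top_\<A>(1)] pos_var_finite by (intro finite_measureI) simp
  thus ?thesis using sets_pos_part by (simp add: nonneg_measures_def)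
qed

lemma measure_pos_part_singleton: "x \<in> \<Omega> \<Longrightarrow> measure (pos_part \<Omega> \<mu>) {x} = max 0 (\<mu> {x})"
proof -
  assume x: "x \<in> \<Omega>"
  have xs: "{x} \<in> \<A>" using x by (auto simp: sets_restrict_space intro!: image_eqI[of _ _ "{x}"])
  have "{B \<in> \<A>. B \<subseteq> {x}} = {{}, {x}}" using xs by auto
  hence "pos_var {x} = sup (ennreal (\<mu> {})) (ennreal (\<mu> {x}))" unfolding pos_var_def by simp
  also have "\<dots> = ennreal (max 0 (\<mu> {x}))" by (simp add: empty max_def ennreal_neg sup_absorb2 sup_absorb1)
  finally show ?thesis using emeasure_pos_part[OF xs] by (simp add: measure_def)
qed

end

lemma uminus_signed_measures: "\<mu> \<in> signed_measures \<Omega> \<Longrightarrow> (\<lambda>A. - \<mu> A) \<in> signed_measures \<Omega>"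
  unfolding signed_measures_def by (auto intro: sums_minus)

section \<open>The reduced measure\<close>

theorem theorem8p2:
  fixes \<Omega> S :: "(real^'n) set"
    and s \<gamma> :: real
    and G :: "real^'n \<Rightarrow> real^'n \<Rightarrow> real"
    and V :: "real^'n \<Rightarrow> ennreal"
    and \<mu> :: "(real^'n) set \<Rightarrow> real"
  assumes dim: "CARD('n) \<ge> 3"
    and s: "0 < s" "s \<le> 1"
    and \<gamma>: "0 < \<gamma>" "\<gamma> \<le> 1"
    and domain: "open \<Omega>" "connected \<Omega>" "\<Omega> \<noteq> {}" "bounded \<Omega>"
    and kernel: "green_kernel \<Omega> s \<gamma> G"
    and S: "finite S" "S \<subseteq> \<Omega>"
    and V: "admissible_potential \<Omega> S V"
    and reduction: "\<And>\<nu>. \<nu> \<in> nonneg_measures \<Omega> \<Longrightarrow> \<exists>u \<alpha>. reduction_limit \<Omega> \<gamma> G V S \<nu> u \<alpha>"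
    and \<mu>: "\<mu> \<in> signed_measures \<Omega>"
  shows "reduced_measure \<Omega> \<gamma> G V S \<mu> =
    (\<lambda>A. \<mu> A - (\<Sum>\<^sub>\<infinity>x\<in>unsolvable_points \<Omega> G V. \<mu> {x} * measure (dirac \<Omega> x) A))"
proof -
  obtain c C where cC: "0 < c" "c \<le> C"
    "\<And>x y. x \<in> \<Omega> \<Longrightarrow> y \<in> \<Omega> \<Longrightarrow> x \<noteq> y \<Longrightarrow> c * model_kernel \<Omega> s \<gamma> x y \<le> G x y"
    "\<And>x y. x \<in> \<Omega> \<Longrightarrow> y \<in> \<Omega> \<Longrightarrow> x \<noteq> y \<Longrightarrow> G x y \<le> C * model_kernel \<Omega> s \<gamma> x y"
    using kernel unfolding green_kernel_def by meson
  interpret reduction_setting \<Omega> s \<gamma> G c C "real CARD('n) - 2 * s" V S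
  proof
    show "3 \<le> CARD('n)" by (rule dim)
    show "(\<lambda>(x, y). G x y) \<in> borel_measurable (restrict_space borel (\<Omega> \<times> \<Omega>))"
      using kernel by (simp add: green_kernel_def)
    show "0 \<le> G x y" "G x y = G y x" if "x \<in> \<Omega>" "y \<in> \<Omega>" for x y
      using kernel that unfolding green_kernel_def by blast+
    show "0 \<le> (\<integral>x. f x * green_fun \<Omega> G f x \<partial>lebesgue_on \<Omega>)"
      if "f \<in> borel_measurable (lebesgue_on \<Omega>)" "integrable (lebesgue_on \<Omega>) (\<lambda>x. (f x)\<^sup>2)" for f
      using kernel that unfolding green_kernel_def by blast
    show "\<exists>g. continuous_on (closure \<Omega>) g \<and> (\<forall>x\<in>\<Omega>. g x = green_fun \<Omega> G f x)"
      if "f \<in> borel_measurable (lebesgue_on \<Omega>)" "AE x in lebesgue_on \<Omega>. \<bar>f x\<bar> \<le> B" for f B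
      using kernel that unfolding green_kernel_def by blast
    show "\<exists>u \<alpha>. reduction_limit \<Omega> \<gamma> G V S \<nu> u \<alpha>" if "\<nu> \<in> nonneg_measures \<Omega>" for \<nu>
      by (rule reduction[OF that])
  qed (use s \<gamma> domain cC S V in auto)
  interpret pos: signed_measure \<Omega> \<mu>
    using \<mu> domain by unfold_locales auto
  interpret neg: signed_measure \<Omega> "\<lambda>A. - \<mu> A"
    using uminus_signed_measures[OF \<mu>] domain by unfold_locales auto
  let ?Z = "unsolvable_points \<Omega> G V"
  have coeff: "reduction_coeff \<Omega> \<gamma> G V S (pos_part \<Omega> \<mu>) x - reduction_coeff \<Omega> \<gamma> G V S (neg_part \<Omega> \<mu>) x
      = (if x \<in> ?Z then \<mu> {x} else 0)" if x: "x \<in> S" for x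
  proof -
    have "x \<in> \<Omega>" using x S by auto
    thus ?thesis
      unfolding neg_part_def reduction_coeff_eq[OF pos.pos_part_nonneg x] reduction_coeff_eq[OF neg.pos_part_nonneg x]
      by (simp add: pos.measure_pos_part_singleton neg.measure_pos_part_singleton max_def)
  qed
  show ?thesis
  proof
    fix A
    have "(\<Sum>x\<in>S. (reduction_coeff \<Omega> \<gamma> G V S (pos_part \<Omega> \<mu>) x
        - reduction_coeff \<Omega> \<gamma> G V S (neg_part \<Omega> \<mu>) x) * measure (dirac \<Omega> x) A)
      = (\<Sum>x\<in>S. if x \<in> ?Z then \<mu> {x} * measure (dirac \<Omega> x) A else 0)"
      by (intro sum.cong refl) (simp add: coeff)
    also have "\<dots> = (\<Sum>x\<in>S \<inter> ?Z. \<mu> {x} * measure (dirac \<Omega> x) A)"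
      using S(1) by (rule sum.inter_restrict[symmetric])
    also have "S \<inter> ?Z = ?Z" using unsolvable_subset by blast
    also have "(\<Sum>x\<in>?Z. \<mu> {x} * measure (dirac \<Omega> x) A) = (\<Sum>\<^sub>\<infinity>x\<in>?Z. \<mu> {x} * measure (dirac \<Omega> x) A)"
      using finite_subset[OF unsolvable_subset S(1)] by (rule infsum_finite[symmetric])
    finally show "reduced_measure \<Omega> \<gamma> G V S \<mu> A
        = \<mu> A - (\<Sum>\<^sub>\<infinity>x\<in>?Z. \<mu> {x} * measure (dirac \<Omega> x) A)"
      by (simp add: reduced_measure_def)
  qed
qed

end
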